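(* Let $G=(V,E)$ be a directed graph with $n$ nodes, $m$ edges and average degree $\bar d=m/n$, and let $c\in(0,1)$. Assume that the out-degree distribution of $G$ follows a power law with exponent $\gamma\ge1$ (in the sense given in the context), and let $\varepsilon\ge \log^{\frac{\gamma-1}{2-\gamma}} n\,/\,\bigl(n^{\frac{\gamma-1}{\gamma}}\bar d^{\,2-\gamma}\bigr)$ and $\delta>1/n^{\Omega(1)}$. Suppose the query node $u$ is chosen uniformly at random from $V$. With the number of hub nodes set to $j_0=n(\varepsilon\bar d)^{\frac{\gamma}{\gamma-1}}$, the expected cost of the PRSim Query Algorithm (described in the context) satisfies $\mathrm{E}[C]=O\!\left(\frac1{\varepsilon^2}\log\frac n\delta\right)$ for $\gamma>2$; $\mathrm{E}[C]=O\!\left(\frac1{\varepsilon^2}\log\frac n\delta\log n\right)$ for $\gamma=2$; and $\mathrm{E}[C]=O\!\left(\min\left\{\frac{n^{1/\gamma}}{\varepsilon^{2-1/\gamma}},\frac{n^{2/\gamma-1}}{\varepsilon^2}\right\}\right)$ for $1<\gamma<2$. Moreover, the index generated by the Preprocessing Algorithm has size $O(m)$ and the preprocessing time is $O(m/\varepsilon)$.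
   Context: For $v\in V$, $\mathcal{I}(v)$, $\mathcal{O}(v)$ are in-/out-neighbor sets, $d_{in}(v)=|\mathcal I(v)|$. A $\sqrt{c}$-walk from $u$ starts at $u$ and at each step either terminates with probability $1-\sqrt{c}$ or, with probability $\sqrt{c}$, moves to a uniformly random in-neighbor. Two walks meet if they are at the same node after the same number of steps. $\pi_\ell(u,w)$ is the probability that a $\sqrt{c}$-walk from $u$ terminates at $w$ after exactly $\ell$ steps; $\pi(w)=\frac1n\sum_u\sum_\ell\pi_\ell(u,w)$ is the reverse PageRank. Order nodes as $w_1,\dots,w_n$ with $\pi(w_1)\ge\dots\ge\pi(w_n)$; $w_1,\dots,w_{j_0}$ are hub nodes. Constants in $O(\cdot)$ may depend on $c$. Power-law assumption (as used in the paper): a power-law out-degree distribution with cumulative exponent $\gamma$ (fraction of nodes with out-degree at least $k$ proportional to $k^{-\gamma}$) is taken to mean that the reverse PageRanks obey $\pi(w_j)=\kappa\, j^{-1/\gamma}/n^{1-1/\gamma}$ for $j=1,\dots,n$, where $\kappa$ is the normalizing constant with $\kappa\sum_{j=1}^n j^{-1/\gamma}/n^{1-1/\gamma}=1$. Preprocessing Algorithm: sort each out-adjacency list by ascending in-degree; compute $\pi$; for each hub $w$, run backward search with $r_{max}=\frac{(1-\sqrt c)^2\varepsilon}{12}$: residues $r_\ell(v,w)$ and reserves $\psi_\ell(v,w)$ start at $0$ except $r_0(w,w)=1$; for $\ell=0,1,\dots$, for each $v$ with $r_\ell(v,w)>r_{max}$: add $\sqrt c\,r_\ell(v,w)/d_{in}(z)$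 to $r_{\ell+1}(z,w)$ for each $z\in\mathcal O(v)$, add $(1-\sqrt c)r_\ell(v,w)$ to $\psi_\ell(v,w)$, set $r_\ell(v,w)=0$; then store in list $L_\ell(w)$ the tuples $(v,\psi_\ell(v,w))$ with $\psi_\ell(v,w)>r_{max}$. Index size = number of stored tuples. Variance Bounded Backward Walk (VBBW) on $w$, target level $\ell$ (scans of sorted lists stop at the first neighbor violating the bound): $\hat\pi_i(x,w)=0$ except $\hat\pi_0(w,w)=1-\sqrt c$; for $i=0,\dots,\ell-1$, for each $x$ with $\hat\pi_i(x,w)\ne0$, independently with probability $\sqrt c$: add $\hat\pi_i(x,w)/d_{in}(y)$ to $\hat\pi_{i+1}(y,w)$ for each $y\in\mathcal O(x)$ with $d_{in}(y)\le\hat\pi_i(x,w)/(1-\sqrt c)$; draw $r$ uniform in $(0,1)$ and add $1-\sqrt c$ to $\hat\pi_{i+1}(y,w)$ for each $y\in\mathcal O(x)$ with $\hat\pi_i(x,w)/(1-\sqrt c)<d_{in}(y)\le \hat\pi_i(x,w)/(r(1-\sqrt c))$; output $\hat\pi_\ell(\cdot,w)$. PRSim Query Algorithm on $u$: $c_1=\frac{12}{(1-\sqrt c)^2}$, $d_r=c_1/\varepsilon^2$, $f_r=3\log\frac n\delta$, $n_r=d_rf_r$; estimators start at $0$ (stored sparsely). For $i=1,\dots,f_r$ and $j=1,\dots,d_r$: sample a $\sqrt c$-walk from $u$, say terminating at $w$ after $\ell$ steps; sample two independent $\sqrt c$-walks from $w$; if they do not meet at any step $\ge1$: add $1/n_r$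 to $\widehat{\eta\pi}_\ell(u,w)$, and if $w$ is not a hub, run VBBW on $w$ with target level $\ell$ and add $\frac{\hat\pi_\ell(v,w)}{(1-\sqrt c)^2d_r}$ to $\hat s_B^i(u,v)$ for every $v$ with nonzero $\hat\pi_\ell(v,w)$. Then $\hat s_B(u,v)=\mathrm{Median}_{1\le i\le f_r}\hat s_B^i(u,v)$, and for every pair $(w,\ell)$ with $w$ a hub and $\widehat{\eta\pi}_\ell(u,w)>\varepsilon/c_1$, every tuple $(v,\psi_\ell(v,w))\in L_\ell(w)$ is read and $\frac{\widehat{\eta\pi}_\ell(u,w)\psi_\ell(v,w)}{(1-\sqrt c)^2}$ is added to $\hat s_I(u,v)$. Output all nonzero $\hat s_I(u,v)+\hat s_B(u,v)$. The cost $C$ is the total running time of this procedure on $u$.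
   Formalization: Adds ε<1 and δ<1 (as ε→∞ the claimed O(1/ε²·log(n/δ)) and O(m/ε) tend to 0 while the cost is at least 1; for δ≥n the log is nonpositive); computing π in preprocessing is charged as power iteration to error ε, with hubs taken from the exact order. *)

theory Defs
  imports "HOL-Probability.Probability" "Graph_Theory.Pair_Digraph"
begin

text \<open>
  Directed graphs are those of \<^theory>\<open>Graph_Theory.Pair_Digraph\<close>: no parallel arcs, self-loops
  allowed.
\<close>

definition in_nbrs :: "'a pair_pre_digraph \<Rightarrow> 'a \<Rightarrow> 'a set" where
  "in_nbrs G v = {x. (x, v) \<in> parcs G}"

definition out_nbrs :: "'a pair_pre_digraph \<Rightarrow> 'a \<Rightarrow> 'a set" where
  "out_nbrs G v = {y. (v, y) \<in> parcs G}"

definition d_in :: "'a pair_pre_digraph \<Rightarrow> 'a \<Rightarrow> nat" where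
  "d_in G v = card (in_nbrs G v)"

definition d_out :: "'a pair_pre_digraph \<Rightarrow> 'a \<Rightarrow> nat" where
  "d_out G v = card (out_nbrs G v)"

definition num_nodes :: "'a pair_pre_digraph \<Rightarrow> nat" where
  "num_nodes G = card (pverts G)"

definition num_edges :: "'a pair_pre_digraph \<Rightarrow> nat" where
  "num_edges G = card (parcs G)"

definition avg_deg :: "'a pair_pre_digraph \<Rightarrow> real" where
  "avg_deg G = real (num_edges G) / real (num_nodes G)"


section \<open>Walks and reverse PageRank\<close>

text \<open>
  The result is the list of visited nodes, so a walk \<open>p\<close> makes \<open>length p - 1\<close> steps and terminates
  at \<open>last p\<close>.  A walk at a node without in-neighbours cannot move and terminates there.
\<close>

partial_function (spmf) sqrtc_walk :: "real \<Rightarrow> 'a pair_pre_digraph \<Rightarrow> 'a \<Rightarrow> 'a list spmf" where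
  "sqrtc_walk c G v = do {
     move \<leftarrow> spmf_of_pmf (bernoulli_pmf (sqrt c));
     if move \<and> in_nbrs G v \<noteq> {} then do {
       x \<leftarrow> spmf_of_set (in_nbrs G v);
       p \<leftarrow> sqrtc_walk c G x;
       return_spmf (v # p)
     } else return_spmf [v]
   }"

definition ppr :: "real \<Rightarrow> 'a pair_pre_digraph \<Rightarrow> nat \<Rightarrow> 'a \<Rightarrow> 'a \<Rightarrow> real" where
  "ppr c G l u w = spmf (map_spmf (\<lambda>p. (length p - 1, last p)) (sqrtc_walk c G u)) (l, w)"

definition reverse_pagerank :: "real \<Rightarrow> 'a pair_pre_digraph \<Rightarrow> 'a \<Rightarrow> real" where
  "reverse_pagerank c G w = 1 / real (num_nodes G) * (\<Sum>u\<in>pverts G. \<Sum>l. ppr c G l u w)"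

definition walks_meet :: "'a list \<Rightarrow> 'a list \<Rightarrow> bool" where
  "walks_meet p q \<longleftrightarrow> (\<exists>k\<ge>1. k < length p \<and> k < length q \<and> p ! k = q ! k)"

definition pagerank_order :: "real \<Rightarrow> 'a pair_pre_digraph \<Rightarrow> (nat \<Rightarrow> 'a) \<Rightarrow> bool" where
  "pagerank_order c G w \<longleftrightarrow>
     bij_betw w {1..num_nodes G} (pverts G) \<and>
     (\<forall>i j. 1 \<le> i \<and> i \<le> j \<and> j \<le> num_nodes G \<longrightarrow>
        reverse_pagerank c G (w i) \<ge> reverse_pagerank c G (w j))"

definition power_law :: "real \<Rightarrow> 'a pair_pre_digraph \<Rightarrow> real \<Rightarrow> (nat \<Rightarrow> 'a) \<Rightarrow> bool" where
  "power_law c G \<gamma> w \<longleftrightarrow>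
     (let n = real (num_nodes G) in
      \<exists>\<kappa>. \<kappa> * (\<Sum>j = 1..num_nodes G. real j powr (- 1 / \<gamma>) / n powr (1 - 1 / \<gamma>)) = 1 \<and>
          (\<forall>j\<in>{1..num_nodes G}.
             reverse_pagerank c G (w j) = \<kappa> * real j powr (- 1 / \<gamma>) / n powr (1 - 1 / \<gamma>)))"

text \<open>
  The number of hubs \<open>j\<^sub>0\<close> is given by a formula with real values; the hubs are the nodes with rank at
  most \<open>j\<^sub>0\<close>, that is, the first \<open>\<lfloor>j\<^sub>0\<rfloor>\<close> nodes, or all nodes if \<open>j\<^sub>0 \<ge> n\<close>.
\<close>

definition hub_nodes :: "'a pair_pre_digraph \<Rightarrow> (nat \<Rightarrow> 'a) \<Rightarrow> real \<Rightarrow> 'a set" where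
  "hub_nodes G w j0 = w ` {j \<in> {1..num_nodes G}. real j \<le> j0}"


section \<open>Preprocessing\<close>

definition r_max :: "real \<Rightarrow> real \<Rightarrow> real" where
  "r_max c \<epsilon> = (1 - sqrt c)\<^sup>2 * \<epsilon> / 12"

text \<open>
  \<open>residue c G \<epsilon> w l v\<close> is the value of \<open>r\<^sub>l(v,w)\<close> at the moment the backward search from \<open>w\<close> starts to
  process level \<open>l\<close>.  It is final until \<open>v\<close> itself is pushed at level \<open>l\<close>, since level \<open>l\<close> receives
  contributions from pushes at level \<open>l - 1\<close> only.
\<close>

primrec residue :: "real \<Rightarrow> 'a pair_pre_digraph \<Rightarrow> real \<Rightarrow> 'a \<Rightarrow> nat \<Rightarrow> 'a \<Rightarrow> real" where
  "residue c G \<epsilon> w 0 v = (if v = w then 1 else 0)"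
| "residue c G \<epsilon> w (Suc l) z =
     (\<Sum>v \<in> {v \<in> in_nbrs G z. residue c G \<epsilon> w l v > r_max c \<epsilon>}.
        sqrt c * residue c G \<epsilon> w l v / real (d_in G z))"

definition reserve :: "real \<Rightarrow> 'a pair_pre_digraph \<Rightarrow> real \<Rightarrow> 'a \<Rightarrow> nat \<Rightarrow> 'a \<Rightarrow> real" where
  "reserve c G \<epsilon> w l v =
     (if residue c G \<epsilon> w l v > r_max c \<epsilon> then (1 - sqrt c) * residue c G \<epsilon> w l v else 0)"

definition index_list :: "real \<Rightarrow> 'a pair_pre_digraph \<Rightarrow> real \<Rightarrow> 'a \<Rightarrow> nat \<Rightarrow> ('a \<times> real) set" where
  "index_list c G \<epsilon> w l =
     {(v, reserve c G \<epsilon> w l v) | v. v \<in> pverts G \<and> reserve c G \<epsilon> w l v > r_max c \<epsilon>}"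

definition index_tuples ::
    "real \<Rightarrow> 'a pair_pre_digraph \<Rightarrow> 'a set \<Rightarrow> real \<Rightarrow> ('a \<times> nat \<times> 'a \<times> real) set" where
  "index_tuples c G H \<epsilon> = {(w, l, v, x). w \<in> H \<and> (v, x) \<in> index_list c G \<epsilon> w l}"

text \<open>
  Every nonzero residue is inspected once; a push at \<open>v\<close> costs one unit for the update of the reserve
  (including storing the tuple) and one unit per out-neighbour.  The sum over the levels is taken in
  \<^typ>\<open>ennreal\<close>, so that nontermination would show up as infinite cost.
\<close>

definition backward_search_cost :: "real \<Rightarrow> 'a pair_pre_digraph \<Rightarrow> real \<Rightarrow> 'a \<Rightarrow> ennreal" where
  "backward_search_cost c G \<epsilon> w =
     1 + (\<Sum>l. of_nat (\<Sum>v \<in> {v \<in> pverts G. residue c G \<epsilon> w l v \<noteq> 0}.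
            1 + (if residue c G \<epsilon> w l v > r_max c \<epsilon> then 1 + d_out G v else 0)))"

text \<open>
  \<open>\<pi>\<close> is computed by power iteration.  \<open>alive_mass c G k v\<close> is the vector held after \<open>k\<close> rounds: the
  probability that the walk from a uniformly random node makes at least \<open>k\<close> steps and is at \<open>v\<close> after
  \<open>k\<close> steps.  The iteration stops as soon as the total mass that is still alive, which bounds the
  \<open>\<ell>\<^sub>1\<close> error of the accumulated estimate of \<open>\<pi>\<close>, is at most \<open>\<epsilon>\<close>.
\<close>

primrec alive_mass :: "real \<Rightarrow> 'a pair_pre_digraph \<Rightarrow> nat \<Rightarrow> 'a \<Rightarrow> real" where
  "alive_mass c G 0 v = 1 / real (num_nodes G)"
| "alive_mass c G (Suc k) v =
     (\<Sum>y\<in>out_nbrs G v. sqrt c * alive_mass c G k y / real (d_in G y))"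

definition pagerank_rounds :: "real \<Rightarrow> 'a pair_pre_digraph \<Rightarrow> real \<Rightarrow> nat" where
  "pagerank_rounds c G \<epsilon> = (LEAST k. (\<Sum>v\<in>pverts G. alive_mass c G k v) \<le> \<epsilon>)"

text \<open>
  Sorting all out-adjacency lists by in-degree (bucket sort) takes \<open>n + m\<close> units, each round of the
  power iteration \<open>n + m\<close> units, and the selection of the hubs \<open>n\<close> units.
\<close>

definition preprocessing_cost :: "real \<Rightarrow> 'a pair_pre_digraph \<Rightarrow> 'a set \<Rightarrow> real \<Rightarrow> ennreal" where
  "preprocessing_cost c G H \<epsilon> =
     of_nat ((num_nodes G + num_edges G)
       + (1 + pagerank_rounds c G \<epsilon>) * (num_nodes G + num_edges G)
       + num_nodes G)
     + (\<Sum>w\<in>H. backward_search_cost c G \<epsilon> w)"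


section \<open>Variance bounded backward walk\<close>

text \<open>
  The distribution of \<open>f r\<close> for \<open>r\<close> uniform in \<open>(0,1)\<close>.
\<close>

definition uniform_draw :: "(real \<Rightarrow> 'b) \<Rightarrow> 'b pmf" where
  "uniform_draw f = Abs_pmf (distr (uniform_measure lborel {0<..<1}) (count_space UNIV) f)"

lemma measure_pmf_uniform_draw:
  fixes f :: "real \<Rightarrow> 'b"
  assumes meas: "f \<in> borel \<rightarrow>\<^sub>M count_space UNIV" and cnt: "countable (range f)"
  shows "measure_pmf (uniform_draw f) =
           distr (uniform_measure lborel {0<..<1}) (count_space UNIV) f"
proof -
  let ?U = "uniform_measure lborel {0<..<1::real}"
  let ?M = "distr ?U (count_space UNIV) f"
  interpret U: prob_space ?U
    by (rule prob_space_uniform_measure) auto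
  have f: "f \<in> ?U \<rightarrow>\<^sub>M count_space UNIV"
    using meas by simp
  interpret M: prob_space ?M
    by (rule U.prob_space_distr[OF f])
  have "AE x in ?M. x \<in> range f"
    by (subst AE_distr_iff[OF f]) auto
  then have "AE x in ?M. measure ?M {x} \<noteq> 0"
    using cnt by (subst M.AE_support_countable) auto
  then show ?thesis
    unfolding uniform_draw_def
    by (intro Abs_pmf_inverse) (simp add: M.prob_space_axioms)
qed

text \<open>
  One level: \<open>q\<close> is \<open>\<pi>\<^sub>i(\<cdot>,w)\<close> (the estimate).  For each node \<open>x\<close> in the support, independently, the
  outcome is \<^const>\<open>None\<close> if the coin with success probability \<open>\<surd>c\<close> fails, and otherwise \<open>Some A\<close>, where
  \<open>A\<close> is the set of out-neighbours selected by the uniform number \<open>r\<close>.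
\<close>

definition vbbw_node ::
    "real \<Rightarrow> 'a pair_pre_digraph \<Rightarrow> ('a \<Rightarrow> real) \<Rightarrow> 'a \<Rightarrow> 'a set option pmf" where
  "vbbw_node c G q x = do {
     b \<leftarrow> bernoulli_pmf (sqrt c);
     if b then
       map_pmf Some (uniform_draw (\<lambda>r.
         {y \<in> out_nbrs G x. q x / (1 - sqrt c) < real (d_in G y) \<and>
                            real (d_in G y) \<le> q x / (r * (1 - sqrt c))}))
     else return_pmf None
   }"

definition vbbw_small :: "real \<Rightarrow> 'a pair_pre_digraph \<Rightarrow> ('a \<Rightarrow> real) \<Rightarrow> 'a \<Rightarrow> 'a set" where
  "vbbw_small c G q x = {y \<in> out_nbrs G x. real (d_in G y) \<le> q x / (1 - sqrt c)}"

definition vbbw_contrib ::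
    "real \<Rightarrow> 'a pair_pre_digraph \<Rightarrow> ('a \<Rightarrow> real) \<Rightarrow> 'a \<Rightarrow> 'a set option \<Rightarrow> 'a \<Rightarrow> real" where
  "vbbw_contrib c G q x oc y =
     (case oc of
        None \<Rightarrow> 0
      | Some A \<Rightarrow> (if y \<in> vbbw_small c G q x then q x / real (d_in G y) else 0)
                + (if y \<in> A then 1 - sqrt c else 0))"

text \<open>
  The lists are sorted by in-degree, so each of the two scans inspects the neighbours that satisfy its
  bound and at most one more.
\<close>

definition vbbw_node_cost ::
    "real \<Rightarrow> 'a pair_pre_digraph \<Rightarrow> ('a \<Rightarrow> real) \<Rightarrow> 'a \<Rightarrow> 'a set option \<Rightarrow> nat" where
  "vbbw_node_cost c G q x oc =
     1 + (case oc of None \<Rightarrow> 0 | Some A \<Rightarrow> (card (vbbw_small c G q x) + 1) + (card A + 1))"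

definition vbbw_level ::
    "real \<Rightarrow> 'a pair_pre_digraph \<Rightarrow> ('a \<Rightarrow> real) \<Rightarrow> (('a \<Rightarrow> real) \<times> nat) pmf" where
  "vbbw_level c G q =
     (let S = {x \<in> pverts G. q x \<noteq> 0} in
      map_pmf (\<lambda>oc. (\<lambda>y. \<Sum>x\<in>S. vbbw_contrib c G q x (oc x) y,
                     \<Sum>x\<in>S. vbbw_node_cost c G q x (oc x)))
        (Pi_pmf S None (vbbw_node c G q)))"

text \<open>The estimates at the target level, paired with the running time.\<close>

primrec vbbw :: "real \<Rightarrow> 'a pair_pre_digraph \<Rightarrow> 'a \<Rightarrow> nat \<Rightarrow> (('a \<Rightarrow> real) \<times> nat) pmf" where
  "vbbw c G w 0 = return_pmf (\<lambda>x. if x = w then 1 - sqrt c else 0, 1)"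
| "vbbw c G w (Suc i) = do {
     (q, k) \<leftarrow> vbbw c G w i;
     (q', k') \<leftarrow> vbbw_level c G q;
     return_pmf (q', k + 1 + k')
   }"


section \<open>Query algorithm\<close>

definition c1 :: "real \<Rightarrow> real" where
  "c1 c = 12 / (1 - sqrt c)\<^sup>2"

definition d_r :: "real \<Rightarrow> real \<Rightarrow> nat" where
  "d_r c \<epsilon> = nat \<lceil>c1 c / \<epsilon>\<^sup>2\<rceil>"

definition f_r :: "'a pair_pre_digraph \<Rightarrow> real \<Rightarrow> nat" where
  "f_r G \<delta> = nat \<lceil>3 * ln (real (num_nodes G) / \<delta>)\<rceil>"

definition n_r :: "real \<Rightarrow> 'a pair_pre_digraph \<Rightarrow> real \<Rightarrow> real \<Rightarrow> nat" where
  "n_r c G \<epsilon> \<delta> = d_r c \<epsilon> * f_r G \<delta>"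

text \<open>
  One iteration \<open>(i,j)\<close> yields \<open>((w, l, no_meet, b), k)\<close>: the walk from \<open>u\<close> terminated at \<open>w\<close> after \<open>l\<close>
  steps, \<open>no_meet\<close> tells whether the two walks from \<open>w\<close> do not meet, \<open>b\<close> is the output of the backward
  walk (zero if it is not run), and \<open>k\<close> is the running time.
\<close>

type_synonym 'a sample = "'a \<times> nat \<times> bool \<times> ('a \<Rightarrow> real)"

definition prsim_sample ::
    "real \<Rightarrow> 'a pair_pre_digraph \<Rightarrow> 'a set \<Rightarrow> 'a \<Rightarrow> ('a sample \<times> nat) spmf" where
  "prsim_sample c G H u = do {
     p \<leftarrow> sqrtc_walk c G u;
     let w = last p;
     let l = length p - 1;
     q1 \<leftarrow> sqrtc_walk c G w;
     q2 \<leftarrow> sqrtc_walk c G w;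
     let k = length p + length q1 + length q2;
     if walks_meet q1 q2 then return_spmf ((w, l, False, \<lambda>_. 0), k)
     else if w \<in> H then return_spmf ((w, l, True, \<lambda>_. 0), k + 1)
     else do {
       (b, k') \<leftarrow> spmf_of_pmf (vbbw c G w l);
       return_spmf ((w, l, True, b), k + 1 + k' + card {v \<in> pverts G. b v \<noteq> 0})
     }
   }"

primrec replicate_spmf :: "nat \<Rightarrow> 'b spmf \<Rightarrow> 'b list spmf" where
  "replicate_spmf 0 p = return_spmf []"
| "replicate_spmf (Suc k) p = do { x \<leftarrow> p; xs \<leftarrow> replicate_spmf k p; return_spmf (x # xs) }"

definition median :: "real list \<Rightarrow> real" where
  "median xs = (let s = sort xs; k = length xs in (s ! ((k - 1) div 2) + s ! (k div 2)) / 2)"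

definition est_eta_pi :: "nat \<Rightarrow> 'a sample list \<Rightarrow> 'a \<Rightarrow> nat \<Rightarrow> real" where
  "est_eta_pi N ss w l =
     (\<Sum>(w', l', no_meet, b)\<leftarrow>ss. if w' = w \<and> l' = l \<and> no_meet then 1 / real N else 0)"

definition est_sB_round :: "real \<Rightarrow> nat \<Rightarrow> 'a sample list \<Rightarrow> 'a \<Rightarrow> real" where
  "est_sB_round c d ss v = (\<Sum>(w, l, no_meet, b)\<leftarrow>ss. b v / ((1 - sqrt c)\<^sup>2 * real d))"

definition est_sB :: "real \<Rightarrow> nat \<Rightarrow> 'a sample list list \<Rightarrow> 'a \<Rightarrow> real" where
  "est_sB c d rounds v = median (map (\<lambda>ss. est_sB_round c d ss v) rounds)"

definition selected_pairs ::
    "real \<Rightarrow> 'a set \<Rightarrow> real \<Rightarrow> nat \<Rightarrow> 'a sample list \<Rightarrow> ('a \<times> nat) set" where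
  "selected_pairs c H \<epsilon> N ss = {(w, l). w \<in> H \<and> est_eta_pi N ss w l > \<epsilon> / c1 c}"

definition est_sI ::
    "real \<Rightarrow> 'a pair_pre_digraph \<Rightarrow> 'a set \<Rightarrow> real \<Rightarrow> nat \<Rightarrow> 'a sample list \<Rightarrow> 'a \<Rightarrow> real" where
  "est_sI c G H \<epsilon> N ss v =
     (\<Sum>(w, l) \<in> selected_pairs c H \<epsilon> N ss.
        \<Sum>(v', x) \<in> index_list c G \<epsilon> w l.
          if v' = v then est_eta_pi N ss w l * x / (1 - sqrt c)\<^sup>2 else 0)"

text \<open>
  The output (zero entries are not reported) and the total running time: all iterations, the medians,
  the scan of the stored estimators, the reading of the selected lists, and the output.  The estimators
  are stored sparsely, so the median for \<open>v\<close> is obtained by linear-time selection from the nonzero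
  values \<open>s\<^sub>B\<^sup>i(u,v)\<close> and the number of zeros.
\<close>

definition prsim_query ::
    "real \<Rightarrow> 'a pair_pre_digraph \<Rightarrow> 'a set \<Rightarrow> real \<Rightarrow> real \<Rightarrow> 'a \<Rightarrow> (('a \<Rightarrow> real) \<times> nat) spmf" where
  "prsim_query c G H \<epsilon> \<delta> u = do {
     runs \<leftarrow> replicate_spmf (f_r G \<delta>) (replicate_spmf (d_r c \<epsilon>) (prsim_sample c G H u));
     let rounds = map (map fst) runs;
     let ss = concat rounds;
     let N = n_r c G \<epsilon> \<delta>;
     let out = (\<lambda>v. est_sI c G H \<epsilon> N ss v + est_sB c (d_r c \<epsilon>) rounds v);
     let k_sampling = sum_list (map snd (concat runs));
     let k_median = (\<Sum>v\<in>pverts G.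
           card {i. i < length rounds \<and> est_sB_round c (d_r c \<epsilon>) (rounds ! i) v \<noteq> 0});
     let k_scan = card {(w, l). est_eta_pi N ss w l \<noteq> 0};
     let k_index = (\<Sum>(w, l) \<in> selected_pairs c H \<epsilon> N ss. 1 + card (index_list c G \<epsilon> w l));
     let k_output = card {v \<in> pverts G. out v \<noteq> 0};
     return_spmf (out, 1 + k_sampling + k_median + k_scan + k_index + k_output)
   }"

text \<open>A run that does not terminate (\<^const>\<open>None\<close>) has infinite cost.\<close>

definition expected_cost :: "('b \<times> nat) spmf \<Rightarrow> ennreal" where
  "expected_cost p = (\<integral>\<^sup>+ r. (case r of None \<Rightarrow> \<infinity> | Some (_, k) \<Rightarrow> of_nat k) \<partial>measure_pmf p)"

definition expected_query_cost ::
    "real \<Rightarrow> 'a pair_pre_digraph \<Rightarrow> 'a set \<Rightarrow> real \<Rightarrow> real \<Rightarrow> ennreal" where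
  "expected_query_cost c G H \<epsilon> \<delta> =
     expected_cost (do { u \<leftarrow> spmf_of_set (pverts G); prsim_query c G H \<epsilon> \<delta> u })"

end

theory Submission
  imports Defs
begin

text \<open>
  Let \<open>h\<^sub>l(v,w)\<close> be the probability that the walk from \<open>v\<close> is alive at \<open>w\<close> after \<open>l\<close> steps.  It dominates
  both the residues of the backward search and, up to the factor \<open>1 - \<surd>c\<close>, the expected estimates of
  the backward walk, because all three obey the same recursion.  Since \<open>\<Sum>\<^sub>v\<Sum>\<^sub>l \<pi>\<^sub>l(v,w) = n \<pi>(w)\<close>,
  a list of a hub \<open>w\<close> has \<open>O(n \<pi>(w) / \<epsilon>)\<close> entries in total and a backward walk from \<open>w\<close> costs
  \<open>O(l + n \<pi>(w))\<close> in expectation, where every step is charged to an estimate of at least \<open>1 - \<surd>c\<close>.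

  For a uniformly random query node a walk ends at \<open>w\<close> with probability \<open>\<pi>(w)\<close>, so a sample costs
  \<open>O(1 + \<Sum> n \<pi>(w)\<^sup>2)\<close> with the sum over the nodes that are not hubs, and by Markov's inequality a pair
  \<open>(w,l)\<close> is selected with probability \<open>O(min(1, \<pi>(w) / \<epsilon>))\<close>.  The power law turns these sums into sums of
  powers of ranks.  It also makes the reverse PageRanks pairwise distinct, whereas that of a node
  without out-neighbours can only take two values; hence all but two nodes have an out-neighbour and
  \<open>n = O(m)\<close>.
\<close>

section \<open>Power sums and logarithms\<close>

text \<open>Three obstacles shape the details. A walk must stop at a node without in-neighbours, so
  termination and presence differ by a factor that depends on the node but lies between \<beta> and
  1; both quantities are kept, and passing between them costs \<open>1 / \<beta>\<close>. Constants
  may depend on \<open>c\<close>, \<gamma> and the exponent \<open>a\<close> but not on the graph,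
  so every ceiling and additive 1 has to be absorbed by a logarithm or by
  \<open>1 / \<epsilon>\<close>; this rests on \<open>n \<ge> 2\<close>, which the normalization of
  the power law and the range of \<delta> enforce. For \<open>1 < \<gamma> < 2\<close> the claimed
  bound has no logarithm although the number of samples has one, and the tail sum contributes a
  negative power of \<open>\<epsilon> * d\<close>; the lower bound on \<epsilon> pays for both. The
  two entries of the minimum come from estimating the same sum over the hubs twice: once with
  Markov's bound alone, once with a geometric mean of Markov's bound and the trivial bound 1. The
  number of hubs is the one for which their reverse PageRanks sum to
  \<open>O(\<epsilon> * d)\<close>.\<close>

lemma powr_diff_mvt:
  fixes x p :: real
  assumes "x > 0"
  obtains \<xi> where "x < \<xi>" "\<xi> < x + 1" "(x + 1) powr p - x powr p = p * \<xi> powr (p - 1)"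
proof -
  have "\<exists>\<xi>>x. \<xi> < x + 1 \<and> (x + 1) powr p - x powr p = (x + 1 - x) * (p * \<xi> powr (p - 1))"
    by (rule MVT2) (use assms in \<open>auto intro!: derivative_eq_intros\<close>)
  with that show ?thesis by auto
qed

text \<open>Integral comparison by induction: by the mean value theorem the new term is at most the
  increment of \<open>x powr (1 - s) / (1 - s)\<close> from \<open>k\<close> to
  \<open>k + 1\<close>.\<close>

lemma sum_powr_le:
  fixes s :: real
  assumes "0 \<le> s" "s < 1"
  shows "(\<Sum>j = 1..k. real j powr - s) \<le> real k powr (1 - s) / (1 - s)"
proof (induction k)
  case (Suc k)
  have "real (Suc k) powr - s \<le> (real (Suc k) powr (1 - s) - real k powr (1 - s)) / (1 - s)"
  \<comment> \<open>The mean value theorem needs a positive left end, so the first term is separate;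
    there the claim is \<open>1 \<le> 1 / (1 - s)\<close>.\<close>
  proof (cases "k = 0")
    case True
    then show ?thesis using assms by (simp add: field_simps)
  next
    case False
    then obtain \<xi> where \<xi>: "real k < \<xi>" "\<xi> < real k + 1"
      "(real k + 1) powr (1 - s) - real k powr (1 - s) = (1 - s) * \<xi> powr (1 - s - 1)"
      using powr_diff_mvt[of "real k" "1 - s"] by auto
    have "(real k + 1) powr - s \<le> \<xi> powr - s" using \<xi> assms by (intro powr_mono2') simp_all
    with \<xi>(3) assms show ?thesis by (simp add: add.commute)
  qed
  with Suc show ?case by (simp add: diff_divide_distrib)
qed (use assms in simp)

lemma sum_powr_upto_le:
  fixes s x :: real
  assumes "0 \<le> s" "s < 1" "0 \<le> x"
  shows "(\<Sum>j\<in>{j \<in> {1..n}. real j \<le> x}. real j powr - s) \<le> x powr (1 - s) / (1 - s)"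
proof -
  have "(\<Sum>j\<in>{j \<in> {1..n}. real j \<le> x}. real j powr - s) \<le> (\<Sum>j = 1..nat \<lfloor>x\<rfloor>. real j powr - s)"
    by (rule sum_mono2) (auto simp: le_nat_floor)
  also have "\<dots> \<le> real (nat \<lfloor>x\<rfloor>) powr (1 - s) / (1 - s)" by (rule sum_powr_le[OF assms(1,2)])
  also have "\<dots> \<le> x powr (1 - s) / (1 - s)"
    using assms by (intro divide_right_mono powr_mono2) (simp_all add: of_nat_floor)
  finally show ?thesis .
qed

text \<open>The step \<open>1 / (k + 1) \<le> ln (k + 1) - ln k\<close> is
  \<open>ln x \<le> x - 1\<close> at \<open>x = k / (k + 1)\<close>.\<close>

lemma sum_inverse_le:
  assumes "k \<ge> 1" shows "(\<Sum>j = 1..k. real j powr - 1) \<le> 1 + ln (real k)"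
  using assms
proof (induction k rule: dec_induct)
  case (step k)
  have "ln (real k / real (Suc k)) \<le> real k / real (Suc k) - 1"
    using step by (intro ln_le_minus_one) simp
  also have "\<dots> = - (real (Suc k) powr - 1)" by (simp add: powr_minus field_simps)
  finally have "real (Suc k) powr - 1 \<le> ln (real (Suc k)) - ln (real k)"
    using step by (simp add: ln_div)
  with step.IH show ?case by simp
qed simp

lemma sum_powr_tail_le:
  fixes s x :: real
  assumes s: "1 < s" and x: "0 < x"
  shows "(\<Sum>j\<in>{j \<in> {1..n}. real j > x}. real j powr - s) \<le> s / (s - 1) * x powr (1 - s)"
proof -
  define k where "k = nat \<lfloor>x\<rfloor>"
  have k: "x \<le> real k + 1" unfolding k_def using x by linarith
  have "{j \<in> {1..n}. real j > x} \<subseteq> {Suc k..n}"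
    unfolding k_def using x by (auto simp: Suc_le_eq nat_less_iff floor_less_iff)
  then have "(\<Sum>j\<in>{j \<in> {1..n}. real j > x}. real j powr - s) \<le> (\<Sum>j = Suc k..n. real j powr - s)"
    by (intro sum_mono2) auto
  also have "\<dots> \<le> s / (s - 1) * (real k + 1) powr (1 - s)"
  proof (cases "n \<ge> Suc k")
    case True
    then have "(\<Sum>j = Suc k..n. real j powr - s)
        \<le> (real k + 1) powr - s + ((real k + 1) powr (1 - s) - real n powr (1 - s)) / (s - 1)"
    proof (induction n rule: dec_induct)
      case base
      then show ?case by (simp add: add.commute)
    next
      case (step n)
      then have "real n > 0" by simp
      then obtain \<xi> where \<xi>: "real n < \<xi>" "\<xi> < real n + 1"
        "(real n + 1) powr (1 - s) - real n powr (1 - s) = (1 - s) * \<xi> powr (1 - s - 1)"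
        using powr_diff_mvt[of "real n" "1 - s"] by auto
      have "(real n + 1) powr - s \<le> \<xi> powr - s" using \<xi> s by (intro powr_mono2') simp_all
      then have "(s - 1) * (real n + 1) powr - s \<le> (s - 1) * \<xi> powr - s"
        using s by (intro mult_left_mono) simp_all
      also have "\<dots> = real n powr (1 - s) - (real n + 1) powr (1 - s)"
        using \<xi>(3) by (simp add: algebra_simps)
      finally have "(real n + 1) powr - s \<le> (real n powr (1 - s) - (real n + 1) powr (1 - s)) / (s - 1)"
        using s by (simp add: field_simps)
      with step show ?case by (simp add: diff_divide_distrib add.commute)
    qed
    also have "\<dots> \<le> (real k + 1) powr (1 - s) + (real k + 1) powr (1 - s) / (s - 1)"
      using s by (intro add_mono divide_right_mono powr_mono) simp_all
    also have "\<dots> = s / (s - 1) * (real k + 1) powr (1 - s)"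
      using s by (simp add: field_simps)
    finally show ?thesis .
  next
    case False
    then show ?thesis using s by simp
  qed
  also have "\<dots> \<le> s / (s - 1) * x powr (1 - s)"
    using s x k by (intro mult_left_mono powr_mono2') simp_all
  finally show ?thesis .
qed

text \<open>A weighted geometric mean of 1 and \<open>y\<close> is at least their minimum. It serves
  to interpolate between the trivial and the Markov bound on a selection probability.\<close>

lemma min_one_le_powr:
  fixes y t :: real
  assumes "0 \<le> y" "0 \<le> t" "t \<le> 1"
  shows "min 1 y \<le> y powr t"
proof (cases "y \<le> 1")
  case True
  then show ?thesis using powr_mono'[of t 1 y] assms by (cases "y = 0") simp_all
next
  case False
  then show ?thesis using assms by (simp add: ge_one_powr_ge_zero)
qed

text \<open>The lower bound on \<open>\<epsilon>\<close> absorbs the logarithmic factor of the number of samples.\<close>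

lemma log_absorption:
  fixes \<gamma> :: real
  assumes \<gamma>: "1 < \<gamma>" "\<gamma> < 2"
  obtains C :: real where "C > 0"
    and "\<And>n d \<epsilon>. 2 \<le> n \<Longrightarrow> 1 / 3 \<le> d \<Longrightarrow> d \<le> n \<Longrightarrow> 0 < \<epsilon> \<Longrightarrow>
       \<epsilon> \<ge> ln n powr ((\<gamma> - 1) / (2 - \<gamma>)) / (n powr ((\<gamma> - 1) / \<gamma>) * d powr (2 - \<gamma>)) \<Longrightarrow>
       ln n \<le> C * min (n powr (2 / \<gamma> - 1)) ((n * \<epsilon>) powr (1 / \<gamma>)) \<and>
       ln n * (\<epsilon> * d) powr (- ((2 - \<gamma>) / (\<gamma> - 1))) \<le> C * min (n powr (2 / \<gamma> - 1)) ((n * \<epsilon>) powr (1 / \<gamma>))"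
proof -
  \<comment> \<open>\<open>q\<close> is the exponent of the logarithm in the lower bound on
    \<epsilon>, and \<open>p = 1 / q\<close> is the exponent of \<open>1 / (\<epsilon> * d)\<close>
    in the tail sum. \<open>s\<close> is the power of \<open>n\<close> left in the lower bound for
    \<open>(n * \<epsilon>) powr a\<close> once \<open>d\<close> is replaced by
    \<open>n\<close>.\<close>
  define a where "a = 1 / \<gamma>"
  define q where "q = (\<gamma> - 1) / (2 - \<gamma>)"
  define p where "p = (2 - \<gamma>) / (\<gamma> - 1)"
  define s where "s = a * (a - 2 + \<gamma>)"
  define B where "B = (ln 2 :: real) powr (q * a)"
  have a: "1 / 2 < a" "a < 1" using \<gamma> by (simp_all add: a_def field_simps)
  have q: "0 < q" "0 < p" "q * p = 1" using \<gamma> by (simp_all add: q_def p_def)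
  \<comment> \<open>The perfect square makes \<open>s\<close> positive, so a power of
    \<open>n\<close> remains to beat the logarithm.\<close>
  have "a - 2 + \<gamma> = (\<gamma> - 1)\<^sup>2 / \<gamma>" using \<gamma> by (simp add: a_def field_simps power2_eq_square)
  then have s: "0 < s" unfolding s_def using a \<gamma> by simp
  have B: "0 < B" unfolding B_def by simp
  define C where "C = 1 / (2 * a - 1) + 3 + 1 / (s * B) + 3 / B"
  have Cs: "1 / (2 * a - 1) \<le> C" "3 \<le> C" "1 / (s * B) \<le> C" "3 / B \<le> C"
    unfolding C_def using a s B by simp_all
  have C: "C > 0" using Cs(2) by linarith
  show ?thesis
  proof (rule that[OF C])
    fix n d \<epsilon> :: real
    assume n: "2 \<le> n" and d: "1 / 3 \<le> d" "d \<le> n" and eps: "0 < \<epsilon>"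
      and E: "\<epsilon> \<ge> ln n powr ((\<gamma> - 1) / (2 - \<gamma>)) / (n powr ((\<gamma> - 1) / \<gamma>) * d powr (2 - \<gamma>))"
    define L where "L = ln n"
    have L: "ln 2 \<le> L" "0 < L" using n by (simp_all add: L_def)
    have "(\<gamma> - 1) / \<gamma> = 1 - a" using \<gamma> by (simp add: a_def field_simps)
    with E have E': "L powr q / (n powr (1 - a) * d powr (2 - \<gamma>)) \<le> \<epsilon>" by (simp add: L_def q_def)
    have pos: "0 < n powr (1 - a)" "0 < d powr (2 - \<gamma>)" using n d by simp_all
    have E1: "L powr q \<le> \<epsilon> * (n powr (1 - a) * d powr (2 - \<gamma>))"
      using E' pos by (simp add: pos_divide_le_eq)
    have i: "L \<le> C * n powr (2 * a - 1)"
    proof -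
      have "L \<le> n powr (2 * a - 1) / (2 * a - 1)" unfolding L_def using n a by (intro ln_powr_bound) simp_all
      also have "\<dots> = 1 / (2 * a - 1) * n powr (2 * a - 1)" by simp
      also have "\<dots> \<le> C * n powr (2 * a - 1)" by (intro mult_right_mono Cs) simp
      finally show ?thesis .
    qed
    \<comment> \<open>The hypothesis multiplied by \<open>n\<close> and raised to the power
      \<open>a\<close>; the power of the logarithm is then replaced by its least value
      \<open>B\<close>, attained at \<open>n = 2\<close>.\<close>
    have ne: "B * n powr (a * a) * d powr (- ((2 - \<gamma>) * a)) \<le> (n * \<epsilon>) powr a"
    proof -
      have "n powr a * L powr q * d powr (- (2 - \<gamma>)) = n * (L powr q / (n powr (1 - a) * d powr (2 - \<gamma>)))"
        using n d by (simp add: powr_diff powr_minus field_simps)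
      also have "\<dots> \<le> n * \<epsilon>" using E' n by (intro mult_left_mono) simp_all
      finally have "(n powr a * L powr q * d powr (- (2 - \<gamma>))) powr a \<le> (n * \<epsilon>) powr a"
        using a by (intro powr_mono2) simp_all
      also have "(n powr a * L powr q * d powr (- (2 - \<gamma>))) powr a = L powr (q * a) * n powr (a * a) * d powr (- ((2 - \<gamma>) * a))"
      proof -
        have "(\<gamma> - 2) * a = - ((2 - \<gamma>) * a)" by (simp add: algebra_simps)
        then show ?thesis by (simp add: powr_mult powr_powr)
      qed
      finally have 1: "L powr (q * a) * n powr (a * a) * d powr (- ((2 - \<gamma>) * a)) \<le> (n * \<epsilon>) powr a" .
      have "B \<le> L powr (q * a)" unfolding B_def using L a q by (intro powr_mono2) simp_all
      then have "B * n powr (a * a) * d powr (- ((2 - \<gamma>) * a)) \<le> L powr (q * a) * n powr (a * a) * d powr (- ((2 - \<gamma>) * a))"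
        by (intro mult_right_mono) simp_all
      with 1 show ?thesis by linarith
    qed
    \<comment> \<open>Raising the hypothesis to the power \<open>p = 1 / q\<close> isolates one
      factor \<open>L\<close>; then the powers of \<epsilon> cancel.\<close>
    have ii: "L * (\<epsilon> * d) powr - p \<le> n powr (2 * a - 1) * d powr (- (2 - \<gamma>))"
    proof -
      have "(L powr q) powr p \<le> (\<epsilon> * (n powr (1 - a) * d powr (2 - \<gamma>))) powr p"
        using E1 q by (intro powr_mono2) simp_all
      then have "L \<le> \<epsilon> powr p * n powr ((1 - a) * p) * d powr ((2 - \<gamma>) * p)"
        using L q eps n d by (simp add: powr_powr powr_mult)
      then have "L * (\<epsilon> * d) powr - p \<le> \<epsilon> powr p * n powr ((1 - a) * p) * d powr ((2 - \<gamma>) * p) * (\<epsilon> * d) powr - p"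
        by (intro mult_right_mono) simp_all
      also have "\<dots> = (\<epsilon> powr p * \<epsilon> powr - p) * n powr ((1 - a) * p) * (d powr ((2 - \<gamma>) * p) * d powr - p)"
        using eps d by (simp add: powr_mult)
      also have "\<epsilon> powr p * \<epsilon> powr - p = 1" using eps by (simp add: powr_add[symmetric])
      also have "d powr ((2 - \<gamma>) * p) * d powr - p = d powr ((1 - \<gamma>) * p)"
        by (simp add: powr_add[symmetric] algebra_simps)
      also have "(1 - a) * p = 2 * a - 1" using \<gamma> by (simp add: a_def p_def field_simps)
      also have "(1 - \<gamma>) * p = - (2 - \<gamma>)" using \<gamma> by (simp add: p_def field_simps)
      finally show ?thesis by simp
    qed
    have d3: "d powr (- t) \<le> 3" if "0 \<le> t" "t \<le> 1" for t
    proof -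
      have "d powr (- t) \<le> (1 / 3) powr (- t)" using d that by (intro powr_mono2') simp_all
      also have "\<dots> = 3 powr t" by (simp add: powr_minus powr_divide)
      also have "\<dots> \<le> 3 powr 1" using that by (intro powr_mono) simp_all
      finally show ?thesis by simp
    qed
    \<comment> \<open>The exponent of \<open>d\<close> in \<open>ne\<close> is negative, so the
      worst case is \<open>d = n\<close>.\<close>
    have iii: "L \<le> C * (n * \<epsilon>) powr a"
    proof -
      have "n powr (- ((2 - \<gamma>) * a)) \<le> d powr (- ((2 - \<gamma>) * a))"
        using d n \<gamma> a by (intro powr_mono2') simp_all
      then have "B * n powr (a * a) * n powr (- ((2 - \<gamma>) * a)) \<le> B * n powr (a * a) * d powr (- ((2 - \<gamma>) * a))"
        using B by (intro mult_left_mono) simp_all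
      also have "B * n powr (a * a) * n powr (- ((2 - \<gamma>) * a)) = B * n powr s"
        by (simp add: s_def mult.assoc powr_add[symmetric] algebra_simps)
      finally have "B * n powr s \<le> (n * \<epsilon>) powr a" using ne by (rule order_trans)
      then have "n powr s \<le> (n * \<epsilon>) powr a / B" using B by (simp only: pos_le_divide_eq mult.commute)
      moreover have "L \<le> n powr s / s" unfolding L_def using n s by (intro ln_powr_bound) simp_all
      moreover have "n powr s / s \<le> (n * \<epsilon>) powr a / B / s" if "n powr s \<le> (n * \<epsilon>) powr a / B"
        using that s by (intro divide_right_mono) simp_all
      ultimately have "L \<le> (n * \<epsilon>) powr a / B / s" by linarith
      also have "\<dots> = 1 / (s * B) * (n * \<epsilon>) powr a" by simp
      also have "\<dots> \<le> C * (n * \<epsilon>) powr a" by (intro mult_right_mono Cs) simp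
      finally show ?thesis .
    qed
    \<comment> \<open>\<open>d powr (- (2 - \<gamma>))\<close> is split into the factor occurring in
      \<open>ne\<close> and one with exponent between -1 and 0, which is at most 3. The powers of
      \<open>n\<close> compare because \<open>2 * a - 1 \<le> a * a\<close>.\<close>
    have iv: "L * (\<epsilon> * d) powr - p \<le> C * (n * \<epsilon>) powr a"
    proof -
      have "2 * a - 1 \<le> a * a" using zero_le_power2[of "a - 1"] by (simp add: power2_eq_square algebra_simps)
      then have 1: "n powr (2 * a - 1) \<le> n powr (a * a)" using n by (intro powr_mono) simp_all
      have "(2 - \<gamma>) * (1 - a) \<le> 1 * 1" using \<gamma> a by (intro mult_mono) simp_all
      then have "d powr (- ((2 - \<gamma>) * (1 - a))) \<le> 3" using \<gamma> a by (intro d3) simp_all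
      moreover have "d powr (- (2 - \<gamma>)) = d powr (- ((2 - \<gamma>) * a)) * d powr (- ((2 - \<gamma>) * (1 - a)))"
        by (simp add: powr_add[symmetric] algebra_simps)
      ultimately have "d powr (- (2 - \<gamma>)) \<le> d powr (- ((2 - \<gamma>) * a)) * 3"
        by (simp add: mult_left_mono)
      with 1 have "n powr (2 * a - 1) * d powr (- (2 - \<gamma>)) \<le> n powr (a * a) * (d powr (- ((2 - \<gamma>) * a)) * 3)"
        by (intro mult_mono) simp_all
      also have "\<dots> = 3 / B * (B * n powr (a * a) * d powr (- ((2 - \<gamma>) * a)))" using B by simp
      also have "\<dots> \<le> 3 / B * (n * \<epsilon>) powr a" using ne B by (intro mult_left_mono) simp_all
      also have "\<dots> \<le> C * (n * \<epsilon>) powr a" by (intro mult_right_mono Cs) simp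
      finally show ?thesis using ii by linarith
    qed
    have v: "L * (\<epsilon> * d) powr - p \<le> C * n powr (2 * a - 1)"
    proof -
      have "n powr (2 * a - 1) * d powr (- (2 - \<gamma>)) \<le> n powr (2 * a - 1) * C"
        using d3[of "2 - \<gamma>"] \<gamma> Cs(2) by (intro mult_left_mono) simp_all
      with ii show ?thesis by (simp add: mult.commute)
    qed
    have exps: "2 / \<gamma> - 1 = 2 * a - 1" "1 / \<gamma> = a" by (simp_all add: a_def)
    show "ln n \<le> C * min (n powr (2 / \<gamma> - 1)) ((n * \<epsilon>) powr (1 / \<gamma>)) \<and>
       ln n * (\<epsilon> * d) powr (- ((2 - \<gamma>) / (\<gamma> - 1))) \<le> C * min (n powr (2 / \<gamma> - 1)) ((n * \<epsilon>) powr (1 / \<gamma>))"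
      unfolding L_def[symmetric] p_def[symmetric] exps using i iii iv v by (simp add: min_def)
  qed
qed


section \<open>Random walks\<close>

lemma nn_integral_measure_spmf_case:
  "(\<integral>\<^sup>+ x. f x \<partial>measure_spmf p) = (\<integral>\<^sup>+ r. (case r of None \<Rightarrow> 0 | Some x \<Rightarrow> f x) \<partial>measure_pmf p)"
proof -
  have "(\<integral>\<^sup>+ x. f x \<partial>measure_spmf p)
      = (\<integral>\<^sup>+ r. (f \<circ> the) r * indicator (range Some) r \<partial>measure_pmf p)"
    by (subst nn_integral_measure_spmf_conv_measure_pmf, simp)
       (subst nn_integral_restrict_space, simp_all)
  also have "\<dots> = (\<integral>\<^sup>+ r. (case r of None \<Rightarrow> 0 | Some x \<Rightarrow> f x) \<partial>measure_pmf p)"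
    by (intro nn_integral_cong) (auto split: option.split simp: indicator_def)
  finally show ?thesis .
qed

lemma nn_integral_bind_spmf:
  "(\<integral>\<^sup>+ x. f x \<partial>measure_spmf (p \<bind> g)) = (\<integral>\<^sup>+ y. (\<integral>\<^sup>+ x. f x \<partial>measure_spmf (g y)) \<partial>measure_spmf p)"
  unfolding nn_integral_measure_spmf_case bind_spmf_def
  by (auto intro!: nn_integral_cong split: option.split)

lemma nn_integral_return_spmf: "(\<integral>\<^sup>+ x. f x \<partial>measure_spmf (return_spmf y)) = f y"
  by (simp add: nn_integral_measure_spmf_case)

lemma nn_integral_spmf_of_pmf: "(\<integral>\<^sup>+ x. f x \<partial>measure_spmf (spmf_of_pmf p)) = (\<integral>\<^sup>+ x. f x \<partial>measure_pmf p)"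
  by simp

lemma nn_integral_spmf_const_le: "(\<integral>\<^sup>+ x. k \<partial>measure_spmf p) \<le> k"
proof -
  have "k * emeasure (measure_spmf p) (space (measure_spmf p)) \<le> k * 1"
    by (intro mult_left_mono measure_spmf.subprob_emeasure_le_1) auto
  then show ?thesis by simp
qed

lemma nn_integral_spmf_cong_set:
  assumes "\<And>x. x \<in> set_spmf p \<Longrightarrow> f x \<le> g x"
  shows "(\<integral>\<^sup>+ x. f x \<partial>measure_spmf p) \<le> (\<integral>\<^sup>+ x. g x \<partial>measure_spmf p)"
  by (rule nn_integral_mono_AE) (use assms in auto)

text \<open>\<open>expected_cost\<close> charges infinity for divergence, whereas the integral over
  \<open>measure_spmf\<close> charges nothing; they agree because \<open>None\<close> carries no
  mass.\<close>

lemma expected_cost_lossless: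
  assumes "lossless_spmf p"
  shows "expected_cost p = (\<integral>\<^sup>+ x. of_nat (snd x) \<partial>measure_spmf p)"
  unfolding expected_cost_def nn_integral_measure_spmf_case
proof (rule nn_integral_cong_AE, rule AE_pmfI)
  fix r assume "r \<in> set_pmf p"
  with assms have "r \<noteq> None" by (metis lossless_iff_set_pmf_None)
  then show "(case r of None \<Rightarrow> \<infinity> | Some (a, k) \<Rightarrow> of_nat k)
      = (case r of None \<Rightarrow> 0 | Some x \<Rightarrow> (of_nat (snd x) :: ennreal))"
    by (auto split: option.split)
qed

lemma lossless_replicate_spmf: "lossless_spmf p \<Longrightarrow> lossless_spmf (replicate_spmf k p)"
  by (induction k) (auto simp: lossless_bind_spmf)

lemma length_replicate_spmf: "xs \<in> set_spmf (replicate_spmf k p) \<Longrightarrow> length xs = k"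
  by (induction k arbitrary: xs) (auto simp: set_bind_spmf)

text \<open>Linearity of expectation. It is only an inequality because a constant may integrate to
  less than itself over a subprobability.\<close>

lemma nn_integral_replicate_spmf:
  fixes f :: "'b \<Rightarrow> ennreal"
  shows "(\<integral>\<^sup>+ xs. sum_list (map f xs) \<partial>measure_spmf (replicate_spmf k p))
      \<le> of_nat k * (\<integral>\<^sup>+ x. f x \<partial>measure_spmf p)"
proof (induction k)
  case 0
  then show ?case by (simp add: nn_integral_return_spmf)
next
  case (Suc k)
  let ?R = "measure_spmf (replicate_spmf k p)"
  have "(\<integral>\<^sup>+ xs. sum_list (map f xs) \<partial>measure_spmf (replicate_spmf (Suc k) p))
      = (\<integral>\<^sup>+ x. \<integral>\<^sup>+ xs. f x + sum_list (map f xs) \<partial>?R \<partial>measure_spmf p)"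
    by (simp add: nn_integral_bind_spmf nn_integral_return_spmf)
  also have "\<dots> = (\<integral>\<^sup>+ x. (\<integral>\<^sup>+ xs. f x \<partial>?R) + (\<integral>\<^sup>+ xs. sum_list (map f xs) \<partial>?R) \<partial>measure_spmf p)"
    by (simp add: nn_integral_add)
  also have "\<dots> \<le> (\<integral>\<^sup>+ x. f x + of_nat k * (\<integral>\<^sup>+ x. f x \<partial>measure_spmf p) \<partial>measure_spmf p)"
    by (intro nn_integral_mono add_mono nn_integral_spmf_const_le Suc)
  also have "\<dots> = (\<integral>\<^sup>+ x. f x \<partial>measure_spmf p)
      + (\<integral>\<^sup>+ y. of_nat k * (\<integral>\<^sup>+ x. f x \<partial>measure_spmf p) \<partial>measure_spmf p)"
    by (simp add: nn_integral_add)
  also have "\<dots> \<le> (\<integral>\<^sup>+ x. f x \<partial>measure_spmf p) + of_nat k * (\<integral>\<^sup>+ x. f x \<partial>measure_spmf p)"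
    by (intro add_left_mono nn_integral_spmf_const_le)
  also have "\<dots> = of_nat (Suc k) * (\<integral>\<^sup>+ x. f x \<partial>measure_spmf p)"
    by (simp add: distrib_right)
  finally show ?case .
qed

lemma nn_integral_replicate_concat_spmf:
  fixes f :: "'b \<Rightarrow> ennreal"
  shows "(\<integral>\<^sup>+ xss. sum_list (map f (concat xss)) \<partial>measure_spmf (replicate_spmf k (replicate_spmf k' p)))
      \<le> of_nat (k * k') * (\<integral>\<^sup>+ x. f x \<partial>measure_spmf p)"
proof -
  have "sum_list (map f (concat xss)) = sum_list (map (\<lambda>xs. sum_list (map f xs)) xss)" for xss
    by (induction xss) auto
  then have "(\<integral>\<^sup>+ xss. sum_list (map f (concat xss)) \<partial>measure_spmf (replicate_spmf k (replicate_spmf k' p)))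
      \<le> of_nat k * (\<integral>\<^sup>+ xs. sum_list (map f xs) \<partial>measure_spmf (replicate_spmf k' p))"
    using nn_integral_replicate_spmf by simp
  also have "\<dots> \<le> of_nat k * (of_nat k' * (\<integral>\<^sup>+ x. f x \<partial>measure_spmf p))"
    by (intro mult_left_mono nn_integral_replicate_spmf) auto
  finally show ?thesis by (simp add: mult.assoc)
qed

section \<open>Occupation and termination probabilities of the walk\<close>

locale walk_graph = pair_fin_digraph G for G :: "'a pair_pre_digraph" +
  fixes c :: real
  assumes c_pos: "0 < c" and c_less_1: "c < 1"
begin

abbreviation "V \<equiv> pverts G"
abbreviation "\<beta> \<equiv> 1 - sqrt c"

lemma sqrt_c: "0 < sqrt c" "sqrt c < 1" "0 \<le> sqrt c" "sqrt c \<le> 1"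
  using c_pos c_less_1 by auto

lemma beta: "0 < \<beta>" "\<beta> < 1" "0 \<le> \<beta>" "\<beta> \<le> 1"
  using sqrt_c by auto

lemma finite_nbrs [simp]: "finite (in_nbrs G v)" "finite (out_nbrs G v)"
  by (rule finite_subset[OF _ finite_imageI[OF pair_finite_arcs, of fst]],
      force simp: in_nbrs_def)
     (rule finite_subset[OF _ finite_imageI[OF pair_finite_arcs, of snd]],
      force simp: out_nbrs_def)

lemma finite_V [simp]: "finite V" by (rule pair_finite_verts)

lemma nbrs_subset: "in_nbrs G v \<subseteq> V" "out_nbrs G v \<subseteq> V"
  by (auto simp: in_nbrs_def out_nbrs_def dest: in_arcsD1 in_arcsD2)

lemma in_nbrs_iff_out_nbrs: "x \<in> in_nbrs G y \<longleftrightarrow> y \<in> out_nbrs G x"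
  by (auto simp: in_nbrs_def out_nbrs_def)

lemma d_in_pos: "y \<in> out_nbrs G x \<Longrightarrow> d_in G y > 0"
  unfolding d_in_def using in_nbrs_iff_out_nbrs finite_nbrs by (metis card_gt_0_iff empty_iff)

lemma sum_nbrs_swap: "(\<Sum>x\<in>V. \<Sum>y\<in>out_nbrs G x. f x y) = (\<Sum>y\<in>V. \<Sum>x\<in>in_nbrs G y. (f x y :: 'b :: comm_monoid_add))"
proof -
  have 1: "Sigma V (out_nbrs G) = parcs G"
    by (auto simp: out_nbrs_def dest: in_arcsD1)
  have "(\<Sum>x\<in>V. \<Sum>y\<in>out_nbrs G x. f x y) = (\<Sum>(x,y)\<in>parcs G. f x y)"
    by (subst sum.Sigma) (auto simp: 1)
  also have "\<dots> = (\<Sum>(y,x)\<in>Sigma V (in_nbrs G). f x y)"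
    by (rule sum.reindex_bij_witness[of _ prod.swap prod.swap])
       (auto simp: in_nbrs_def dest: in_arcsD2)
  also have "\<dots> = (\<Sum>y\<in>V. \<Sum>x\<in>in_nbrs G y. f x y)"
    by (subst sum.Sigma) auto
  finally show ?thesis .
qed

lemma sum_d_out: "(\<Sum>v\<in>V. d_out G v) = num_edges G"
proof -
  have 1: "Sigma V (out_nbrs G) = parcs G"
    by (auto simp: out_nbrs_def dest: in_arcsD1)
  show ?thesis unfolding d_out_def num_edges_def 1[symmetric] by (subst card_SigmaI) auto
qed

lemma num_edges_le: "num_edges G \<le> num_nodes G ^ 2"
proof -
  have "parcs G \<subseteq> V \<times> V" by (auto dest: in_arcsD1 in_arcsD2)
  then have "card (parcs G) \<le> card (V \<times> V)" by (intro card_mono) auto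
  then show ?thesis by (simp add: num_edges_def num_nodes_def card_cartesian_product power2_eq_square)
qed

text \<open>The probability that the walk from \<open>v\<close> makes at least \<open>l\<close> steps and is at \<open>w\<close> after \<open>l\<close> steps.\<close>

primrec hit :: "'a \<Rightarrow> nat \<Rightarrow> 'a \<Rightarrow> real" where
  "hit w 0 v = (if v = w then 1 else 0)"
| "hit w (Suc l) v = sqrt c / real (d_in G v) * (\<Sum>x\<in>in_nbrs G v. hit w l x)"

text \<open>The factor that turns \<open>hit\<close> into \<open>ppr\<close>: without in-neighbours
  both outcomes of the coin end the walk.\<close>

definition stop_prob :: "'a \<Rightarrow> real" where
  "stop_prob v = (if in_nbrs G v = {} then 1 else \<beta>)"

lemma stop_prob: "\<beta> \<le> stop_prob v" "stop_prob v \<le> 1" "0 \<le> stop_prob v"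
  using beta by (auto simp: stop_prob_def)

lemma hit_nonneg: "0 \<le> hit w l v"
  using sqrt_c by (induction l arbitrary: v) (auto intro!: mult_nonneg_nonneg divide_nonneg_nonneg sum_nonneg)

text \<open>Summed over the endpoint, \<open>hit\<close> becomes the probability of surviving
  \<open>l\<close> steps, and each step is survived with probability at most
  \<open>sqrt c\<close>.\<close>

lemma sum_hit_le:
  assumes "v \<in> V" shows "(\<Sum>w\<in>V. hit w l v) \<le> sqrt c ^ l"
  using assms
proof (induction l arbitrary: v)
  case 0 then show ?case by simp
next
  case (Suc l)
  have "(\<Sum>w\<in>V. hit w (Suc l) v) = sqrt c / real (d_in G v) * (\<Sum>x\<in>in_nbrs G v. \<Sum>w\<in>V. hit w l x)"
    by (subst sum.swap) (simp add: sum_distrib_left sum_divide_distrib)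
  also have "\<dots> \<le> sqrt c / real (d_in G v) * (\<Sum>x\<in>in_nbrs G v. sqrt c ^ l)"
    using sqrt_c nbrs_subset by (intro mult_left_mono sum_mono Suc.IH) auto
  also have "\<dots> \<le> sqrt c ^ Suc l"
    using sqrt_c by (cases "d_in G v = 0") (auto simp: d_in_def)
  finally show ?case .
qed

lemma hit_le:
  assumes "v \<in> V" "w \<in> V" shows "hit w l v \<le> sqrt c ^ l"
proof -
  have "hit w l v \<le> (\<Sum>w\<in>V. hit w l v)"
    using assms by (intro member_le_sum) (auto simp: hit_nonneg)
  with sum_hit_le[OF assms(1)] show ?thesis by (rule order_trans[rotated])
qed

text \<open>First-step analysis. At a node without in-neighbours the second summand is 0 / 0 = 0, so
  one formula covers both cases.\<close>

lemma nn_integral_sqrtc_walk: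
  "(\<integral>\<^sup>+ p. f p \<partial>measure_spmf (sqrtc_walk c G v))
     = ennreal (stop_prob v) * f [v]
     + ennreal (sqrt c) * ((\<Sum>x\<in>in_nbrs G v. \<integral>\<^sup>+ p. f (v # p) \<partial>measure_spmf (sqrtc_walk c G x)) / of_nat (d_in G v))"
proof (cases "in_nbrs G v = {}")
  case True
  show ?thesis
    by (subst sqrtc_walk.simps)
       (simp add: True nn_integral_bind_spmf nn_integral_return_spmf stop_prob_def)
next
  case False
  then show ?thesis
    by (subst sqrtc_walk.simps)
       (use sqrt_c False in \<open>simp add: nn_integral_bind_spmf nn_integral_return_spmf nn_integral_spmf_of_set
          stop_prob_def d_in_def mult.commute add.commute del: bind_spmf_of_pmf\<close>)
qed

text \<open>The walk is a least fixed point, so termination has to be proved: by induction it has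
  probability at least \<open>1 - sqrt c ^ l\<close> for every \<open>l\<close>, and the limit gives
  1.\<close>

lemma lossless_sqrtc_walk: "lossless_spmf (sqrtc_walk c G v)"
proof -
  let ?W = "\<lambda>v. \<integral>\<^sup>+ p. 1 \<partial>measure_spmf (sqrtc_walk c G v)"
  have *: "1 - ennreal (sqrt c ^ l) \<le> ?W v" for l v
  proof (induction l arbitrary: v)
    case 0 then show ?case by simp
  next
    case (Suc l)
    show ?case
    proof (cases "in_nbrs G v = {}")
      case True
      show ?thesis by (subst nn_integral_sqrtc_walk) (use True in \<open>simp add: stop_prob_def\<close>)
    next
      case False
      then have d: "d_in G v > 0" by (simp add: d_in_def card_gt_0_iff)
      have "1 - ennreal (sqrt c ^ Suc l) = ennreal (1 - sqrt c ^ Suc l)"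
        using sqrt_c by (simp add: ennreal_1[symmetric] ennreal_minus del: ennreal_1)
      also have "1 - sqrt c ^ Suc l = \<beta> + sqrt c * (1 - sqrt c ^ l)"
        by (simp add: algebra_simps)
      also have "ennreal \<dots> = ennreal \<beta> + ennreal (sqrt c) * ennreal (1 - sqrt c ^ l)"
        using sqrt_c by (simp add: ennreal_mult power_le_one)
      also have "ennreal (1 - sqrt c ^ l) = (\<Sum>x\<in>in_nbrs G v. ennreal (1 - sqrt c ^ l)) / of_nat (d_in G v)"
        using d by (simp add: d_in_def[symmetric] mult_divide_eq_ennreal mult.commute[of "of_nat _"])
      also have "ennreal \<beta> + ennreal (sqrt c) * \<dots> \<le> ?W v"
      proof (subst nn_integral_sqrtc_walk, intro add_mono mult_left_mono divide_right_mono_ennreal sum_mono)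
        show "ennreal \<beta> \<le> ennreal (stop_prob v) * 1" using stop_prob by (simp add: ennreal_leI)
        fix x
        show "ennreal (1 - sqrt c ^ l) \<le> (\<integral>\<^sup>+ p. 1 \<partial>measure_spmf (sqrtc_walk c G x))"
          using Suc[of x] sqrt_c by (simp add: ennreal_1[symmetric] ennreal_minus del: ennreal_1)
      qed auto
      finally show ?thesis .
    qed
  qed
  have "1 - sqrt c ^ l \<le> weight_spmf (sqrtc_walk c G v)" for l
  proof -
    have "ennreal (1 - sqrt c ^ l) = 1 - ennreal (sqrt c ^ l)"
      using sqrt_c by (simp add: ennreal_1[symmetric] ennreal_minus del: ennreal_1)
    also have "\<dots> \<le> ennreal (weight_spmf (sqrtc_walk c G v))"
      using *[of l v] by (simp add: measure_spmf.emeasure_eq_measure)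
    finally show ?thesis by (simp add: ennreal_le_iff)
  qed
  moreover have "(\<lambda>l. 1 - sqrt c ^ l) \<longlonglongrightarrow> 1 - 0"
    using sqrt_c by (intro tendsto_diff tendsto_const LIMSEQ_power_zero) auto
  ultimately have "1 \<le> weight_spmf (sqrtc_walk c G v)"
    using LIMSEQ_le_const2[of "\<lambda>l. 1 - sqrt c ^ l" 1] by auto
  then show ?thesis using weight_spmf_le_1[of "sqrtc_walk c G v"] by (auto simp: lossless_spmf_def)
qed

lemma set_sqrtc_walk:
  assumes "p \<in> set_spmf (sqrtc_walk c G v)"
  shows "p = [v] \<or> (\<exists>x q. p = v # q \<and> x \<in> in_nbrs G v \<and> q \<in> set_spmf (sqrtc_walk c G x))"
  using assms
  by (subst (asm) sqrtc_walk.simps) (auto simp: set_bind_spmf simp del: bind_spmf_of_pmf split: if_splits)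

lemma sqrtc_walk_nonempty: "p \<in> set_spmf (sqrtc_walk c G v) \<Longrightarrow> p \<noteq> []"
  using set_sqrtc_walk by blast

lemma sqrtc_walk_last:
  assumes "v \<in> V" "p \<in> set_spmf (sqrtc_walk c G v)" shows "last p \<in> V"
  using assms
proof (induction p arbitrary: v)
  case Nil
  then show ?case using sqrtc_walk_nonempty by blast
next
  case (Cons y p)
  from set_sqrtc_walk[OF Cons.prems(2)]
  consider "y = v" "p = []" | x where "x \<in> in_nbrs G v" "p \<in> set_spmf (sqrtc_walk c G x)"
    by blast
  then show ?case
  proof cases
    case 1 then show ?thesis using Cons.prems by simp
  next
    case 2
    then show ?thesis using Cons.IH[of x] nbrs_subset sqrtc_walk_nonempty by fastforce
  qed
qed

lemma ppr_eq_emeasure: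
  "ennreal (ppr c G l u w) = (\<integral>\<^sup>+ p. (if (length p - 1, last p) = (l, w) then 1 else 0) \<partial>measure_spmf (sqrtc_walk c G u))"
  unfolding ppr_def ennreal_spmf_map_conv_nn_integral
  by (intro nn_integral_cong) (auto simp: indicator_def)

text \<open>To terminate at \<open>w\<close> after \<open>l\<close> steps is to be there after
  \<open>l\<close> steps and then stop. Both sides are computed by first-step analysis from the
  start \<open>u\<close>.\<close>

lemma ppr_eq: "ppr c G l u w = hit w l u * stop_prob w"
proof -
  let ?I = "\<lambda>l u. \<integral>\<^sup>+ p. (if (length p - 1, last p) = (l, w) then 1 else 0) \<partial>measure_spmf (sqrtc_walk c G u)"
  have "?I l u = ennreal (hit w l u * stop_prob w)"
  proof (induction l arbitrary: u)
    case 0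
    have "(\<integral>\<^sup>+ p. (if (length (u # p) - 1, last (u # p)) = (0, w) then 1 else 0) \<partial>measure_spmf (sqrtc_walk c G x)) = 0" for x
    proof -
      have "(\<integral>\<^sup>+ p. (if (length (u # p) - 1, last (u # p)) = (0, w) then 1 else 0) \<partial>measure_spmf (sqrtc_walk c G x))
         \<le> (\<integral>\<^sup>+ p. 0 \<partial>measure_spmf (sqrtc_walk c G x))"
        by (rule nn_integral_spmf_cong_set) (auto dest: sqrtc_walk_nonempty)
      then show ?thesis by simp
    qed
    then show ?case by (subst nn_integral_sqrtc_walk) simp
  next
    case (Suc l)
    have "(\<integral>\<^sup>+ p. (if (length (u # p) - 1, last (u # p)) = (Suc l, w) then 1 else 0) \<partial>measure_spmf (sqrtc_walk c G x)) = ?I l x" for x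
    proof -
      have 1: "p \<in> set_spmf (sqrtc_walk c G x) \<Longrightarrow> ((length (u # p) - 1, last (u # p)) = (Suc l, w)) = ((length p - 1, last p) = (l, w))" for p
        using sqrtc_walk_nonempty[of p x] by (cases p) auto
      show ?thesis
        by (rule antisym; rule nn_integral_spmf_cong_set; simp only: 1; simp)
    qed
    then have "?I (Suc l) u = ennreal (sqrt c) * ((\<Sum>x\<in>in_nbrs G u. ennreal (hit w l x * stop_prob w)) / of_nat (d_in G u))"
      by (subst nn_integral_sqrtc_walk) (simp only: Suc, simp)
    also have "(\<Sum>x\<in>in_nbrs G u. ennreal (hit w l x * stop_prob w)) / of_nat (d_in G u)
        = ennreal ((\<Sum>x\<in>in_nbrs G u. hit w l x) * stop_prob w / real (d_in G u))"
    proof (cases "in_nbrs G u = {}")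
      case False
      then have "d_in G u > 0" by (simp add: d_in_def card_gt_0_iff)
      then show ?thesis
        by (simp add: sum_ennreal hit_nonneg stop_prob sum_distrib_right ennreal_of_nat_eq_real_of_nat
            divide_ennreal sum_nonneg)
    qed simp
    also have "ennreal (sqrt c) * \<dots> = ennreal (hit w (Suc l) u * stop_prob w)"
      using sqrt_c by (simp add: ennreal_mult[symmetric] hit_nonneg stop_prob sum_nonneg mult_ac)
    finally show ?case .
  qed
  then have "ennreal (ppr c G l u w) = ennreal (hit w l u * stop_prob w)"
    by (simp add: ppr_eq_emeasure)
  then show ?thesis
    by (simp add: ppr_def hit_nonneg stop_prob)
qed

lemma ppr_nonneg: "0 \<le> ppr c G l u w"
  by (simp add: ppr_def)

lemma ppr_le_hit: "ppr c G l u w \<le> hit w l u"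
  unfolding ppr_eq using mult_left_mono[OF stop_prob(2)[of w] hit_nonneg[of w l u]] by simp

text \<open>With \<open>ppr_le_hit\<close> this makes the two interchangeable up to \<beta>:
  \<open>hit\<close> has the clean recursion, \<open>ppr\<close> is what sums to the reverse
  PageRank.\<close>

lemma hit_le_ppr: "\<beta> * hit w l u \<le> ppr c G l u w"
  unfolding ppr_eq using mult_right_mono[OF stop_prob(1)[of w] hit_nonneg[of w l u]] by (simp add: mult.commute)

lemma ppr_le: "u \<in> V \<Longrightarrow> w \<in> V \<Longrightarrow> ppr c G l u w \<le> sqrt c ^ l"
  using ppr_le_hit hit_le by (rule order_trans)

text \<open>\<open>reverse_pagerank\<close> contains a real infinite sum, which carries no
  information unless it converges.\<close>

lemma summable_ppr: "u \<in> V \<Longrightarrow> w \<in> V \<Longrightarrow> summable (\<lambda>l. ppr c G l u w)"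
  by (rule summable_comparison_test'[OF summable_geometric[of "sqrt c"]])
     (simp_all add: c_pos c_less_1 less_imp_le ppr_nonneg ppr_le)

end


section \<open>Reverse PageRank as the law of the endpoint\<close>

context walk_graph
begin

abbreviation "rpr \<equiv> reverse_pagerank c G"

text \<open>Each walk contributes to exactly one term of the double sum, that of its own length and
  endpoint.\<close>

lemma nn_integral_walk_decomp:
  assumes u: "u \<in> V"
  shows "(\<integral>\<^sup>+ p. F (length p - 1) (last p) \<partial>measure_spmf (sqrtc_walk c G u))
     = (\<Sum>l. \<Sum>w\<in>V. ennreal (ppr c G l u w) * F l w)"
proof -
  let ?i = "\<lambda>p l w. (if (length p - 1, last p) = (l, w) then 1 else 0) :: ennreal"
  have split: "F (length p - 1) (last p) = (\<Sum>l. \<Sum>w\<in>V. ?i p l w * F l w)"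
    if "p \<in> set_spmf (sqrtc_walk c G u)" for p
  proof -
    have V: "last p \<in> V" by (rule sqrtc_walk_last[OF u that])
    have "(\<Sum>l. \<Sum>w\<in>V. ?i p l w * F l w) = (\<Sum>l\<in>{length p - 1}. \<Sum>w\<in>V. ?i p l w * F l w)"
      by (rule suminf_finite) auto
    also have "\<dots> = (\<Sum>w\<in>V. ?i p (length p - 1) w * F (length p - 1) w)" by simp
    also have "\<dots> = F (length p - 1) (last p)"
      by (subst sum.remove[OF finite_V V], subst sum.neutral) auto
    finally show ?thesis by (rule sym)
  qed
  have "(\<integral>\<^sup>+ p. F (length p - 1) (last p) \<partial>measure_spmf (sqrtc_walk c G u))
     = (\<integral>\<^sup>+ p. (\<Sum>l. \<Sum>w\<in>V. ?i p l w * F l w) \<partial>measure_spmf (sqrtc_walk c G u))"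
    by (rule nn_integral_cong_AE, unfold AE_measure_spmf_iff, rule ballI, erule split)
  also have "\<dots> = (\<Sum>l. \<Sum>w\<in>V. (\<integral>\<^sup>+ p. ?i p l w \<partial>measure_spmf (sqrtc_walk c G u)) * F l w)"
    by (subst nn_integral_suminf, simp, subst nn_integral_sum, simp, subst nn_integral_multc, simp, rule refl)
  finally show ?thesis by (simp only: ppr_eq_emeasure)
qed

lemma rpr_eq: "w \<in> V \<Longrightarrow> real (num_nodes G) * rpr w = (\<Sum>u\<in>V. \<Sum>l. ppr c G l u w)"
  unfolding reverse_pagerank_def by (auto simp: num_nodes_def)

text \<open>No walk leaves the vertex set, so the value outside it is 0; the unrestricted form
  spares membership conditions in later estimates.\<close>

lemma rpr_nonneg: "0 \<le> rpr w"
proof (cases "w \<in> V")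
  case True
  then show ?thesis unfolding reverse_pagerank_def
    by (intro mult_nonneg_nonneg sum_nonneg suminf_nonneg summable_ppr) (auto simp: ppr_nonneg)
next
  case False
  have "hit w l v = 0" if "v \<in> V" for l v
    using that
  proof (induction l arbitrary: v)
    case (Suc l)
    then have "(\<Sum>x\<in>in_nbrs G v. hit w l x) = 0" using nbrs_subset by (intro sum.neutral) auto
    then show ?case by simp
  qed (use False in auto)
  then show ?thesis unfolding reverse_pagerank_def by (simp add: ppr_eq)
qed

lemma suminf_sum_ppr:
  assumes "w \<in> V"
  shows "(\<Sum>l. \<Sum>u\<in>V. ennreal (ppr c G l u w)) = ennreal (real (num_nodes G) * rpr w)"
proof -
  have "(\<Sum>l. \<Sum>u\<in>V. ennreal (ppr c G l u w)) = (\<Sum>u\<in>V. \<Sum>l. ennreal (ppr c G l u w))"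
    by (rule suminf_sum) (rule summableI)
  also have "\<dots> = (\<Sum>u\<in>V. ennreal (\<Sum>l. ppr c G l u w))"
    using assms by (intro sum.cong refl suminf_ennreal2) (auto simp: ppr_nonneg summable_ppr)
  also have "\<dots> = ennreal (\<Sum>u\<in>V. \<Sum>l. ppr c G l u w)"
    using assms by (intro sum_ennreal suminf_nonneg) (auto simp: ppr_nonneg summable_ppr)
  finally show ?thesis using rpr_eq[OF assms] by simp
qed

lemma sum_ppr_le:
  assumes "w \<in> V"
  shows "(\<Sum>l<k. \<Sum>u\<in>V. ppr c G l u w) \<le> real (num_nodes G) * rpr w"
proof -
  have "(\<Sum>l<k. \<Sum>u\<in>V. ppr c G l u w) = (\<Sum>u\<in>V. \<Sum>l<k. ppr c G l u w)" by (rule sum.swap)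
  also have "\<dots> \<le> (\<Sum>u\<in>V. \<Sum>l. ppr c G l u w)"
    using assms by (intro sum_mono sum_le_suminf) (auto simp: ppr_nonneg summable_ppr)
  finally show ?thesis using rpr_eq[OF assms] by simp
qed

text \<open>Averaged over the start, the endpoint has law \<open>rpr\<close>; the factor
  \<open>num_nodes G\<close> is the division by \<open>n\<close> that a sum over all starts
  lacks.\<close>

lemma sum_walk_last:
  "(\<Sum>u\<in>V. \<integral>\<^sup>+ p. h (last p) \<partial>measure_spmf (sqrtc_walk c G u))
    = (\<Sum>w\<in>V. ennreal (real (num_nodes G) * rpr w) * h w)"
proof -
  have "(\<Sum>u\<in>V. \<integral>\<^sup>+ p. h (last p) \<partial>measure_spmf (sqrtc_walk c G u))
      = (\<Sum>u\<in>V. \<Sum>l. \<Sum>w\<in>V. ennreal (ppr c G l u w) * h w)"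
    by (rule sum.cong[OF refl]) (rule nn_integral_walk_decomp)
  also have "\<dots> = (\<Sum>l. \<Sum>u\<in>V. \<Sum>w\<in>V. ennreal (ppr c G l u w) * h w)"
    by (rule suminf_sum[symmetric]) (rule summableI)
  also have "\<dots> = (\<Sum>l. \<Sum>w\<in>V. (\<Sum>u\<in>V. ennreal (ppr c G l u w)) * h w)"
    by (subst sum.swap) (simp add: sum_distrib_right)
  also have "\<dots> = (\<Sum>w\<in>V. \<Sum>l. (\<Sum>u\<in>V. ennreal (ppr c G l u w)) * h w)"
    by (rule suminf_sum) (rule summableI)
  also have "\<dots> = (\<Sum>w\<in>V. ennreal (real (num_nodes G) * rpr w) * h w)"
    by (rule sum.cong[OF refl]) (simp add: suminf_sum_ppr)
  finally show ?thesis .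
qed

text \<open>Termination after \<open>l\<close> steps is bounded by survival of \<open>l\<close>
  steps, and the sum of \<open>(l + 1) * sqrt c ^ l\<close> is
  \<open>1 / \<beta>\<^sup>2\<close>.\<close>

lemma nn_integral_length_walk:
  assumes u: "u \<in> V"
  shows "(\<integral>\<^sup>+ p. of_nat (length p) \<partial>measure_spmf (sqrtc_walk c G u)) \<le> ennreal (1 / \<beta>\<^sup>2)"
proof -
  have "(\<integral>\<^sup>+ p. of_nat (length p) \<partial>measure_spmf (sqrtc_walk c G u))
     \<le> (\<integral>\<^sup>+ p. of_nat (Suc (length p - 1)) \<partial>measure_spmf (sqrtc_walk c G u))"
    by (intro nn_integral_mono of_nat_mono) simp
  also have "\<dots> = (\<Sum>l. \<Sum>w\<in>V. ennreal (ppr c G l u w) * of_nat (Suc l))"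
    by (rule nn_integral_walk_decomp[OF u])
  also have "\<dots> \<le> (\<Sum>l. ennreal (of_nat (Suc l) * sqrt c ^ l))"
  proof (intro suminf_le summableI)
    fix l
    have "(\<Sum>w\<in>V. ppr c G l u w) \<le> sqrt c ^ l"
      using sum_hit_le[OF u, of l] by (rule order_trans[rotated]) (intro sum_mono ppr_le_hit)
    then have "(\<Sum>w\<in>V. ennreal (ppr c G l u w)) \<le> ennreal (sqrt c ^ l)"
      by (simp add: sum_ennreal ppr_nonneg ennreal_leI)
    then have "(\<Sum>w\<in>V. ennreal (ppr c G l u w) * of_nat (Suc l)) \<le> ennreal (sqrt c ^ l) * of_nat (Suc l)"
      unfolding sum_distrib_right[symmetric] by (intro mult_right_mono) auto
    also have "\<dots> = ennreal (of_nat (Suc l) * sqrt c ^ l)"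
      using sqrt_c by (subst ennreal_mult) (auto simp: ennreal_of_nat_eq_real_of_nat mult.commute simp del: of_nat_Suc)
    finally show "(\<Sum>w\<in>V. ennreal (ppr c G l u w) * of_nat (Suc l)) \<le> \<dots>" .
  qed
  also have "\<dots> = ennreal (1 / \<beta>\<^sup>2)"
    using geometric_deriv_sums[of "sqrt c"] sqrt_c
    by (intro suminf_ennreal_eq) (auto simp: abs_of_nonneg)
  finally show ?thesis .
qed

lemma suminf_sum_hit:
  assumes "v \<in> V" shows "(\<Sum>l. \<Sum>w\<in>V. ennreal (hit w l v)) \<le> ennreal (1 / \<beta>)"
proof -
  have "(\<Sum>l. \<Sum>w\<in>V. ennreal (hit w l v)) \<le> (\<Sum>l. ennreal (sqrt c ^ l))"
    using sum_hit_le[OF assms]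
    by (intro suminf_le summableI) (simp add: sum_ennreal hit_nonneg ennreal_leI)
  also have "\<dots> = ennreal (1 / \<beta>)"
    using geometric_sums[of "sqrt c"] sqrt_c by (intro suminf_ennreal_eq) (auto simp: abs_of_nonneg)
  finally show ?thesis .
qed

text \<open>Walks move to in-neighbours, so a node that is nobody's in-neighbour is visited only by
  the walk that starts there.\<close>

lemma rpr_sink:
  assumes "w \<in> V" "out_nbrs G w = {}"
  shows "rpr w = stop_prob w / real (num_nodes G)"
proof -
  have w: "w \<notin> in_nbrs G v" for v using assms(2) in_nbrs_iff_out_nbrs by blast
  have hit: "hit w (Suc l) v = 0" for l v
  proof (induction l arbitrary: v)
    case 0
    have "(\<Sum>x\<in>in_nbrs G v. hit w 0 x) = 0" by (rule sum.neutral) (use w[of v] in auto)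
    then show ?case by simp
  next
    case (Suc l)
      have "(\<Sum>x\<in>in_nbrs G v. hit w (Suc l) x) = 0" by (rule sum.neutral) (use Suc in blast)
    then show ?case by (subst hit.simps) (simp only: mult_zero_right)
  qed
  have "(\<Sum>l. ppr c G l u w) = (if u = w then stop_prob w else 0)" for u
  proof -
    have "(\<Sum>l. ppr c G l u w) = (\<Sum>l\<in>{0}. ppr c G l u w)"
    proof (rule suminf_finite)
      fix l :: nat assume "l \<notin> {0}"
      then obtain k where "l = Suc k" by (cases l) auto
      then show "ppr c G l u w = 0" by (simp add: ppr_eq hit del: hit.simps)
    qed simp
    then show ?thesis by (simp add: ppr_eq)
  qed
  then have "(\<Sum>u\<in>V. \<Sum>l. ppr c G l u w) = (\<Sum>u\<in>V. if u = w then stop_prob w else 0)"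
    by (intro sum.cong refl)
  also have "\<dots> = stop_prob w" using assms(1) by simp
  finally show ?thesis unfolding reverse_pagerank_def by simp
qed

text \<open>Injectivity allows at most two nodes without out-neighbours, hence
  \<open>n \<le> m + 2\<close>; the factor 3 then uses \<open>m \<ge> 1\<close>.\<close>

lemma num_nodes_le:
  assumes inj: "inj_on rpr V" and n: "num_nodes G \<ge> 2"
  shows "num_nodes G \<le> 3 * num_edges G"
proof -
  define S where "S = {v \<in> V. out_nbrs G v = {}}"
  have inj': "inj_on rpr S" using inj by (rule inj_on_subset) (auto simp: S_def)
  have rS: "rpr ` S \<subseteq> {1 / real (num_nodes G), \<beta> / real (num_nodes G)}"
    by (auto simp: S_def rpr_sink stop_prob_def)
  have "card S = card (rpr ` S)" using card_image[OF inj'] by simp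
  also have "\<dots> \<le> card {1 / real (num_nodes G), \<beta> / real (num_nodes G)}"
    by (rule card_mono[OF _ rS]) simp
  also have "\<dots> \<le> 2" by (simp add: card_insert_if)
  finally have S2: "card S \<le> 2" .
  have "num_nodes G - card S = card (V - S)"
    unfolding num_nodes_def by (subst card_Diff_subset) (auto simp: S_def)
  also have "\<dots> = (\<Sum>v\<in>V - S. 1)" by simp
  also have "\<dots> \<le> (\<Sum>v\<in>V - S. d_out G v)"
    by (rule sum_mono) (auto simp: S_def d_out_def Suc_le_eq card_gt_0_iff)
  also have "\<dots> \<le> (\<Sum>v\<in>V. d_out G v)" by (rule sum_mono2) auto
  finally have m: "num_nodes G - card S \<le> num_edges G" by (simp add: sum_d_out)
  \<comment> \<open>Without edges all nodes also lack in-neighbours, so they would share the value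
    \<open>1 / n\<close>, against injectivity and \<open>n \<ge> 2\<close>.\<close>
  have "num_edges G \<noteq> 0"
  proof
    assume 0: "num_edges G = 0"
    then have "parcs G = {}" by (simp add: num_edges_def pair_finite_arcs)
    then have e: "out_nbrs G v = {}" "in_nbrs G v = {}" for v by (auto simp: out_nbrs_def in_nbrs_def)
    then have "rpr ` V \<subseteq> {1 / real (num_nodes G)}" by (auto simp: rpr_sink stop_prob_def)
    then have "card (rpr ` V) \<le> card {1 / real (num_nodes G)}" by (intro card_mono) auto
    then show False using n card_image[OF inj] by (simp add: num_nodes_def)
  qed
  with m S2 n show ?thesis by linarith
qed

end

section \<open>Preprocessing\<close>

locale prsim_graph = walk_graph +
  fixes \<epsilon> :: real
  assumes eps_pos: "0 < \<epsilon>" and eps_less_1: "\<epsilon> < 1"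
begin

abbreviation "\<rho> \<equiv> r_max c \<epsilon>"

lemma r_max_pos: "0 < \<rho>"
  using eps_pos beta by (simp add: r_max_def)

lemma residue_nonneg: "0 \<le> residue c G \<epsilon> w l v"
  using sqrt_c by (induction l arbitrary: v) (auto intro!: sum_nonneg divide_nonneg_nonneg mult_nonneg_nonneg)

text \<open>The residues obey the recursion of \<open>hit\<close> with the summands below the
  threshold left out.\<close>

lemma residue_le_hit: "residue c G \<epsilon> w l v \<le> hit w l v"
proof (induction l arbitrary: v)
  case (Suc l)
  have "residue c G \<epsilon> w (Suc l) v
      \<le> (\<Sum>x\<in>in_nbrs G v. sqrt c * residue c G \<epsilon> w l x / real (d_in G v))"
    unfolding residue.simps
    by (rule sum_mono2) (use sqrt_c residue_nonneg in \<open>auto intro!: divide_nonneg_nonneg mult_nonneg_nonneg\<close>)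
  also have "\<dots> \<le> (\<Sum>x\<in>in_nbrs G v. sqrt c * hit w l x / real (d_in G v))"
    using sqrt_c Suc by (intro sum_mono divide_right_mono mult_left_mono) auto
  also have "\<dots> = hit w (Suc l) v" by (simp add: sum_distrib_left sum_divide_distrib)
  finally show ?case .
qed simp

lemma reserve_le_ppr: "reserve c G \<epsilon> w l v \<le> ppr c G l v w"
proof -
  have "reserve c G \<epsilon> w l v \<le> \<beta> * hit w l v"
    unfolding reserve_def using beta residue_le_hit[of w l v] hit_nonneg[of w l v]
    by (auto intro!: mult_left_mono)
  from this hit_le_ppr show ?thesis by (rule order_trans)
qed

lemma index_list_eq:
  "index_list c G \<epsilon> w l = (\<lambda>v. (v, reserve c G \<epsilon> w l v)) ` {v \<in> V. reserve c G \<epsilon> w l v > \<rho>}"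
  by (auto simp: index_list_def)

lemma finite_index_list [simp]: "finite (index_list c G \<epsilon> w l)"
  by (simp add: index_list_eq)

text \<open>Counting by mass: every stored tuple accounts for more than \<rho> of
  \<open>ppr\<close>.\<close>

lemma card_index_list: "real (card (index_list c G \<epsilon> w l)) \<le> (\<Sum>v\<in>V. ppr c G l v w) / \<rho>"
proof -
  let ?A = "{v \<in> V. reserve c G \<epsilon> w l v > \<rho>}"
  have "real (card (index_list c G \<epsilon> w l)) * \<rho> \<le> real (card ?A) * \<rho>"
    using r_max_pos unfolding index_list_eq by (intro mult_right_mono of_nat_mono card_image_le) auto
  also have "\<dots> = (\<Sum>v\<in>?A. \<rho>)" by simp
  also have "\<dots> \<le> (\<Sum>v\<in>?A. ppr c G l v w)"
  proof (rule sum_mono)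
    fix v assume "v \<in> ?A"
    then show "\<rho> \<le> ppr c G l v w" using reserve_le_ppr[of w l v] by simp
  qed
  also have "\<dots> \<le> (\<Sum>v\<in>V. ppr c G l v w)" by (rule sum_mono2) (auto simp: ppr_nonneg)
  finally show ?thesis using r_max_pos by (simp add: field_simps)
qed

text \<open>Finiteness is part of the claim because the cardinality of an infinite set is 0, which
  would make the size bound empty.\<close>

lemma index_tuples_bound:
  assumes H: "H \<subseteq> V"
  shows "finite (index_tuples c G H \<epsilon>)"
    and "real (card (index_tuples c G H \<epsilon>)) \<le> (\<Sum>w\<in>H. real (num_nodes G) * rpr w) / \<rho>"
proof -
  have finH: "finite H" using H finite_V by (rule finite_subset)
  \<comment> \<open>From level \<open>L\<close> on all lists are empty, since reserves are at most
    \<open>sqrt c ^ l\<close>.\<close>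
  obtain L where L: "sqrt c ^ L < \<rho>"
    using real_arch_pow_inv[OF r_max_pos sqrt_c(2)] by blast
  have l: "l < L" if "w \<in> H" "(v, x) \<in> index_list c G \<epsilon> w l" for w l v x
  proof (rule ccontr)
    assume "\<not> l < L"
    then have "sqrt c ^ l \<le> sqrt c ^ L" using sqrt_c by (intro power_decreasing) auto
    moreover have v: "v \<in> V" "\<rho> < reserve c G \<epsilon> w l v" using that by (auto simp: index_list_def)
    moreover have "ppr c G l v w \<le> sqrt c ^ l" using v that H by (intro ppr_le) auto
    ultimately show False using L reserve_le_ppr[of w l v] by linarith
  qed
  let ?T = "\<Union>w\<in>H. \<Union>l<L. (\<lambda>(v, x). (w, l, v, x)) ` index_list c G \<epsilon> w l"
  have sub: "index_tuples c G H \<epsilon> \<subseteq> ?T" using l by (fastforce simp: index_tuples_def)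
  have finT: "finite ?T" using finH by auto
  show fin: "finite (index_tuples c G H \<epsilon>)" using sub finT by (rule finite_subset)
  have "card (index_tuples c G H \<epsilon>) \<le> card ?T" using finT sub by (rule card_mono)
  also have "\<dots> \<le> (\<Sum>w\<in>H. card (\<Union>l<L. (\<lambda>(v, x). (w, l, v, x)) ` index_list c G \<epsilon> w l))"
    using finH by (rule card_UN_le)
  also have "\<dots> \<le> (\<Sum>w\<in>H. \<Sum>l<L. card ((\<lambda>(v, x). (w, l, v, x)) ` index_list c G \<epsilon> w l))"
    by (intro sum_mono card_UN_le) auto
  also have "\<dots> \<le> (\<Sum>w\<in>H. \<Sum>l<L. card (index_list c G \<epsilon> w l))"
    by (intro sum_mono card_image_le) auto
  finally have "real (card (index_tuples c G H \<epsilon>)) \<le> (\<Sum>w\<in>H. \<Sum>l<L. real (card (index_list c G \<epsilon> w l)))"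
    by (simp flip: of_nat_sum)
  also have "\<dots> \<le> (\<Sum>w\<in>H. \<Sum>l<L. (\<Sum>v\<in>V. ppr c G l v w) / \<rho>)"
    by (intro sum_mono card_index_list)
  also have "\<dots> = (\<Sum>w\<in>H. (\<Sum>l<L. \<Sum>v\<in>V. ppr c G l v w) / \<rho>)" by (simp add: sum_divide_distrib)
  also have "\<dots> \<le> (\<Sum>w\<in>H. (real (num_nodes G) * rpr w) / \<rho>)"
    using r_max_pos H by (intro sum_mono divide_right_mono sum_ppr_le) auto
  finally show "real (card (index_tuples c G H \<epsilon>)) \<le> (\<Sum>w\<in>H. real (num_nodes G) * rpr w) / \<rho>"
    by (simp add: sum_divide_distrib)
qed

section \<open>Total work of the backward searches\<close>

definition push_cost :: "'a \<Rightarrow> nat \<Rightarrow> nat" where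
  "push_cost w l = (\<Sum>v\<in>V. if residue c G \<epsilon> w l v > \<rho> then 1 + d_out G v else 0)"

text \<open>A nonzero residue at level \<open>l + 1\<close> belongs to an out-neighbour of a node
  pushed at level \<open>l\<close>, so inspections are charged to the pushes one level earlier; this
  doubles the push cost. Level 0 has one nonzero residue at most.\<close>

lemma backward_search_cost_le:
  "backward_search_cost c G \<epsilon> w \<le> 2 + 2 * (\<Sum>l. of_nat (push_cost w l))"
proof -
  let ?N = "\<lambda>l. {v \<in> V. residue c G \<epsilon> w l v \<noteq> 0}"
  have N0: "card (?N 0) \<le> 1"
  proof -
    have "card (?N 0) \<le> card {w}" by (rule card_mono) auto
    then show ?thesis by simp
  qed
  have NSuc: "card (?N (Suc l)) \<le> push_cost w l" for l
  proof -
    let ?P = "{v \<in> V. residue c G \<epsilon> w l v > \<rho>}"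
    have "?N (Suc l) \<subseteq> (\<Union>v\<in>?P. out_nbrs G v)"
    proof
      fix z assume "z \<in> ?N (Suc l)"
      then obtain v where "v \<in> in_nbrs G z" "residue c G \<epsilon> w l v > \<rho>"
        by (auto elim: sum.not_neutral_contains_not_neutral)
      then have "v \<in> ?P" "z \<in> out_nbrs G v"
        using nbrs_subset(1)[of z] by (simp_all add: subset_eq in_nbrs_iff_out_nbrs[symmetric])
      then show "z \<in> (\<Union>v\<in>?P. out_nbrs G v)" by (rule UN_I)
    qed
    then have "card (?N (Suc l)) \<le> card (\<Union>v\<in>?P. out_nbrs G v)" by (intro card_mono) auto
    also have "\<dots> \<le> (\<Sum>v\<in>?P. d_out G v)" unfolding d_out_def by (intro card_UN_le) auto
    also have "\<dots> \<le> (\<Sum>v\<in>?P. if residue c G \<epsilon> w l v > \<rho> then 1 + d_out G v else 0)"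
      by (rule sum_mono) simp
    also have "\<dots> \<le> push_cost w l" unfolding push_cost_def by (rule sum_mono2) auto
    finally show ?thesis .
  qed
  define N where "N l = card (?N l)" for l
  have level: "(\<Sum>v\<in>?N l. 1 + (if residue c G \<epsilon> w l v > \<rho> then 1 + d_out G v else 0)) \<le> N l + push_cost w l" for l
  proof -
    have "(\<Sum>v\<in>?N l. if residue c G \<epsilon> w l v > \<rho> then 1 + d_out G v else 0) \<le> push_cost w l"
      unfolding push_cost_def by (rule sum_mono2) auto
    then show ?thesis by (simp only: sum.distrib N_def card_eq_sum add_left_mono)
  qed
  have "backward_search_cost c G \<epsilon> w \<le> 1 + (\<Sum>l. of_nat (N l) + of_nat (push_cost w l))"
    unfolding backward_search_cost_def
    by (intro add_left_mono suminf_le summableI, subst of_nat_add[symmetric], rule of_nat_mono, rule level)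
  also have "\<dots> = 1 + ((\<Sum>l. of_nat (N l)) + (\<Sum>l. of_nat (push_cost w l)))"
    by (simp only: suminf_add[OF summableI summableI])
  also have "(\<Sum>l. of_nat (N l) :: ennreal) = (\<Sum>l. of_nat (N (Suc l))) + of_nat (N 0)"
    by (subst suminf_offset[where i = 1]) (auto intro: summableI)
  also have "\<dots> \<le> (\<Sum>l. of_nat (push_cost w l)) + 1"
    using NSuc of_nat_mono[OF N0] unfolding N_def[symmetric]
    by (intro add_mono suminf_le summableI of_nat_mono) simp_all
  also have "1 + ((\<Sum>l. of_nat (push_cost w l)) + 1 + (\<Sum>l. of_nat (push_cost w l)))
      = 2 + 2 * (\<Sum>l. of_nat (push_cost w l) :: ennreal)"
    unfolding mult_2 by (simp only: one_add_one[symmetric] ac_simps)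
  finally show ?thesis by simp
qed

text \<open>A push at \<open>v\<close> requires \<open>hit w l v / \<rho> \<ge> 1\<close>, which
  pays for its \<open>1 + d_out G v\<close> units. The order of summation matters: for fixed
  \<open>v\<close>, the sum of \<open>hit w l v\<close> over targets and levels is at most
  \<open>1 / \<beta>\<close>, a bound free of the set of hubs.\<close>

lemma sum_push_cost:
  assumes H: "H \<subseteq> V"
  shows "(\<Sum>w\<in>H. \<Sum>l. of_nat (push_cost w l)) \<le> ennreal ((real (num_nodes G) + real (num_edges G)) / (\<beta> * \<rho>))"
proof -
  have push: "of_nat (push_cost w l) \<le> (\<Sum>v\<in>V. ennreal (hit w l v) * ennreal (real (1 + d_out G v) / \<rho>))" for w l
  proof -
    have "real (push_cost w l) \<le> (\<Sum>v\<in>V. hit w l v * (real (1 + d_out G v) / \<rho>))"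
      unfolding push_cost_def of_nat_sum
    proof (intro sum_mono)
      fix v
      show "real (if residue c G \<epsilon> w l v > \<rho> then 1 + d_out G v else 0) \<le> hit w l v * (real (1 + d_out G v) / \<rho>)"
      proof (cases "residue c G \<epsilon> w l v > \<rho>")
        case True
        then have "1 \<le> hit w l v / \<rho>" using residue_le_hit[of w l v] r_max_pos by (simp add: field_simps)
        then have "1 * real (1 + d_out G v) \<le> hit w l v / \<rho> * real (1 + d_out G v)"
          by (intro mult_right_mono) auto
        with True show ?thesis by simp
      next
        case False
        have "0 \<le> hit w l v * (real (1 + d_out G v) / \<rho>)"
          using r_max_pos hit_nonneg by (intro mult_nonneg_nonneg divide_nonneg_nonneg) auto
        with False show ?thesis by simp
      qed
    qed
    then have "ennreal (real (push_cost w l)) \<le> ennreal (\<Sum>v\<in>V. hit w l v * (real (1 + d_out G v) / \<rho>))"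
      by (rule ennreal_leI)
    also have "\<dots> = (\<Sum>v\<in>V. ennreal (hit w l v * (real (1 + d_out G v) / \<rho>)))"
      using r_max_pos by (intro sum_ennreal[symmetric] mult_nonneg_nonneg hit_nonneg) simp
    also have "\<dots> = (\<Sum>v\<in>V. ennreal (hit w l v) * ennreal (real (1 + d_out G v) / \<rho>))"
      by (rule sum.cong[OF refl], rule ennreal_mult[OF hit_nonneg]) (use r_max_pos in simp)
    finally show ?thesis by (simp add: ennreal_of_nat_eq_real_of_nat)
  qed
  have "(\<Sum>w\<in>H. \<Sum>l. of_nat (push_cost w l)) \<le> (\<Sum>w\<in>V. \<Sum>l. of_nat (push_cost w l) :: ennreal)"
    using H by (intro sum_mono2) auto
  also have "\<dots> \<le> (\<Sum>w\<in>V. \<Sum>l. \<Sum>v\<in>V. ennreal (hit w l v) * ennreal (real (1 + d_out G v) / \<rho>))"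
    by (intro sum_mono suminf_le summableI push)
  also have "\<dots> = (\<Sum>l. \<Sum>w\<in>V. \<Sum>v\<in>V. ennreal (hit w l v) * ennreal (real (1 + d_out G v) / \<rho>))"
    by (rule suminf_sum[symmetric]) (rule summableI)
  also have "\<dots> = (\<Sum>l. \<Sum>v\<in>V. (\<Sum>w\<in>V. ennreal (hit w l v)) * ennreal (real (1 + d_out G v) / \<rho>))"
    by (subst sum.swap) (simp add: sum_distrib_right)
  also have "\<dots> = (\<Sum>v\<in>V. \<Sum>l. (\<Sum>w\<in>V. ennreal (hit w l v)) * ennreal (real (1 + d_out G v) / \<rho>))"
    by (rule suminf_sum) (rule summableI)
  also have "\<dots> \<le> (\<Sum>v\<in>V. ennreal (1 / \<beta>) * ennreal (real (1 + d_out G v) / \<rho>))"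
    unfolding ennreal_suminf_multc by (intro sum_mono mult_right_mono suminf_sum_hit) auto
  also have "\<dots> = (\<Sum>v\<in>V. ennreal (1 / \<beta> * (real (1 + d_out G v) / \<rho>)))"
    by (rule sum.cong[OF refl], rule ennreal_mult[symmetric]) (use r_max_pos beta in simp_all)
  also have "\<dots> = ennreal (\<Sum>v\<in>V. 1 / \<beta> * (real (1 + d_out G v) / \<rho>))"
    using r_max_pos beta by (intro sum_ennreal mult_nonneg_nonneg) simp_all
  also have "(\<Sum>v\<in>V. 1 / \<beta> * (real (1 + d_out G v) / \<rho>)) = (real (num_nodes G) + real (num_edges G)) / (\<beta> * \<rho>)"
    unfolding sum_d_out[symmetric] num_nodes_def by (simp add: sum.distrib sum_divide_distrib[symmetric] flip: of_nat_sum)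
  finally show ?thesis .
qed

section \<open>Convergence of the power iteration\<close>

lemma alive_mass_nonneg: "0 \<le> alive_mass c G k v"
  using sqrt_c by (induction k arbitrary: v) (auto intro!: sum_nonneg divide_nonneg_nonneg mult_nonneg_nonneg)

lemma sum_alive_mass: "(\<Sum>v\<in>V. alive_mass c G k v) \<le> sqrt c ^ k"
proof (induction k)
  case 0
  then show ?case by (simp add: num_nodes_def)
next
  case (Suc k)
  have "(\<Sum>v\<in>V. alive_mass c G (Suc k) v) = (\<Sum>y\<in>V. \<Sum>x\<in>in_nbrs G y. sqrt c * alive_mass c G k y / real (d_in G y))"
    unfolding alive_mass.simps by (rule sum_nbrs_swap)
  also have "\<dots> \<le> (\<Sum>y\<in>V. sqrt c * alive_mass c G k y)"
  proof (rule sum_mono)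
    fix y
    show "(\<Sum>x\<in>in_nbrs G y. sqrt c * alive_mass c G k y / real (d_in G y)) \<le> sqrt c * alive_mass c G k y"
      using sqrt_c alive_mass_nonneg[of k y] by (cases "d_in G y = 0") (auto simp: d_in_def)
  qed
  also have "\<dots> \<le> sqrt c ^ Suc k"
    using Suc sqrt_c by (simp add: sum_distrib_left[symmetric] mult_left_mono)
  finally show ?case .
qed

text \<open>A bound linear in \<open>1 / \<epsilon>\<close> suffices for the target
  \<open>O(m / \<epsilon>)\<close>. It follows from Bernoulli's inequality for
  \<open>(1 + \<beta>) ^ k\<close>, as
  \<open>sqrt c * (1 + \<beta>) = 1 - \<beta>\<^sup>2 \<le> 1\<close>.\<close>

lemma pagerank_rounds_le: "real (pagerank_rounds c G \<epsilon>) \<le> 1 / (\<beta> * \<epsilon>) + 1"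
proof -
  define k where "k = nat \<lceil>1 / (\<beta> * \<epsilon>)\<rceil>"
  have k: "1 / (\<beta> * \<epsilon>) \<le> real k" "real k \<le> 1 / (\<beta> * \<epsilon>) + 1"
    using beta eps_pos by (auto simp: k_def of_nat_nat)
  have "1 \<le> \<epsilon> * (real k * \<beta>)" using k(1) beta eps_pos by (simp add: field_simps)
  also have "\<dots> \<le> \<epsilon> * (1 + real k * \<beta>)" using eps_pos by simp
  also have "\<dots> \<le> \<epsilon> * (1 + \<beta>) ^ k"
    using eps_pos beta by (intro mult_left_mono Bernoulli_inequality) linarith+
  finally have 1: "1 \<le> \<epsilon> * (1 + \<beta>) ^ k" .
  have "sqrt c * (1 + \<beta>) = 1 - \<beta>\<^sup>2" by (simp add: power2_eq_square algebra_simps)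
  then have "sqrt c * (1 + \<beta>) \<le> 1" by simp
  then have "(sqrt c * (1 + \<beta>)) ^ k \<le> 1" using sqrt_c by (intro power_le_one mult_nonneg_nonneg) linarith+
  then have "sqrt c ^ k * (1 + \<beta>) ^ k \<le> \<epsilon> * (1 + \<beta>) ^ k" using 1 by (simp add: power_mult_distrib)
  then have "sqrt c ^ k \<le> \<epsilon>" using beta by (simp add: mult_le_cancel_right_pos)
  then have "(\<Sum>v\<in>V. alive_mass c G k v) \<le> \<epsilon>" using sum_alive_mass order_trans by blast
  then have "pagerank_rounds c G \<epsilon> \<le> k" unfolding pagerank_rounds_def by (rule Least_le)
  with k show ?thesis by linarith
qed

lemma preprocessing_cost_le:
  assumes H: "H \<subseteq> V"
  shows "preprocessing_cost c G H \<epsilon> \<le> ennreal (32 / \<beta>^3 * ((real (num_nodes G) + real (num_edges G)) / \<epsilon>))"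
proof -
  define S where "S = real (num_nodes G) + real (num_edges G)"
  have S: "0 \<le> S" "real (num_nodes G) \<le> S" by (auto simp: S_def)
  have "(\<Sum>w\<in>H. backward_search_cost c G \<epsilon> w) \<le> (\<Sum>w\<in>H. 2 + 2 * (\<Sum>l. of_nat (push_cost w l)))"
    by (intro sum_mono backward_search_cost_le)
  also have "\<dots> = 2 * of_nat (card H) + 2 * (\<Sum>w\<in>H. \<Sum>l. of_nat (push_cost w l))"
    by (simp add: sum.distrib sum_distrib_left mult.commute)
  also have "\<dots> \<le> 2 * of_nat (num_nodes G) + 2 * ennreal (S / (\<beta> * \<rho>))"
    unfolding num_nodes_def S_def using H sum_push_cost[OF H]
    by (intro add_mono mult_left_mono of_nat_mono card_mono) (auto simp: num_nodes_def)
  also have "\<dots> = ennreal (2 * real (num_nodes G) + 2 * (S / (\<beta> * \<rho>)))"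
  proof -
    have "0 \<le> S / (\<beta> * \<rho>)" using S beta r_max_pos by simp
    then show ?thesis
      by (simp only: ennreal_of_nat_eq_real_of_nat ennreal_plus ennreal_mult of_nat_0_le_iff ennreal_numeral zero_le_numeral mult_nonneg_nonneg)
  qed
  finally have B: "(\<Sum>w\<in>H. backward_search_cost c G \<epsilon> w) \<le> \<dots>" .
  let ?A = "(num_nodes G + num_edges G) + (1 + pagerank_rounds c G \<epsilon>) * (num_nodes G + num_edges G) + num_nodes G"
  have "real ?A = S + (1 + real (pagerank_rounds c G \<epsilon>)) * S + real (num_nodes G)"
    by (simp add: S_def algebra_simps)
  also have "\<dots> \<le> S + (1 + (1 / (\<beta> * \<epsilon>) + 1)) * S + S"
    using S pagerank_rounds_le by (intro add_mono mult_right_mono) auto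
  finally have A: "real ?A \<le> S + (1 + (1 / (\<beta> * \<epsilon>) + 1)) * S + S" .
  have "preprocessing_cost c G H \<epsilon> \<le> ennreal (real ?A) + ennreal (2 * real (num_nodes G) + 2 * (S / (\<beta> * \<rho>)))"
    unfolding preprocessing_cost_def ennreal_of_nat_eq_real_of_nat using B by (rule add_left_mono)
  also have "\<dots> = ennreal (real ?A + (2 * real (num_nodes G) + 2 * (S / (\<beta> * \<rho>))))"
    using S beta r_max_pos by (subst ennreal_plus[symmetric]) (auto simp del: of_nat_add)
  also have "\<dots> \<le> ennreal (32 / \<beta>^3 * (S / \<epsilon>))"
  proof (rule ennreal_leI)
    have e: "1 \<le> 1 / \<epsilon>" using eps_pos eps_less_1 by simp
    have b: "1 \<le> 1 / \<beta>" using beta by simp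
    have b3: "1 / \<beta> \<le> 1 / \<beta>^3" using beta power_decreasing[of 1 3 \<beta>] by (intro divide_left_mono) simp_all
    have s1: "S \<le> 1 / \<beta>^3 * (S / \<epsilon>)"
    proof -
      have "1 \<le> 1 / \<beta>^3 * (1 / \<epsilon>)" using mult_mono[of 1 "1/\<beta>^3" 1 "1 / \<epsilon>"] e b b3 by linarith
      from mult_right_mono[OF this S(1)] show ?thesis by simp
    qed
    have s2: "1 / (\<beta> * \<epsilon>) * S \<le> 1 / \<beta>^3 * (S / \<epsilon>)"
      using mult_right_mono[OF b3, of "S / \<epsilon>"] S eps_pos by simp
    have s3: "S / (\<beta> * \<rho>) = 12 * (1 / \<beta>^3 * (S / \<epsilon>))"
      using beta eps_pos by (simp add: r_max_def field_simps power2_eq_square power3_eq_cube)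
    have "real ?A + (2 * real (num_nodes G) + 2 * (S / (\<beta> * \<rho>)))
      \<le> S + (1 + (1 / (\<beta> * \<epsilon>) + 1)) * S + S + (2 * S + 2 * (S / (\<beta> * \<rho>)))"
      using A S by linarith
    also have "\<dots> = 6 * S + 1 / (\<beta> * \<epsilon>) * S + 2 * (S / (\<beta> * \<rho>))" by (simp add: algebra_simps)
    also have "\<dots> \<le> 32 / \<beta>^3 * (S / \<epsilon>)"
    proof -
      \<comment> \<open>In units of \<open>X\<close> the three terms are at most 6, 1 and 2 * 12,
        the 12 coming from \<open>r_max\<close>; 32 rounds up their sum 31.\<close>
      define X where "X = 1 / \<beta>^3 * (S / \<epsilon>)"
      have "32 / \<beta>^3 * (S / \<epsilon>) = 32 * X" by (simp add: X_def)
      moreover have "0 \<le> X" using s1 S unfolding X_def by linarith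
      moreover have "6 * S + A + 2 * B \<le> 32 * X" if "S \<le> X" "A \<le> X" "B = 12 * X" "0 \<le> X" for A B
        using that by linarith
      ultimately show ?thesis using s1 s2 s3 unfolding X_def[symmetric] by metis
    qed
    finally show "real ?A + (2 * real (num_nodes G) + 2 * (S / (\<beta> * \<rho>))) \<le> 32 / \<beta>^3 * (S / \<epsilon>)" .
  qed
  finally show ?thesis by (simp add: S_def)
qed

end


section \<open>Variance bounded backward walk\<close>

text \<open>There are finitely many subsets of \<open>S\<close>, so a preimage is a finite union
  over membership patterns, each a finite conjunction of measurable conditions.\<close>

lemma measurable_finite_Collect:
  assumes fin: "finite S" and P: "\<And>y. y \<in> S \<Longrightarrow> {r \<in> space M. P y r} \<in> sets M"
  shows "(\<lambda>r. {y \<in> S. P y r}) \<in> M \<rightarrow>\<^sub>M count_space UNIV"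
proof (rule measurableI)
  fix B
  have "(\<lambda>r. {y \<in> S. P y r}) -` B \<inter> space M
      = (\<Union>A\<in>B \<inter> Pow S. {r \<in> space M. \<forall>y\<in>S. P y r \<longleftrightarrow> y \<in> A})"
  proof (rule set_eqI, rule iffI)
    fix r assume "r \<in> (\<lambda>r. {y \<in> S. P y r}) -` B \<inter> space M"
    then show "r \<in> (\<Union>A\<in>B \<inter> Pow S. {r \<in> space M. \<forall>y\<in>S. P y r \<longleftrightarrow> y \<in> A})"
      by (intro UN_I[of "{y \<in> S. P y r}"]) auto
  next
    fix r assume "r \<in> (\<Union>A\<in>B \<inter> Pow S. {r \<in> space M. \<forall>y\<in>S. P y r \<longleftrightarrow> y \<in> A})"
    then obtain A where A: "A \<in> B" "A \<subseteq> S" "r \<in> space M" "\<forall>y\<in>S. P y r \<longleftrightarrow> y \<in> A" by blast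
    then have "{y \<in> S. P y r} = A" by blast
    with A show "r \<in> (\<lambda>r. {y \<in> S. P y r}) -` B \<inter> space M" by simp
  qed
  also have "\<dots> \<in> sets M"
  proof (rule sets.finite_UN)
    show "finite (B \<inter> Pow S)" using fin by simp
    fix A
    have "{r \<in> space M. P y r \<longleftrightarrow> y \<in> A} \<in> sets M" if "y \<in> S" for y
    proof (cases "y \<in> A")
      case True then show ?thesis using P[OF that] by simp
    next
      case False
      then have "{r \<in> space M. P y r \<longleftrightarrow> y \<in> A} = space M - {r \<in> space M. P y r}" by auto
      then show ?thesis using P[OF that] by simp
    qed
    then show "{r \<in> space M. \<forall>y\<in>S. P y r \<longleftrightarrow> y \<in> A} \<in> sets M"
      using fin by (intro sets.sets_Collect_finite_All) auto
  qed
  finally show "(\<lambda>r. {y \<in> S. P y r}) -` B \<inter> space M \<in> sets M" .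
qed simp

section \<open>Law of a single scan\<close>

context walk_graph
begin

definition vbbw_sel :: "('a \<Rightarrow> real) \<Rightarrow> 'a \<Rightarrow> real \<Rightarrow> 'a set" where
  "vbbw_sel q x r = {y \<in> out_nbrs G x. q x / \<beta> < real (d_in G y) \<and> real (d_in G y) \<le> q x / (r * \<beta>)}"

lemma vbbw_node_eq:
  "vbbw_node c G q x = bernoulli_pmf (sqrt c) \<bind>
     (\<lambda>b. if b then map_pmf Some (uniform_draw (vbbw_sel q x)) else return_pmf None)"
  unfolding vbbw_node_def vbbw_sel_def ..

text \<open>\<open>uniform_draw\<close> is built with \<open>Abs_pmf\<close>, so nothing is known
  about it until measurability and a countable range are shown. Both hold because all values are
  subsets of the finite set \<open>out_nbrs G x\<close>.\<close>

lemma measure_pmf_vbbw_sel: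
  "measure_pmf (uniform_draw (vbbw_sel q x)) =
     distr (uniform_measure lborel {0<..<1}) (count_space UNIV) (vbbw_sel q x)"
  and measurable_vbbw_sel: "vbbw_sel q x \<in> borel \<rightarrow>\<^sub>M count_space UNIV"
proof -
  show m: "vbbw_sel q x \<in> borel \<rightarrow>\<^sub>M count_space UNIV"
    unfolding vbbw_sel_def by (rule measurable_finite_Collect) (simp, measurable)
  have "range (vbbw_sel q x) \<subseteq> Pow (out_nbrs G x)" by (auto simp: vbbw_sel_def)
  then have "countable (range (vbbw_sel q x))" by (rule countable_finite[OF finite_subset]) simp
  with m show "measure_pmf (uniform_draw (vbbw_sel q x)) =
     distr (uniform_measure lborel {0<..<1}) (count_space UNIV) (vbbw_sel q x)"
    by (rule measure_pmf_uniform_draw)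
qed

lemma emeasure_vbbw_sel:
  "emeasure (measure_pmf (uniform_draw (vbbw_sel q x))) X = emeasure lborel ({0<..<1} \<inter> vbbw_sel q x -` X)"
proof -
  have s: "vbbw_sel q x -` X \<in> sets borel"
    using measurable_sets[OF measurable_vbbw_sel[of q x], of X] by simp
  have "emeasure (measure_pmf (uniform_draw (vbbw_sel q x))) X
      = emeasure (uniform_measure lborel {0<..<1}) (vbbw_sel q x -` X)"
    unfolding measure_pmf_vbbw_sel using measurable_vbbw_sel[of q x]
    by (subst emeasure_distr) simp_all
  also have "\<dots> = emeasure lborel ({0<..<1} \<inter> vbbw_sel q x -` X)"
    using s by (subst emeasure_uniform_measure) (simp_all add: divide_ennreal_def)
  finally show ?thesis .
qed

lemma set_vbbw_sel: "set_pmf (uniform_draw (vbbw_sel q x)) \<subseteq> range (vbbw_sel q x)"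
proof
  fix A assume A: "A \<in> set_pmf (uniform_draw (vbbw_sel q x))"
  show "A \<in> range (vbbw_sel q x)"
  proof (rule ccontr)
    assume "A \<notin> range (vbbw_sel q x)"
    then have "vbbw_sel q x -` {A} = {}" by auto
    then have "emeasure (measure_pmf (uniform_draw (vbbw_sel q x))) {A} = 0"
      by (simp add: emeasure_vbbw_sel)
    with A show False by (simp add: emeasure_pmf_single set_pmf_iff)
  qed
qed

lemma set_vbbw_node:
  assumes "oc \<in> set_pmf (vbbw_node c G q x)"
  shows "oc = None \<or> (\<exists>r. oc = Some (vbbw_sel q x r))"
  using assms set_vbbw_sel[of q x] unfolding vbbw_node_eq by (auto split: if_splits)

text \<open>
  Every nonzero estimate of the backward walk is at least \<open>1 - \<surd>c\<close>; this is what turns expected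
  values of estimates into bounds on the number of nodes and edges visited.
\<close>

definition vbbw_ok :: "('a \<Rightarrow> real) \<Rightarrow> bool" where
  "vbbw_ok q \<longleftrightarrow> (\<forall>x. q x = 0 \<or> \<beta> \<le> q x)"

lemma vbbw_ok_nonneg: "vbbw_ok q \<Longrightarrow> 0 \<le> q x"
  using beta unfolding vbbw_ok_def by (metis order_refl order_trans)

text \<open>The threshold of the deterministic scan is exactly what keeps the added value
  \<open>q x / d_in\<close> from falling below \<beta>.\<close>

lemma vbbw_small_contrib:
  assumes "y \<in> vbbw_small c G q x"
  shows "\<beta> \<le> q x / real (d_in G y)"
proof -
  have "y \<in> out_nbrs G x" "real (d_in G y) \<le> q x / \<beta>" using assms by (auto simp: vbbw_small_def)
  with d_in_pos[of y x] beta show ?thesis by (simp add: field_simps)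
qed

lemma vbbw_contrib_cases: "vbbw_contrib c G q x oc y = 0 \<or> \<beta> \<le> vbbw_contrib c G q x oc y"
proof (cases oc)
  case (Some A)
  show ?thesis
  proof (cases "y \<in> vbbw_small c G q x")
    case True
    moreover have "0 \<le> q x / real (d_in G y)" using vbbw_small_contrib[OF True] beta by linarith
    ultimately show ?thesis using vbbw_small_contrib[OF True] Some by (auto simp: vbbw_contrib_def)
  qed (use Some beta in \<open>auto simp: vbbw_contrib_def\<close>)
qed (simp add: vbbw_contrib_def)

lemma vbbw_contrib_nonneg: "0 \<le> vbbw_contrib c G q x oc y"
  using vbbw_contrib_cases[of q x oc y] beta by linarith

text \<open>The upper half of unbiasedness. The two scans are disjoint, separated by the comparison
  of \<open>d_in G y\<close> with \<open>q x / \<beta>\<close>, so each neighbour receives either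
  the exact value or a random one.\<close>

lemma nn_integral_vbbw_contrib:
  assumes ok: "vbbw_ok q"
  shows "(\<integral>\<^sup>+ oc. ennreal (vbbw_contrib c G q x oc y) \<partial>vbbw_node c G q x)
      \<le> (if y \<in> out_nbrs G x then ennreal (sqrt c / real (d_in G y)) * ennreal (q x) else 0)"
proof -
  let ?U = "measure_pmf (uniform_draw (vbbw_sel q x))"
  let ?d = "real (d_in G y)"
  have q: "0 \<le> q x" by (rule vbbw_ok_nonneg[OF ok])
  have eq: "(\<integral>\<^sup>+ oc. ennreal (vbbw_contrib c G q x oc y) \<partial>vbbw_node c G q x)
      = (\<integral>\<^sup>+ A. ennreal (vbbw_contrib c G q x (Some A) y) \<partial>?U) * ennreal (sqrt c)"
    unfolding vbbw_node_eq using sqrt_c by (simp add: vbbw_contrib_def)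
  show ?thesis
  proof (cases "y \<in> out_nbrs G x")
    case False
    have "(\<integral>\<^sup>+ A. ennreal (vbbw_contrib c G q x (Some A) y) \<partial>?U) = (\<integral>\<^sup>+ A. 0 \<partial>?U)"
    proof (rule nn_integral_cong_AE, rule AE_pmfI)
      fix A assume "A \<in> set_pmf (uniform_draw (vbbw_sel q x))"
      then have "y \<notin> A" using set_vbbw_sel[of q x] False by (auto simp: vbbw_sel_def)
      then show "ennreal (vbbw_contrib c G q x (Some A) y) = 0"
        using False by (simp add: vbbw_contrib_def vbbw_small_def)
    qed
    then show ?thesis using False eq by simp
  next
    case True
    have d: "?d > 0" using d_in_pos[OF True] by simp
    have "(\<integral>\<^sup>+ A. ennreal (vbbw_contrib c G q x (Some A) y) \<partial>?U) \<le> ennreal (q x / ?d)"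
    proof (cases "y \<in> vbbw_small c G q x")
      case small: True
      have "(\<integral>\<^sup>+ A. ennreal (vbbw_contrib c G q x (Some A) y) \<partial>?U) = (\<integral>\<^sup>+ A. ennreal (q x / ?d) \<partial>?U)"
      proof (rule nn_integral_cong_AE, rule AE_pmfI)
        fix A assume "A \<in> set_pmf (uniform_draw (vbbw_sel q x))"
        then have "y \<notin> A" using set_vbbw_sel[of q x] small by (auto simp: vbbw_sel_def vbbw_small_def)
        then show "ennreal (vbbw_contrib c G q x (Some A) y) = ennreal (q x / ?d)"
          using small by (simp add: vbbw_contrib_def)
      qed
      then show ?thesis by (simp add: measure_pmf.emeasure_space_1)
    next
      case large: False
      have "(\<integral>\<^sup>+ A. ennreal (vbbw_contrib c G q x (Some A) y) \<partial>?U)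
          = (\<integral>\<^sup>+ A. ennreal \<beta> * indicator {A. y \<in> A} A \<partial>?U)"
        using large by (intro nn_integral_cong) (simp add: vbbw_contrib_def indicator_def)
      also have "\<dots> = ennreal \<beta> * emeasure ?U {A. y \<in> A}"
        by (subst nn_integral_cmult_indicator) simp_all
      \<comment> \<open>\<open>y\<close> is selected only if \<open>r\<close> lies below
        \<open>q x / (\<beta> * d_in)\<close>; this probability times the added value \<beta> is
        \<open>q x / d_in\<close>.\<close>
      also have "emeasure ?U {A. y \<in> A} \<le> emeasure lborel {0..q x / (\<beta> * ?d)}"
        unfolding emeasure_vbbw_sel
      proof (rule emeasure_mono)
        show "{0<..<1} \<inter> vbbw_sel q x -` {A. y \<in> A} \<subseteq> {0..q x / (\<beta> * ?d)}"
        proof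
          fix r :: real assume "r \<in> {0<..<1} \<inter> vbbw_sel q x -` {A. y \<in> A}"
          then have r: "0 < r" "?d \<le> q x / (r * \<beta>)" by (auto simp: vbbw_sel_def)
          then show "r \<in> {0..q x / (\<beta> * ?d)}" using d beta by (simp add: field_simps)
        qed
      qed simp
      also have "\<dots> = ennreal (q x / (\<beta> * ?d))" using q d beta by simp
      also have "ennreal \<beta> * ennreal (q x / (\<beta> * ?d)) = ennreal (q x / ?d)"
      proof -
        have "\<beta> * (q x / (\<beta> * ?d)) = q x / ?d" using beta by simp
        then show ?thesis using beta q d by (subst ennreal_mult[symmetric]) simp_all
      qed
      finally show ?thesis by (simp add: mult_left_mono)
    qed
    then have "(\<integral>\<^sup>+ A. ennreal (vbbw_contrib c G q x (Some A) y) \<partial>?U) * ennreal (sqrt c)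
        \<le> ennreal (q x / ?d) * ennreal (sqrt c)"
      by (rule mult_right_mono) simp
    also have "\<dots> = ennreal (sqrt c / ?d) * ennreal (q x)"
      using q d sqrt_c by (simp add: ennreal_mult[symmetric] mult.commute)
    finally show ?thesis using True eq by simp
  qed
qed

lemma nn_integral_Pi_pmf_component:
  assumes "finite S" "x \<in> S"
  shows "(\<integral>\<^sup>+ oc. f (oc x) \<partial>Pi_pmf S d p) = (\<integral>\<^sup>+ o'. f o' \<partial>p x)"
proof -
  have "(\<integral>\<^sup>+ oc. f (oc x) \<partial>Pi_pmf S d p) = (\<integral>\<^sup>+ o'. f o' \<partial>map_pmf (\<lambda>g. g x) (Pi_pmf S d p))"
    by simp
  then show ?thesis using assms by (simp add: Pi_pmf_component)
qed

section \<open>Estimates and running time accumulated over the levels\<close>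

definition mass :: "('a \<Rightarrow> real) \<Rightarrow> real" where "mass q = (\<Sum>x\<in>V. q x)"

text \<open>Conditioned on the current level, the expected next estimate obeys the one-step
  recursion of \<open>hit\<close>, as an upper bound.\<close>

lemma nn_integral_vbbw_level:
  assumes ok: "vbbw_ok q"
  shows "(\<integral>\<^sup>+ r. ennreal (fst r y) \<partial>vbbw_level c G q)
      \<le> ennreal (sqrt c / real (d_in G y)) * (\<Sum>x\<in>in_nbrs G y. ennreal (q x))"
proof -
  let ?S = "{x \<in> V. q x \<noteq> 0}"
  have "(\<integral>\<^sup>+ r. ennreal (fst r y) \<partial>vbbw_level c G q)
      = (\<integral>\<^sup>+ oc. (\<Sum>x\<in>?S. ennreal (vbbw_contrib c G q x (oc x) y)) \<partial>Pi_pmf ?S None (vbbw_node c G q))"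
    unfolding vbbw_level_def Let_def by (simp add: vbbw_contrib_nonneg)
  also have "\<dots> = (\<Sum>x\<in>?S. \<integral>\<^sup>+ oc. ennreal (vbbw_contrib c G q x (oc x) y) \<partial>Pi_pmf ?S None (vbbw_node c G q))"
    by (rule nn_integral_sum) simp
  also have "\<dots> = (\<Sum>x\<in>?S. \<integral>\<^sup>+ oc. ennreal (vbbw_contrib c G q x oc y) \<partial>vbbw_node c G q x)"
    by (intro sum.cong refl nn_integral_Pi_pmf_component) simp_all
  also have "\<dots> \<le> (\<Sum>x\<in>?S. if y \<in> out_nbrs G x then ennreal (sqrt c / real (d_in G y)) * ennreal (q x) else 0)"
    by (intro sum_mono nn_integral_vbbw_contrib ok)
  also have "\<dots> = (\<Sum>x\<in>?S \<inter> in_nbrs G y. ennreal (sqrt c / real (d_in G y)) * ennreal (q x))"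
    by (subst sum.inter_restrict) (auto simp: in_nbrs_iff_out_nbrs)
  also have "\<dots> \<le> (\<Sum>x\<in>in_nbrs G y. ennreal (sqrt c / real (d_in G y)) * ennreal (q x))"
    by (rule sum_mono2) simp_all
  finally show ?thesis by (simp add: sum_distrib_left)
qed

lemma card_support_le_mass:
  assumes ok: "vbbw_ok q"
  shows "\<beta> * real (card {x \<in> V. q x \<noteq> 0}) \<le> mass q"
proof -
  have "\<beta> * real (card {x \<in> V. q x \<noteq> 0}) = (\<Sum>x\<in>{x \<in> V. q x \<noteq> 0}. \<beta>)" by simp
  also have "\<dots> \<le> (\<Sum>x\<in>{x \<in> V. q x \<noteq> 0}. q x)" using ok by (intro sum_mono) (auto simp: vbbw_ok_def)
  also have "\<dots> \<le> mass q" unfolding mass_def by (rule sum_mono2) (auto simp: vbbw_ok_nonneg[OF ok])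
  finally show ?thesis .
qed

text \<open>The cost bound holds for every outcome. Each active node causes 3 units (the visit and
  the overrun of each scan), charged to its own estimate; every selected neighbour receives at least
  \<beta> at the next level and pays for itself.\<close>

lemma set_vbbw_level:
  assumes ok: "vbbw_ok q" and r: "(q', k') \<in> set_pmf (vbbw_level c G q)"
  shows "vbbw_ok q'" and "\<beta> * real k' \<le> 3 * mass q + mass q'"
proof -
  let ?S = "{x \<in> V. q x \<noteq> 0}"
  from r obtain oc where oc: "oc \<in> set_pmf (Pi_pmf ?S None (vbbw_node c G q))"
    and q': "q' = (\<lambda>y. \<Sum>x\<in>?S. vbbw_contrib c G q x (oc x) y)"
    and k': "k' = (\<Sum>x\<in>?S. vbbw_node_cost c G q x (oc x))"
    unfolding vbbw_level_def Let_def by auto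
  have node: "oc x \<in> set_pmf (vbbw_node c G q x)" if "x \<in> ?S" for x
    using oc that by (auto simp: set_Pi_pmf PiE_dflt_def)
  show "vbbw_ok q'"
    unfolding vbbw_ok_def q'
  proof (intro allI)
    fix y
    show "(\<Sum>x\<in>?S. vbbw_contrib c G q x (oc x) y) = 0 \<or> \<beta> \<le> (\<Sum>x\<in>?S. vbbw_contrib c G q x (oc x) y)"
    proof (cases "\<exists>x\<in>?S. vbbw_contrib c G q x (oc x) y \<noteq> 0")
      case True
      then obtain x where x: "x \<in> ?S" "\<beta> \<le> vbbw_contrib c G q x (oc x) y"
        using vbbw_contrib_cases by blast
      have "vbbw_contrib c G q x (oc x) y \<le> (\<Sum>x\<in>?S. vbbw_contrib c G q x (oc x) y)"
        using x by (intro member_le_sum) (auto simp: vbbw_contrib_nonneg)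
      with x show ?thesis by linarith
    next
      case False
      then have "(\<Sum>x\<in>?S. vbbw_contrib c G q x (oc x) y) = 0" by (intro sum.neutral) blast
      then show ?thesis ..
    qed
  qed
  have cost: "\<beta> * real (vbbw_node_cost c G q x (oc x)) \<le> 3 * \<beta> + (\<Sum>y\<in>V. vbbw_contrib c G q x (oc x) y)"
    if x: "x \<in> ?S" for x
  proof -
    consider "oc x = None" | A where "oc x = Some A" "A \<subseteq> V"
      using set_vbbw_node[OF node[OF x]] nbrs_subset(2)[of x] by (auto simp: vbbw_sel_def)
    then show ?thesis
    proof cases
      case 1
      then show ?thesis using beta by (simp add: vbbw_node_cost_def vbbw_contrib_def)
    next
      case 2
      have small: "vbbw_small c G q x \<subseteq> V" using nbrs_subset(2)[of x] by (auto simp: vbbw_small_def)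
      have "\<beta> * real (card (vbbw_small c G q x)) = (\<Sum>y\<in>vbbw_small c G q x. \<beta>)" by simp
      also have "\<dots> \<le> (\<Sum>y\<in>vbbw_small c G q x. q x / real (d_in G y))"
        by (intro sum_mono vbbw_small_contrib)
      also have "\<dots> = (\<Sum>y\<in>V. if y \<in> vbbw_small c G q x then q x / real (d_in G y) else 0)"
        using small by (simp add: sum.inter_restrict[symmetric] Int_absorb1)
      finally have 3: "\<beta> * real (card (vbbw_small c G q x)) \<le> \<dots>" .
      have "\<beta> * real (card A) = (\<Sum>y\<in>V. if y \<in> A then \<beta> else 0)"
        using 2(2) by (simp add: sum.inter_restrict[symmetric] Int_absorb1)
      with 3 show ?thesis
        by (simp add: 2 vbbw_node_cost_def vbbw_contrib_def sum.distrib distrib_left)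
    qed
  qed
  have "\<beta> * real k' = (\<Sum>x\<in>?S. \<beta> * real (vbbw_node_cost c G q x (oc x)))"
    by (simp add: k' sum_distrib_left)
  also have "\<dots> \<le> (\<Sum>x\<in>?S. 3 * \<beta> + (\<Sum>y\<in>V. vbbw_contrib c G q x (oc x) y))"
    by (intro sum_mono cost)
  also have "\<dots> = 3 * (\<beta> * real (card ?S)) + (\<Sum>x\<in>?S. \<Sum>y\<in>V. vbbw_contrib c G q x (oc x) y)"
    by (simp add: sum.distrib)
  also have "(\<Sum>x\<in>?S. \<Sum>y\<in>V. vbbw_contrib c G q x (oc x) y) = mass q'"
    unfolding mass_def q' by (rule sum.swap)
  also have "3 * (\<beta> * real (card ?S)) \<le> 3 * mass q"
    using card_support_le_mass[OF ok] by simp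
  finally show "\<beta> * real k' \<le> 3 * mass q + mass q'" by simp
qed

lemma set_vbbw: "r \<in> set_pmf (vbbw c G w i) \<Longrightarrow> vbbw_ok (fst r)"
proof (induction i arbitrary: r)
  case 0
  then show ?case by (auto simp: vbbw_ok_def)
next
  case (Suc i)
  from Suc.prems obtain q k q' k' where q: "(q, k) \<in> set_pmf (vbbw c G w i)"
    and q': "(q', k') \<in> set_pmf (vbbw_level c G q)" and r: "fst r = q'"
    by (auto split: prod.splits)
  from Suc.IH[OF q] have "vbbw_ok q" by simp
  then show ?case unfolding r using q' by (rule set_vbbw_level)
qed

text \<open>The recursions coincide, and the start value \<open>1 - sqrt c\<close> supplies the
  factor \<beta>.\<close>

lemma nn_integral_vbbw:
  "(\<integral>\<^sup>+ r. ennreal (fst r y) \<partial>vbbw c G w i) \<le> ennreal (\<beta> * hit w i y)"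
proof (induction i arbitrary: y)
  case 0
  then show ?case using beta by simp
next
  case (Suc i)
  have "(\<integral>\<^sup>+ r. ennreal (fst r y) \<partial>vbbw c G w (Suc i))
      = (\<integral>\<^sup>+ r. (\<integral>\<^sup>+ r'. ennreal (fst r' y) \<partial>vbbw_level c G (fst r)) \<partial>vbbw c G w i)"
    by (simp add: case_prod_unfold)
  also have "\<dots> \<le> (\<integral>\<^sup>+ r. ennreal (sqrt c / real (d_in G y)) * (\<Sum>x\<in>in_nbrs G y. ennreal (fst r x)) \<partial>vbbw c G w i)"
    by (rule nn_integral_mono_AE, rule AE_pmfI, rule nn_integral_vbbw_level, rule set_vbbw)
  also have "\<dots> = ennreal (sqrt c / real (d_in G y)) * (\<Sum>x\<in>in_nbrs G y. \<integral>\<^sup>+ r. ennreal (fst r x) \<partial>vbbw c G w i)"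
    by (simp add: nn_integral_cmult nn_integral_sum)
  also have "\<dots> \<le> ennreal (sqrt c / real (d_in G y)) * (\<Sum>x\<in>in_nbrs G y. ennreal (\<beta> * hit w i x))"
    by (intro mult_left_mono sum_mono Suc) simp
  also have "\<dots> = ennreal (sqrt c / real (d_in G y)) * ennreal (\<Sum>x\<in>in_nbrs G y. \<beta> * hit w i x)"
    using beta by (subst sum_ennreal) (simp_all add: hit_nonneg)
  also have "\<dots> = ennreal (sqrt c / real (d_in G y) * (\<Sum>x\<in>in_nbrs G y. \<beta> * hit w i x))"
    using beta sqrt_c by (intro ennreal_mult[symmetric] sum_nonneg mult_nonneg_nonneg hit_nonneg) simp_all
  also have "sqrt c / real (d_in G y) * (\<Sum>x\<in>in_nbrs G y. \<beta> * hit w i x) = \<beta> * hit w (Suc i) y"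
    by (simp add: sum_distrib_left[symmetric])
  finally show ?case .
qed

definition hit_sum :: "'a \<Rightarrow> nat \<Rightarrow> real" where "hit_sum w i = (\<Sum>x\<in>V. hit w i x)"

lemma hit_sum_nonneg: "0 \<le> hit_sum w i"
  unfolding hit_sum_def by (simp add: sum_nonneg hit_nonneg)

lemma nn_integral_mass_vbbw:
  "(\<integral>\<^sup>+ r. ennreal (mass (fst r) / \<beta>) \<partial>vbbw c G w i) \<le> ennreal (hit_sum w i)"
proof -
  have "(\<integral>\<^sup>+ r. ennreal (mass (fst r) / \<beta>) \<partial>vbbw c G w i)
      = (\<integral>\<^sup>+ r. (\<Sum>x\<in>V. ennreal (1 / \<beta>) * ennreal (fst r x)) \<partial>vbbw c G w i)"
  proof (rule nn_integral_cong_AE, rule AE_pmfI)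
    fix r assume "r \<in> set_pmf (vbbw c G w i)"
    then have nn: "0 \<le> fst r x" for x using set_vbbw vbbw_ok_nonneg by blast
    have "ennreal (mass (fst r) / \<beta>) = ennreal (1 / \<beta> * mass (fst r))" by simp
    also have "\<dots> = ennreal (1 / \<beta>) * ennreal (mass (fst r))"
      using beta nn by (intro ennreal_mult) (simp_all add: mass_def sum_nonneg)
    also have "\<dots> = (\<Sum>x\<in>V. ennreal (1 / \<beta>) * ennreal (fst r x))"
      unfolding mass_def sum_distrib_left[symmetric] using nn by (subst sum_ennreal) simp_all
    finally show "ennreal (mass (fst r) / \<beta>) = (\<Sum>x\<in>V. ennreal (1 / \<beta>) * ennreal (fst r x))" .
  qed
  also have "\<dots> = (\<Sum>x\<in>V. ennreal (1 / \<beta>) * (\<integral>\<^sup>+ r. ennreal (fst r x) \<partial>vbbw c G w i))"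
    by (simp add: nn_integral_sum nn_integral_cmult)
  also have "\<dots> \<le> (\<Sum>x\<in>V. ennreal (1 / \<beta>) * ennreal (\<beta> * hit w i x))"
    by (intro sum_mono mult_left_mono nn_integral_vbbw) simp
  also have "\<dots> = (\<Sum>x\<in>V. ennreal (hit w i x))"
    using beta hit_nonneg by (intro sum.cong refl) (subst ennreal_mult[symmetric], simp_all)
  also have "\<dots> = ennreal (hit_sum w i)" unfolding hit_sum_def by (simp add: sum_ennreal hit_nonneg)
  finally show ?thesis .
qed

lemma nn_integral_vbbw_support:
  "(\<integral>\<^sup>+ r. of_nat (card {v \<in> V. fst r v \<noteq> 0}) \<partial>vbbw c G w i) \<le> ennreal (hit_sum w i)"
proof -
  have "(\<integral>\<^sup>+ r. of_nat (card {v \<in> V. fst r v \<noteq> 0}) \<partial>vbbw c G w i)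
      \<le> (\<integral>\<^sup>+ r. ennreal (mass (fst r) / \<beta>) \<partial>vbbw c G w i)"
  proof (rule nn_integral_mono_AE, rule AE_pmfI)
    fix r assume "r \<in> set_pmf (vbbw c G w i)"
    from card_support_le_mass[OF set_vbbw[OF this]]
    show "of_nat (card {v \<in> V. fst r v \<noteq> 0}) \<le> ennreal (mass (fst r) / \<beta>)"
      unfolding ennreal_of_nat_eq_real_of_nat using beta by (intro ennreal_leI) (simp add: field_simps)
  qed
  with nn_integral_mass_vbbw show ?thesis by (rule order_trans[rotated])
qed

text \<open>The induction keeps apart the mass a level starts from, with weight 3, and the mass it
  produces, with weight 1; only afterwards are the two shifted sums merged into the factor
  4.\<close>

lemma nn_integral_vbbw_cost:
  "(\<integral>\<^sup>+ r. of_nat (snd r) \<partial>vbbw c G w i) \<le> ennreal (1 + real i + 4 * (\<Sum>j\<le>i. hit_sum w j))"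
proof -
  have "(\<integral>\<^sup>+ r. of_nat (snd r) \<partial>vbbw c G w i)
      \<le> ennreal (1 + real i + ((\<Sum>j<i. 3 * hit_sum w j) + (\<Sum>j<i. hit_sum w (Suc j))))"
  proof (induction i)
    case 0
    then show ?case by simp
  next
    case (Suc i)
    have "(\<integral>\<^sup>+ r. of_nat (snd r) \<partial>vbbw c G w (Suc i))
        = (\<integral>\<^sup>+ r. (\<integral>\<^sup>+ r'. of_nat (snd r + 1 + snd r') \<partial>vbbw_level c G (fst r)) \<partial>vbbw c G w i)"
      by (simp add: case_prod_unfold)
    also have "\<dots> \<le> (\<integral>\<^sup>+ r. (\<integral>\<^sup>+ r'. of_nat (snd r + 1) + (ennreal (3 * (mass (fst r) / \<beta>)) + ennreal (mass (fst r') / \<beta>)) \<partial>vbbw_level c G (fst r)) \<partial>vbbw c G w i)"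
    proof (rule nn_integral_mono_AE, rule AE_pmfI, rule nn_integral_mono_AE, rule AE_pmfI)
      fix r r' assume r: "r \<in> set_pmf (vbbw c G w i)" and r': "r' \<in> set_pmf (vbbw_level c G (fst r))"
      from r have ok: "vbbw_ok (fst r)" by (rule set_vbbw)
      from r' have r'': "(fst r', snd r') \<in> set_pmf (vbbw_level c G (fst r))" by simp
      note lev = set_vbbw_level[OF ok r'']
      have nn: "0 \<le> mass (fst r)" "0 \<le> mass (fst r')"
        unfolding mass_def using vbbw_ok_nonneg[OF ok] vbbw_ok_nonneg[OF lev(1)] by (simp_all add: sum_nonneg)
      have "real (snd r') \<le> 3 * (mass (fst r) / \<beta>) + mass (fst r') / \<beta>"
      proof -
        have "real (snd r') = \<beta> * real (snd r') / \<beta>" using beta by simp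
        also have "\<dots> \<le> (3 * mass (fst r) + mass (fst r')) / \<beta>"
          using lev(2) beta by (intro divide_right_mono) simp_all
        finally show ?thesis by (simp add: add_divide_distrib)
      qed
      then have "ennreal (real (snd r')) \<le> ennreal (3 * (mass (fst r) / \<beta>) + mass (fst r') / \<beta>)"
        by (rule ennreal_leI)
      also have "\<dots> = ennreal (3 * (mass (fst r) / \<beta>)) + ennreal (mass (fst r') / \<beta>)"
        using nn beta by (intro ennreal_plus) simp_all
      finally have "of_nat (snd r') \<le> ennreal (3 * (mass (fst r) / \<beta>)) + ennreal (mass (fst r') / \<beta>)"
        by (simp only: ennreal_of_nat_eq_real_of_nat)
      then show "of_nat (snd r + 1 + snd r')
          \<le> of_nat (snd r + 1) + (ennreal (3 * (mass (fst r) / \<beta>)) + ennreal (mass (fst r') / \<beta>))"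
        unfolding of_nat_add[of "snd r + 1"] by (rule add_left_mono)
    qed
    also have "\<dots> = (\<integral>\<^sup>+ r. (of_nat (snd r) + 1) + ennreal (3 * (mass (fst r) / \<beta>)) \<partial>vbbw c G w i)
         + (\<integral>\<^sup>+ r'. ennreal (mass (fst r') / \<beta>) \<partial>vbbw c G w (Suc i))"
      by (simp add: nn_integral_add measure_pmf.emeasure_space_1 case_prod_unfold add.assoc add.commute add.left_commute)
    also have "(\<integral>\<^sup>+ r. (of_nat (snd r) + 1) + ennreal (3 * (mass (fst r) / \<beta>)) \<partial>vbbw c G w i)
        = (\<integral>\<^sup>+ r. of_nat (snd r) \<partial>vbbw c G w i) + 1 + 3 * (\<integral>\<^sup>+ r. ennreal (mass (fst r) / \<beta>) \<partial>vbbw c G w i)"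
    proof -
      have "ennreal (3 * (mass (fst r) / \<beta>)) = 3 * ennreal (mass (fst r) / \<beta>)" for r :: "('a \<Rightarrow> real) \<times> nat"
        by (subst ennreal_mult') simp_all
      then show ?thesis
        by (simp only:) (simp add: nn_integral_add measure_pmf.emeasure_space_1 nn_integral_cmult)
    qed
    also have "\<dots> + (\<integral>\<^sup>+ r'. ennreal (mass (fst r') / \<beta>) \<partial>vbbw c G w (Suc i))
        \<le> ennreal (1 + real i + ((\<Sum>j<i. 3 * hit_sum w j) + (\<Sum>j<i. hit_sum w (Suc j)))) + 1 + 3 * ennreal (hit_sum w i)
         + ennreal (hit_sum w (Suc i))"
      by (intro add_mono Suc mult_left_mono nn_integral_mass_vbbw order_refl) simp
    also have "\<dots> = ennreal (1 + real (Suc i) + ((\<Sum>j<Suc i. 3 * hit_sum w j) + (\<Sum>j<Suc i. hit_sum w (Suc j))))"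
    proof -
      let ?X = "(\<Sum>j<i. 3 * hit_sum w j) + (\<Sum>j<i. hit_sum w (Suc j))"
      have X: "0 \<le> ?X" by (intro add_nonneg_nonneg sum_nonneg) (simp_all add: hit_sum_nonneg)
      have "ennreal (1 + real i + ?X) + 1 + 3 * ennreal (hit_sum w i) + ennreal (hit_sum w (Suc i))
         = ennreal (1 + real i + ?X) + ennreal 1 + ennreal (3 * hit_sum w i) + ennreal (hit_sum w (Suc i))"
        by (simp add: ennreal_mult hit_sum_nonneg)
      also have "\<dots> = ennreal (1 + real i + ?X + 1 + 3 * hit_sum w i + hit_sum w (Suc i))"
        using X hit_sum_nonneg[of w i] hit_sum_nonneg[of w "Suc i"]
        by (subst ennreal_plus[symmetric]; simp)+
      also have "1 + real i + ?X + 1 + 3 * hit_sum w i + hit_sum w (Suc i) = 1 + real (Suc i) + ((\<Sum>j<Suc i. 3 * hit_sum w j) + (\<Sum>j<Suc i. hit_sum w (Suc j)))"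
        by simp
      finally show ?thesis .
    qed
    finally show ?case .
  qed
  also have "\<dots> \<le> ennreal (1 + real i + 4 * (\<Sum>j\<le>i. hit_sum w j))"
  proof (rule ennreal_leI)
    have 1: "(\<Sum>j<i. hit_sum w j) \<le> (\<Sum>j\<le>i. hit_sum w j)"
      by (rule sum_mono2) (auto simp: hit_sum_nonneg)
    have "(\<Sum>j<i. hit_sum w (Suc j)) = (\<Sum>j\<in>{1..i}. hit_sum w j)"
      by (rule sum.reindex_bij_witness[of _ "\<lambda>j. j - 1" Suc]) auto
    also have "\<dots> \<le> (\<Sum>j\<le>i. hit_sum w j)"
      by (rule sum_mono2) (auto simp: hit_sum_nonneg)
    finally show "1 + real i + ((\<Sum>j<i. 3 * hit_sum w j) + (\<Sum>j<i. hit_sum w (Suc j))) \<le> 1 + real i + 4 * (\<Sum>j\<le>i. hit_sum w j)"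
      using 1 by (simp add: sum_distrib_left[symmetric])
  qed
  finally show ?thesis .
qed

text \<open>The bound does not grow with the target level, since the masses of all levels together
  are at most \<open>n * rpr w / \<beta>\<close>.\<close>

lemma sum_hit_sum_le:
  assumes "w \<in> V"
  shows "(\<Sum>j\<le>i. hit_sum w j) \<le> real (num_nodes G) * rpr w / \<beta>"
proof -
  have "\<beta> * (\<Sum>j\<le>i. hit_sum w j) = (\<Sum>j\<le>i. \<Sum>u\<in>V. \<beta> * hit w j u)"
    by (simp add: hit_sum_def sum_distrib_left)
  also have "\<dots> \<le> (\<Sum>j\<le>i. \<Sum>u\<in>V. ppr c G j u w)" by (intro sum_mono hit_le_ppr)
  also have "\<dots> \<le> real (num_nodes G) * rpr w"
    using sum_ppr_le[OF assms, of "Suc i"] by (simp add: lessThan_Suc_atMost)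
  finally show ?thesis using beta by (simp add: field_simps)
qed

text \<open>The support of the output is paid for three times in a query: when it is added to the
  estimators, in the medians and in the final output. Hence 7 = 4 + 3.\<close>

lemma nn_integral_vbbw_total:
  assumes w: "w \<in> V"
  shows "(\<integral>\<^sup>+ r. of_nat (snd r + 3 * card {v \<in> V. fst r v \<noteq> 0}) \<partial>vbbw c G w i)
     \<le> ennreal (1 + real i + 7 * (real (num_nodes G) * rpr w / \<beta>))"
proof -
  define X where "X = real (num_nodes G) * rpr w / \<beta>"
  have s: "(\<Sum>j\<le>i. hit_sum w j) \<le> X" unfolding X_def by (rule sum_hit_sum_le[OF w])
  have "hit_sum w i \<le> (\<Sum>j\<le>i. hit_sum w j)" by (rule member_le_sum) (auto simp: hit_sum_nonneg)
  with s have h: "hit_sum w i \<le> X" by linarith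
  have "(\<integral>\<^sup>+ r. of_nat (snd r + 3 * card {v \<in> V. fst r v \<noteq> 0}) \<partial>vbbw c G w i)
     = (\<integral>\<^sup>+ r. of_nat (snd r) \<partial>vbbw c G w i) + 3 * (\<integral>\<^sup>+ r. of_nat (card {v \<in> V. fst r v \<noteq> 0}) \<partial>vbbw c G w i)"
    by (simp add: nn_integral_add nn_integral_cmult)
  also have "\<dots> \<le> ennreal (1 + real i + 4 * (\<Sum>j\<le>i. hit_sum w j)) + 3 * ennreal (hit_sum w i)"
    by (intro add_mono mult_left_mono nn_integral_vbbw_cost nn_integral_vbbw_support) simp
  also have "\<dots> = ennreal (1 + real i + 4 * (\<Sum>j\<le>i. hit_sum w j) + 3 * hit_sum w i)"
    by (subst ennreal_plus) (simp_all add: ennreal_mult hit_sum_nonneg sum_nonneg)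
  also have "\<dots> \<le> ennreal (1 + real i + 7 * X)"
    using s h by (intro ennreal_leI) linarith
  finally show ?thesis unfolding X_def .
qed

end


section \<open>Expected cost of a query\<close>

lemma est_eta_pi_nonzero:
  "est_eta_pi N ss w l \<noteq> 0 \<Longrightarrow> (w, l) \<in> set (map (\<lambda>s. (fst s, fst (snd s))) ss)"
  unfolding est_eta_pi_def by (induction ss) (auto split: if_splits)

lemma est_eta_pi_nonneg: "0 \<le> est_eta_pi N ss w l"
  unfolding est_eta_pi_def by (rule sum_list_nonneg) auto

lemma est_sB_round_nonzero:
  "est_sB_round c d ss v \<noteq> 0 \<Longrightarrow> \<exists>s\<in>set ss. snd (snd (snd s)) v \<noteq> 0"
  unfolding est_sB_round_def by (induction ss) (auto split: if_splits)

text \<open>Nonemptiness puts both middle positions inside the list; the median of the empty list is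
  unspecified.\<close>

lemma median_nonzero:
  assumes "median xs \<noteq> 0" "xs \<noteq> []" shows "\<exists>x\<in>set xs. x \<noteq> 0"
proof (rule ccontr)
  assume "\<not> ?thesis"
  then have 0: "\<forall>x\<in>set (sort xs). x = 0" by simp
  have "sort xs ! k = 0" if "k < length xs" for k
    using 0 that by (metis length_sort nth_mem)
  moreover have "(length xs - 1) div 2 < length xs" "length xs div 2 < length xs"
    using assms(2) by (cases xs; simp)+
  ultimately have "median xs = 0" by (simp add: median_def Let_def)
  with assms(1) show False by simp
qed

lemma card_ex_le:
  assumes "finite A" "finite I"
  shows "card {v \<in> A. \<exists>i\<in>I. P i v} \<le> (\<Sum>v\<in>A. card {i \<in> I. P i v})"
proof -
  have "card {v \<in> A. \<exists>i\<in>I. P i v} = (\<Sum>v\<in>{v \<in> A. \<exists>i\<in>I. P i v}. 1)" by simp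
  also have "\<dots> \<le> (\<Sum>v\<in>{v \<in> A. \<exists>i\<in>I. P i v}. card {i \<in> I. P i v})"
    using assms by (intro sum_mono) (auto simp: Suc_le_eq card_gt_0_iff)
  also have "\<dots> \<le> (\<Sum>v\<in>A. card {i \<in> I. P i v})"
    using assms by (intro sum_mono2) auto
  finally show ?thesis .
qed

section \<open>Accounting for the cost of one run, outcome by outcome\<close>

context prsim_graph
begin

definition support_size :: "'a sample \<Rightarrow> nat" where
  "support_size s = card {v \<in> V. snd (snd (snd s)) v \<noteq> 0}"

text \<open>Costs arising after sampling are charged back to the samples: the support once for the
  medians and once for the output, and one unit each for a scanned estimator and a selected
  pair.\<close>

definition sample_cost :: "'a sample \<times> nat \<Rightarrow> nat" where
  "sample_cost r = snd r + 2 * support_size (fst r) + 2"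

definition read_cost :: "'a set \<Rightarrow> nat \<Rightarrow> 'a sample list \<Rightarrow> nat" where
  "read_cost H N ss = (\<Sum>(w, l)\<in>selected_pairs c H \<epsilon> N ss. card (index_list c G \<epsilon> w l))"

lemma c1_pos: "0 < c1 c"
  unfolding c1_def using beta by simp

lemma selected_pairs_nonzero:
  "selected_pairs c H \<epsilon> N ss \<subseteq> {(w, l). est_eta_pi N ss w l \<noteq> 0}"
proof -
  have "0 < \<epsilon> / c1 c" using eps_pos c1_pos by simp
  then show ?thesis by (auto simp: selected_pairs_def)
qed

lemma finite_est_nonzero: "finite {(w, l). est_eta_pi N ss w l \<noteq> 0}"
  by (rule finite_subset[of _ "set (map (\<lambda>s. (fst s, fst (snd s))) ss)"])
     (auto dest: est_eta_pi_nonzero)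

lemma card_est_nonzero: "card {(w, l). est_eta_pi N ss w l \<noteq> 0} \<le> length ss"
proof -
  have "card {(w, l). est_eta_pi N ss w l \<noteq> 0} \<le> card (set (map (\<lambda>s. (fst s, fst (snd s))) ss))"
    by (rule card_mono) (auto dest: est_eta_pi_nonzero)
  also have "\<dots> \<le> length ss" by (rule card_length[THEN order_trans]) simp
  finally show ?thesis .
qed

lemma finite_selected_pairs: "finite (selected_pairs c H \<epsilon> N ss)"
  using selected_pairs_nonzero finite_est_nonzero by (rule finite_subset)

lemma card_selected_pairs: "card (selected_pairs c H \<epsilon> N ss) \<le> length ss"
  using card_mono[OF finite_est_nonzero selected_pairs_nonzero] card_est_nonzero by (rule order_trans)

text \<open>A node is nonzero in a round only if some backward walk of that round ended with a
  nonzero value there; counting by rounds instead of by nodes makes this additive.\<close>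

lemma median_cost_le:
  "(\<Sum>v\<in>V. card {i. i < length rounds \<and> est_sB_round c d (rounds ! i) v \<noteq> 0})
    \<le> sum_list (map support_size (concat rounds))"
proof -
  have round: "card {v \<in> V. est_sB_round c d ss v \<noteq> 0} \<le> sum_list (map support_size ss)" for ss
  proof -
    have "card {v \<in> V. est_sB_round c d ss v \<noteq> 0} \<le> card {v \<in> V. \<exists>s\<in>set ss. snd (snd (snd s)) v \<noteq> 0}"
      by (rule card_mono) (auto dest: est_sB_round_nonzero)
    also have "\<dots> \<le> sum_list (map support_size ss)"
    proof (induction ss)
      case (Cons s ss)
      have "{v \<in> V. \<exists>s\<in>set (s # ss). snd (snd (snd s)) v \<noteq> 0}
          = {v \<in> V. snd (snd (snd s)) v \<noteq> 0} \<union> {v \<in> V. \<exists>s\<in>set ss. snd (snd (snd s)) v \<noteq> 0}" by auto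
      then have "card {v \<in> V. \<exists>s\<in>set (s # ss). snd (snd (snd s)) v \<noteq> 0}
          \<le> support_size s + card {v \<in> V. \<exists>s\<in>set ss. snd (snd (snd s)) v \<noteq> 0}"
        unfolding support_size_def by (simp only: card_Un_le)
      with Cons show ?case by simp
    qed simp
    finally show ?thesis .
  qed
  have "(\<Sum>v\<in>V. card {i. i < length rounds \<and> est_sB_round c d (rounds ! i) v \<noteq> 0})
      = (\<Sum>v\<in>V. \<Sum>i<length rounds. if est_sB_round c d (rounds ! i) v \<noteq> 0 then 1 else 0)"
    by (rule sum.cong[OF refl], subst sum.inter_filter[symmetric]) (auto intro!: arg_cong[where f = card])
  also have "\<dots> = (\<Sum>i<length rounds. \<Sum>v\<in>V. if est_sB_round c d (rounds ! i) v \<noteq> 0 then 1 else 0)"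
    by (rule sum.swap)
  also have "\<dots> = (\<Sum>i<length rounds. card {v \<in> V. est_sB_round c d (rounds ! i) v \<noteq> 0})"
    by (rule sum.cong[OF refl], subst sum.inter_filter[symmetric]) auto
  also have "\<dots> \<le> (\<Sum>i<length rounds. sum_list (map support_size (rounds ! i)))"
    by (intro sum_mono round)
  also have "\<dots> = sum_list (map (\<lambda>ss. sum_list (map support_size ss)) rounds)"
    by (simp add: sum_list_sum_nth atLeast0LessThan)
  also have "\<dots> = sum_list (map support_size (concat rounds))"
    by (induction rounds) auto
  finally show ?thesis .
qed

text \<open>A nonzero output needs a nonzero median, hence a nonzero round, or an index tuple that
  was read.\<close>

lemma output_cost_le:
  assumes "rounds \<noteq> []"
  shows "card {v \<in> V. est_sI c G H \<epsilon> N ss v + est_sB c d rounds v \<noteq> 0}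
    \<le> sum_list (map support_size (concat rounds)) + read_cost H N ss"
proof -
  let ?sel = "selected_pairs c H \<epsilon> N ss"
  let ?A = "{v \<in> V. \<exists>i\<in>{..<length rounds}. est_sB_round c d (rounds ! i) v \<noteq> 0}"
  let ?B = "\<Union>(w, l)\<in>?sel. fst ` index_list c G \<epsilon> w l"
  have finB: "finite ?B" by (auto simp: case_prod_unfold finite_selected_pairs)
  have "{v \<in> V. est_sI c G H \<epsilon> N ss v + est_sB c d rounds v \<noteq> 0} \<subseteq> ?A \<union> ?B"
  proof
    fix v assume v: "v \<in> {v \<in> V. est_sI c G H \<epsilon> N ss v + est_sB c d rounds v \<noteq> 0}"
    then consider "est_sI c G H \<epsilon> N ss v \<noteq> 0" | "est_sB c d rounds v \<noteq> 0" by fastforce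
    then show "v \<in> ?A \<union> ?B"
    proof cases
      case 1
      then obtain w l where wl: "(w, l) \<in> ?sel"
        "(\<Sum>(v', x)\<in>index_list c G \<epsilon> w l. if v' = v then est_eta_pi N ss w l * x / \<beta>\<^sup>2 else 0) \<noteq> 0"
        unfolding est_sI_def by (force elim: sum.not_neutral_contains_not_neutral)
      from wl(2) obtain x where "(v, x) \<in> index_list c G \<epsilon> w l"
        by (force elim: sum.not_neutral_contains_not_neutral split: if_splits)
      with wl(1) show ?thesis by force
    next
      case 2
      from median_nonzero[OF 2[unfolded est_sB_def]] assms
      obtain ss' where "ss' \<in> set rounds" "est_sB_round c d ss' v \<noteq> 0" by auto
      with v show ?thesis by (auto simp: in_set_conv_nth)
    qed
  qed
  then have "card {v \<in> V. est_sI c G H \<epsilon> N ss v + est_sB c d rounds v \<noteq> 0} \<le> card (?A \<union> ?B)"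
    using finB by (intro card_mono) auto
  also have "\<dots> \<le> card ?A + card ?B" by (rule card_Un_le)
  also have "card ?A \<le> sum_list (map support_size (concat rounds))"
    using card_ex_le[of V "{..<length rounds}" "\<lambda>i v. est_sB_round c d (rounds ! i) v \<noteq> 0"]
      median_cost_le[of rounds d] by simp
  also have "card ?B \<le> (\<Sum>(w, l)\<in>?sel. card (fst ` index_list c G \<epsilon> w l))"
    using card_UN_le[OF finite_selected_pairs, where A = "\<lambda>(w, l). fst ` index_list c G \<epsilon> w l"]
    by (simp add: case_prod_unfold)
  also have "\<dots> \<le> read_cost H N ss"
    unfolding read_cost_def by (intro sum_mono) (auto intro: card_image_le)
  finally show ?thesis by simp
qed

text \<open>\<open>read_cost\<close> enters twice because a tuple that is read may also cause an
  entry of the output.\<close>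

lemma query_cost_le:
  assumes "runs \<noteq> []"
  defines "rounds \<equiv> map (map fst) runs"
  shows "1 + sum_list (map snd (concat runs))
      + (\<Sum>v\<in>V. card {i. i < length rounds \<and> est_sB_round c d (rounds ! i) v \<noteq> 0})
      + card {(w, l). est_eta_pi N (concat rounds) w l \<noteq> 0}
      + (\<Sum>(w, l)\<in>selected_pairs c H \<epsilon> N (concat rounds). 1 + card (index_list c G \<epsilon> w l))
      + card {v \<in> V. est_sI c G H \<epsilon> N (concat rounds) v + est_sB c d rounds v \<noteq> 0}
    \<le> 1 + sum_list (map sample_cost (concat runs)) + 2 * read_cost H N (concat rounds)"
proof -
  let ?S = "sum_list (map support_size (concat rounds))"
  have "rounds \<noteq> []" using assms by simp
  note o = output_cost_le[OF this, of H N "concat rounds" d]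
  have ss: "concat rounds = map fst (concat runs)" unfolding rounds_def by (simp add: map_concat)
  have idx: "(\<Sum>(w, l)\<in>selected_pairs c H \<epsilon> N (concat rounds). 1 + card (index_list c G \<epsilon> w l))
      = card (selected_pairs c H \<epsilon> N (concat rounds)) + read_cost H N (concat rounds)"
    unfolding read_cost_def by (simp only: case_prod_unfold sum.distrib card_eq_sum)
  have "sum_list (map sample_cost (concat runs))
      = sum_list (map snd (concat runs)) + 2 * ?S + 2 * length (concat rounds)"
    unfolding ss
  proof -
    show "sum_list (map sample_cost rs) = sum_list (map snd rs) + 2 * sum_list (map support_size (map fst rs))
        + 2 * length (map fst rs)" for rs
      by (induction rs) (simp_all add: sample_cost_def)
  qed
  with o idx median_cost_le[of rounds d] card_est_nonzero[of N "concat rounds"]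
    card_selected_pairs[of H N "concat rounds"]
  show ?thesis by linarith
qed

section \<open>Expected cost of a single sample\<close>

lemma lossless_prsim_sample: "lossless_spmf (prsim_sample c G H u)"
  unfolding prsim_sample_def Let_def by (auto simp: lossless_sqrtc_walk split: prod.split)

lemma lossless_prsim_query: "lossless_spmf (prsim_query c G H \<epsilon> \<delta> u)"
  unfolding prsim_query_def Let_def
  by (auto intro!: lossless_replicate_spmf lossless_prsim_sample)

text \<open>Four walk lengths give \<open>4 / \<beta>\<^sup>2\<close>: the walk from
  \<open>u\<close> counts for itself and for the levels of the backward walk, and there are two test
  walks. The 3 is one estimator update plus the 2 of \<open>sample_cost\<close>.\<close>

lemma nn_integral_sample_cost:
  assumes u: "u \<in> V"
  shows "(\<integral>\<^sup>+ r. of_nat (sample_cost r) \<partial>measure_spmf (prsim_sample c G H u))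
    \<le> ennreal (4 / \<beta>\<^sup>2 + 3) + (\<integral>\<^sup>+ p. (if last p \<in> H then 0 else ennreal (7 * (real (num_nodes G) * rpr (last p) / \<beta>)))
          \<partial>measure_spmf (sqrtc_walk c G u))"
proof -
  let ?W = "\<lambda>v. measure_spmf (sqrtc_walk c G v)"
  define h where "h w = (if w \<in> H then 0 else ennreal (7 * (real (num_nodes G) * rpr w / \<beta>)))" for w
  have inner: "(\<integral>\<^sup>+ r. of_nat (sample_cost r) \<partial>measure_spmf (
       if walks_meet q1 q2 then return_spmf ((last p, length p - 1, False, \<lambda>_. 0), length p + length q1 + length q2)
       else if last p \<in> H then return_spmf ((last p, length p - 1, True, \<lambda>_. 0), length p + length q1 + length q2 + 1)
       else do {
         (b, k') \<leftarrow> spmf_of_pmf (vbbw c G (last p) (length p - 1));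
         return_spmf ((last p, length p - 1, True, b), length p + length q1 + length q2 + 1 + k' + card {v \<in> V. b v \<noteq> 0})
       })) \<le> of_nat (length p) + of_nat (length p) + of_nat (length q1) + of_nat (length q2) + 3 + h (last p)"
    (is "?I \<le> ?R")
    if p: "p \<in> set_spmf (sqrtc_walk c G u)" for p q1 q2
  proof -
    have w: "last p \<in> V" using sqrtc_walk_last[OF u p] .
    have len: "1 + real (length p - 1) = real (length p)" using sqrtc_walk_nonempty[OF p] by (cases p) auto
    have nn: "0 \<le> 7 * (real (num_nodes G) * rpr (last p) / \<beta>)"
      using beta rpr_nonneg by (intro mult_nonneg_nonneg divide_nonneg_nonneg) simp_all
    define R where "R = length p + length q1 + length q2 + 3"
    have R: "of_nat R \<le> ?R"
    proof -
      have "of_nat R + (of_nat (length p) + h (last p)) = ?R" unfolding R_def by (simp add: ac_simps)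
      then show ?thesis by (metis le_iff_add)
    qed
    show ?thesis
    proof (cases "walks_meet q1 q2 \<or> last p \<in> H")
      case True
      have "?I \<le> of_nat R"
        using True by (auto simp: nn_integral_return_spmf sample_cost_def support_size_def R_def)
      then show ?thesis using R by (rule order_trans)
    next
      case False
      have "?I = (\<integral>\<^sup>+ r. of_nat R + of_nat (snd r + 3 * card {v \<in> V. fst r v \<noteq> 0}) \<partial>vbbw c G (last p) (length p - 1))"
      proof -
        have "walks_meet q1 q2 = False" "(last p \<in> H) = False" using False by simp_all
        then show ?thesis
          by (simp only: if_False nn_integral_bind_spmf nn_integral_return_spmf case_prod_unfold
                nn_integral_spmf_of_pmf of_nat_add[symmetric])
             (intro nn_integral_cong arg_cong[where f = of_nat], simp add: sample_cost_def support_size_def R_def)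
      qed
      also have "\<dots> = of_nat R + (\<integral>\<^sup>+ r. of_nat (snd r + 3 * card {v \<in> V. fst r v \<noteq> 0}) \<partial>vbbw c G (last p) (length p - 1))"
        by (subst nn_integral_add) (simp_all add: measure_pmf.emeasure_space_1)
      also have "\<dots> \<le> of_nat R + ennreal (1 + real (length p - 1) + 7 * (real (num_nodes G) * rpr (last p) / \<beta>))"
        by (intro add_left_mono nn_integral_vbbw_total w)
      also have "\<dots> = of_nat R + (of_nat (length p) + h (last p))"
        using False nn unfolding len by (subst ennreal_plus) (simp_all add: h_def ennreal_of_nat_eq_real_of_nat)
      also have "\<dots> = ?R" unfolding R_def by (simp add: ac_simps)
      finally show ?thesis .
    qed
  qed
  have len: "(\<integral>\<^sup>+ q. of_nat (length q) \<partial>?W v) \<le> ennreal (1 / \<beta>\<^sup>2)" if "v \<in> V" for v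
    by (rule nn_integral_length_walk[OF that])
  have "(\<integral>\<^sup>+ r. of_nat (sample_cost r) \<partial>measure_spmf (prsim_sample c G H u))
    \<le> (\<integral>\<^sup>+ p. \<integral>\<^sup>+ q1. \<integral>\<^sup>+ q2. of_nat (length p) + of_nat (length p) + of_nat (length q1) + of_nat (length q2) + 3 + h (last p) \<partial>?W (last p) \<partial>?W (last p) \<partial>?W u)"
    unfolding prsim_sample_def Let_def nn_integral_bind_spmf[of "sqrtc_walk c G _"]
    by (intro nn_integral_spmf_cong_set inner)
  also have "\<dots> \<le> (\<integral>\<^sup>+ p. of_nat (length p) + of_nat (length p) + ennreal (1 / \<beta>\<^sup>2) + ennreal (1 / \<beta>\<^sup>2) + 3 + h (last p) \<partial>?W u)"
  proof (rule nn_integral_spmf_cong_set)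
    fix p assume "p \<in> set_spmf (sqrtc_walk c G u)"
    then have w: "last p \<in> V" by (rule sqrtc_walk_last[OF u])
    \<comment> \<open>Everything that is independent of the two test walks.\<close>
    define K where "K = of_nat (length p) + of_nat (length p) + (3 :: ennreal) + h (last p)"
    have "(\<integral>\<^sup>+ q1. \<integral>\<^sup>+ q2. of_nat (length p) + of_nat (length p) + of_nat (length q1) + of_nat (length q2) + 3 + h (last p) \<partial>?W (last p) \<partial>?W (last p))
        = (\<integral>\<^sup>+ q1. \<integral>\<^sup>+ q2. (K + of_nat (length q1)) + of_nat (length q2) \<partial>?W (last p) \<partial>?W (last p))"
      by (intro nn_integral_cong) (simp add: K_def ac_simps)
    also have "\<dots> = (\<integral>\<^sup>+ q1. (\<integral>\<^sup>+ q2. K + of_nat (length q1) \<partial>?W (last p)) + (\<integral>\<^sup>+ q2. of_nat (length q2) \<partial>?W (last p)) \<partial>?W (last p))"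
      by (subst nn_integral_add) simp_all
    also have "\<dots> \<le> (\<integral>\<^sup>+ q1. (K + of_nat (length q1)) + ennreal (1 / \<beta>\<^sup>2) \<partial>?W (last p))"
      by (intro nn_integral_mono add_mono nn_integral_spmf_const_le len w)
    also have "\<dots> = (\<integral>\<^sup>+ q1. (K + ennreal (1 / \<beta>\<^sup>2)) + of_nat (length q1) \<partial>?W (last p))"
      by (simp add: ac_simps)
    also have "\<dots> = (\<integral>\<^sup>+ q1. K + ennreal (1 / \<beta>\<^sup>2) \<partial>?W (last p)) + (\<integral>\<^sup>+ q1. of_nat (length q1) \<partial>?W (last p))"
      by (subst nn_integral_add) simp_all
    also have "\<dots> \<le> (K + ennreal (1 / \<beta>\<^sup>2)) + ennreal (1 / \<beta>\<^sup>2)"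
      by (intro add_mono nn_integral_spmf_const_le len w)
    also have "\<dots> = of_nat (length p) + of_nat (length p) + ennreal (1 / \<beta>\<^sup>2) + ennreal (1 / \<beta>\<^sup>2) + 3 + h (last p)"
      by (simp add: K_def ac_simps)
    finally show "(\<integral>\<^sup>+ q1. \<integral>\<^sup>+ q2. of_nat (length p) + of_nat (length p) + of_nat (length q1) + of_nat (length q2) + 3 + h (last p) \<partial>?W (last p) \<partial>?W (last p))
        \<le> \<dots>" .
  qed
  also have "\<dots> = (\<integral>\<^sup>+ p. of_nat (length p) \<partial>?W u) + (\<integral>\<^sup>+ p. of_nat (length p) \<partial>?W u)
      + (\<integral>\<^sup>+ p. ennreal (1 / \<beta>\<^sup>2) + ennreal (1 / \<beta>\<^sup>2) + 3 \<partial>?W u) + (\<integral>\<^sup>+ p. h (last p) \<partial>?W u)"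
    by (simp add: nn_integral_add add.assoc distrib_right)
  also have "\<dots> \<le> ennreal (1 / \<beta>\<^sup>2) + ennreal (1 / \<beta>\<^sup>2) + (ennreal (1 / \<beta>\<^sup>2) + ennreal (1 / \<beta>\<^sup>2) + 3) + (\<integral>\<^sup>+ p. h (last p) \<partial>?W u)"
    by (intro add_mono nn_integral_spmf_const_le len u order_refl)
  also have "ennreal (1 / \<beta>\<^sup>2) + ennreal (1 / \<beta>\<^sup>2) + (ennreal (1 / \<beta>\<^sup>2) + ennreal (1 / \<beta>\<^sup>2) + 3) = ennreal (4 / \<beta>\<^sup>2 + 3)"
  proof -
    have "ennreal (4 / \<beta>\<^sup>2 + 3) = ennreal (1 / \<beta>\<^sup>2 + 1 / \<beta>\<^sup>2 + (1 / \<beta>\<^sup>2 + 1 / \<beta>\<^sup>2 + 3))" by simp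
    also have "\<dots> = ennreal (1 / \<beta>\<^sup>2) + ennreal (1 / \<beta>\<^sup>2) + (ennreal (1 / \<beta>\<^sup>2) + ennreal (1 / \<beta>\<^sup>2) + ennreal 3)"
      by (simp only: ennreal_plus add_nonneg_nonneg zero_le_numeral zero_le_divide_1_iff zero_le_power2)
    finally show ?thesis by simp
  qed
  finally show ?thesis unfolding h_def .
qed

text \<open>The square arises because \<open>rpr w\<close> is both the chance to end at
  \<open>w\<close> and, times \<open>n\<close>, the order of the cost of the backward walk from
  there.\<close>

lemma sum_sample_cost:
  "(\<Sum>u\<in>V. \<integral>\<^sup>+ r. of_nat (sample_cost r) \<partial>measure_spmf (prsim_sample c G H u))
    \<le> ennreal (real (num_nodes G) * (4 / \<beta>\<^sup>2 + 3 + 7 / \<beta> * (\<Sum>w\<in>V - H. real (num_nodes G) * (rpr w)\<^sup>2)))"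
proof -
  define h where "h w = (if w \<in> H then 0 else ennreal (7 * (real (num_nodes G) * rpr w / \<beta>)))" for w
  let ?n = "real (num_nodes G)"
  have b: "0 \<le> 4 / \<beta>\<^sup>2 + 3" by (intro add_nonneg_nonneg) simp_all
  have "(\<Sum>u\<in>V. \<integral>\<^sup>+ r. of_nat (sample_cost r) \<partial>measure_spmf (prsim_sample c G H u))
      \<le> (\<Sum>u\<in>V. ennreal (4 / \<beta>\<^sup>2 + 3) + (\<integral>\<^sup>+ p. h (last p) \<partial>measure_spmf (sqrtc_walk c G u)))"
    unfolding h_def by (intro sum_mono nn_integral_sample_cost)
  also have "\<dots> = ennreal (?n * (4 / \<beta>\<^sup>2 + 3)) + (\<Sum>w\<in>V. ennreal (?n * rpr w) * h w)"
    unfolding sum.distrib sum_walk_last using b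
    by (simp add: num_nodes_def ennreal_mult ennreal_of_nat_eq_real_of_nat)
  also have "(\<Sum>w\<in>V. ennreal (?n * rpr w) * h w) = (\<Sum>w\<in>V - H. ennreal (?n * (7 / \<beta> * (?n * (rpr w)\<^sup>2))))"
  proof (rule sum.mono_neutral_cong_right)
    fix w assume "w \<in> V - H"
    then show "ennreal (?n * rpr w) * h w = ennreal (?n * (7 / \<beta> * (?n * (rpr w)\<^sup>2)))"
      using rpr_nonneg[of w] beta
      by (simp add: h_def ennreal_mult[symmetric] power2_eq_square mult_ac)
  qed (auto simp: h_def)
  also have "\<dots> = ennreal (?n * (7 / \<beta> * (\<Sum>w\<in>V - H. ?n * (rpr w)\<^sup>2)))"
    using beta by (subst sum_ennreal) (simp_all add: sum_distrib_left)
  also have "ennreal (?n * (4 / \<beta>\<^sup>2 + 3)) + \<dots> = ennreal (?n * (4 / \<beta>\<^sup>2 + 3) + ?n * (7 / \<beta> * (\<Sum>w\<in>V - H. ?n * (rpr w)\<^sup>2)))"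
    using b beta by (intro ennreal_plus[symmetric] mult_nonneg_nonneg sum_nonneg) simp_all
  finally show ?thesis by (simp add: distrib_left)
qed

text \<open>Dropping the condition that the test walks do not meet leaves the event whose
  probability is \<open>ppr\<close>.\<close>

lemma nn_integral_sample_pair:
  "(\<integral>\<^sup>+ r. (case fst r of (w', l', no_meet, b) \<Rightarrow> if w' = w \<and> l' = l \<and> no_meet then 1 else 0) \<partial>measure_spmf (prsim_sample c G H u))
    \<le> ennreal (ppr c G l u w)"
proof -
  let ?W = "\<lambda>v. measure_spmf (sqrtc_walk c G v)"
  let ?i = "\<lambda>p. (if (length p - 1, last p) = (l, w) then 1 else 0) :: ennreal"
  have inner: "(\<integral>\<^sup>+ r. (case fst r of (w', l', no_meet, b) \<Rightarrow> if w' = w \<and> l' = l \<and> no_meet then 1 else 0) \<partial>measure_spmf (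
       if walks_meet q1 q2 then return_spmf ((last p, length p - 1, False, \<lambda>_. 0), length p + length q1 + length q2)
       else if last p \<in> H then return_spmf ((last p, length p - 1, True, \<lambda>_. 0), length p + length q1 + length q2 + 1)
       else do {
         (b, k') \<leftarrow> spmf_of_pmf (vbbw c G (last p) (length p - 1));
         return_spmf ((last p, length p - 1, True, b), length p + length q1 + length q2 + 1 + k' + card {v \<in> V. b v \<noteq> 0})
       })) \<le> ?i p" for p q1 q2 :: "'a list"
    by (auto simp: nn_integral_bind_spmf nn_integral_return_spmf case_prod_unfold measure_pmf.emeasure_space_1 simp del: bind_spmf_of_pmf)
  have "(\<integral>\<^sup>+ r. (case fst r of (w', l', no_meet, b) \<Rightarrow> if w' = w \<and> l' = l \<and> no_meet then 1 else 0) \<partial>measure_spmf (prsim_sample c G H u))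
    \<le> (\<integral>\<^sup>+ p. \<integral>\<^sup>+ q1. \<integral>\<^sup>+ q2. ?i p \<partial>?W (last p) \<partial>?W (last p) \<partial>?W u)"
    unfolding prsim_sample_def Let_def nn_integral_bind_spmf[of "sqrtc_walk c G _"]
    by (intro nn_integral_mono inner)
  also have "\<dots> \<le> (\<integral>\<^sup>+ p. ?i p \<partial>?W u)"
    by (intro nn_integral_mono order_trans[OF nn_integral_mono[OF nn_integral_spmf_const_le] nn_integral_spmf_const_le])
  also have "\<dots> = ennreal (ppr c G l u w)" by (simp only: ppr_eq_emeasure)
  finally show ?thesis .
qed

end


section \<open>Expected cost of reading the index\<close>

context prsim_graph
begin

text \<open>The random set of selected pairs is replaced by indicators over a fixed range, so that
  sums and expectation can be exchanged.\<close>

lemma of_nat_read_cost_le: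
  assumes H: "finite H"
  shows "of_nat (read_cost H N ss)
    \<le> (\<Sum>w\<in>H. \<Sum>l. of_nat (card (index_list c G \<epsilon> w l)) * (if est_eta_pi N ss w l > \<epsilon> / c1 c then 1 else 0 :: ennreal))"
proof -
  let ?sel = "selected_pairs c H \<epsilon> N ss"
  let ?f = "\<lambda>w l. of_nat (card (index_list c G \<epsilon> w l)) * (if est_eta_pi N ss w l > \<epsilon> / c1 c then 1 else 0 :: ennreal)"
  have "finite (snd ` ?sel)" using finite_selected_pairs by (rule finite_imageI)
  \<comment> \<open>This cut-off depends on the outcome and disappears again when the sum is
    extended to all levels.\<close>
  then obtain L where L: "snd ` ?sel \<subseteq> {..<L}" unfolding finite_nat_iff_bounded by blast
  have sub: "?sel \<subseteq> H \<times> {..<L}"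
  proof
    fix z assume z: "z \<in> ?sel"
    then have "snd z \<in> {..<L}" using L by blast
    with z show "z \<in> H \<times> {..<L}" by (auto simp: selected_pairs_def)
  qed
  have "of_nat (read_cost H N ss) = (\<Sum>(w, l)\<in>?sel. of_nat (card (index_list c G \<epsilon> w l)))"
    unfolding read_cost_def by (simp add: case_prod_unfold)
  also have "\<dots> = (\<Sum>(w, l)\<in>?sel. ?f w l)"
    by (rule sum.cong[OF refl]) (auto simp: selected_pairs_def)
  also have "\<dots> \<le> (\<Sum>(w, l)\<in>H \<times> {..<L}. ?f w l)"
    using H sub by (intro sum_mono2) auto
  also have "\<dots> = (\<Sum>w\<in>H. \<Sum>l<L. ?f w l)" by (simp only: sum.cartesian_product)
  also have "\<dots> \<le> (\<Sum>w\<in>H. \<Sum>l. ?f w l)"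
    by (intro sum_mono sum_le_suminf summableI) simp_all
  finally show ?thesis .
qed

lemma nn_integral_est_eta_pi:
  "(\<integral>\<^sup>+ runs. ennreal (est_eta_pi (k * k') (concat (map (map fst) runs)) w l)
      \<partial>measure_spmf (replicate_spmf k (replicate_spmf k' (prsim_sample c G H u))))
    \<le> ennreal (ppr c G l u w)"
proof -
  let ?N = "k * k'"
  let ?g = "\<lambda>r. (case fst r of (w', l', no_meet, b) \<Rightarrow> if w' = w \<and> l' = l \<and> no_meet then 1 else 0) :: ennreal"
  let ?f = "\<lambda>r :: 'a sample \<times> nat. ennreal (1 / real ?N) * ?g r"
  have est: "ennreal (est_eta_pi ?N (map fst rs) w l) = sum_list (map ?f rs)" for rs :: "('a sample \<times> nat) list"
  proof (induction rs)
    case (Cons r rs)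
    have "est_eta_pi ?N (map fst (r # rs)) w l
        = (case fst r of (w', l', no_meet, b) \<Rightarrow> if w' = w \<and> l' = l \<and> no_meet then 1 / real ?N else 0)
          + est_eta_pi ?N (map fst rs) w l"
      by (simp add: est_eta_pi_def)
    also have "ennreal \<dots> = ennreal (case fst r of (w', l', no_meet, b) \<Rightarrow> if w' = w \<and> l' = l \<and> no_meet then 1 / real ?N else 0)
        + ennreal (est_eta_pi ?N (map fst rs) w l)"
      by (rule ennreal_plus) (auto simp: est_eta_pi_nonneg split: prod.split)
    finally show ?case using Cons by (auto split: prod.split)
  qed (simp add: est_eta_pi_def)
  have "(\<integral>\<^sup>+ runs. ennreal (est_eta_pi ?N (concat (map (map fst) runs)) w l)
      \<partial>measure_spmf (replicate_spmf k (replicate_spmf k' (prsim_sample c G H u))))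
    = (\<integral>\<^sup>+ runs. sum_list (map ?f (concat runs))
      \<partial>measure_spmf (replicate_spmf k (replicate_spmf k' (prsim_sample c G H u))))"
    unfolding map_concat[symmetric] est ..
  also have "\<dots> \<le> of_nat ?N * (\<integral>\<^sup>+ r. ?f r \<partial>measure_spmf (prsim_sample c G H u))"
    by (rule nn_integral_replicate_concat_spmf)
  also have "\<dots> = of_nat ?N * ennreal (1 / real ?N) * (\<integral>\<^sup>+ r. ?g r \<partial>measure_spmf (prsim_sample c G H u))"
    by (subst nn_integral_cmult) (simp_all add: mult.assoc)
  also have "\<dots> \<le> 1 * ennreal (ppr c G l u w)"
  proof (intro mult_mono nn_integral_sample_pair)
    \<comment> \<open>An inequality because the product is 0 when there are no samples.\<close>
    have "real ?N * (1 / real ?N) \<le> 1" by simp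
    then have "ennreal (real ?N) * ennreal (1 / real ?N) \<le> ennreal 1"
      by (subst ennreal_mult[symmetric]) (simp_all add: ennreal_leI del: ennreal_1)
    then show "of_nat ?N * ennreal (1 / real ?N) \<le> 1" by (simp add: ennreal_of_nat_eq_real_of_nat del: of_nat_mult)
  qed simp_all
  finally show ?thesis by simp
qed

lemma sum_card_index_list:
  assumes w: "w \<in> V"
  shows "(\<Sum>l. of_nat (card (index_list c G \<epsilon> w l))) \<le> ennreal (real (num_nodes G) * rpr w / \<rho>)"
proof -
  have "(\<Sum>l. of_nat (card (index_list c G \<epsilon> w l))) \<le> (\<Sum>l. (\<Sum>v\<in>V. ennreal (ppr c G l v w)) * ennreal (1 / \<rho>))"
  proof (intro suminf_le summableI)
    fix l
    have "of_nat (card (index_list c G \<epsilon> w l)) \<le> ennreal ((\<Sum>v\<in>V. ppr c G l v w) * (1 / \<rho>))"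
      unfolding ennreal_of_nat_eq_real_of_nat using card_index_list[of w l] by (intro ennreal_leI) simp
    also have "\<dots> = (\<Sum>v\<in>V. ennreal (ppr c G l v w)) * ennreal (1 / \<rho>)"
      using r_max_pos by (subst ennreal_mult) (simp_all add: sum_ennreal sum_nonneg ppr_nonneg)
    finally show "of_nat (card (index_list c G \<epsilon> w l)) \<le> \<dots>" .
  qed
  also have "\<dots> = ennreal (real (num_nodes G) * rpr w) * ennreal (1 / \<rho>)"
    by (simp only: ennreal_suminf_multc suminf_sum_ppr[OF w])
  also have "\<dots> = ennreal (real (num_nodes G) * rpr w / \<rho>)"
    using r_max_pos rpr_nonneg by (subst ennreal_mult[symmetric]) simp_all
  finally show ?thesis .
qed

text \<open>The lists are deterministic, so only the selection is random. Its probability, summed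
  over all starts, is bounded by \<open>n\<close> trivially and by Markov's inequality with
  threshold \<open>\<epsilon> / c1 c\<close>.\<close>

lemma sum_read_cost:
  assumes H: "H \<subseteq> V"
  shows "(\<Sum>u\<in>V. \<integral>\<^sup>+ runs. of_nat (read_cost H (k * k') (concat (map (map fst) runs)))
      \<partial>measure_spmf (replicate_spmf k (replicate_spmf k' (prsim_sample c G H u))))
    \<le> ennreal (real (num_nodes G) * (\<Sum>w\<in>H. real (num_nodes G) * rpr w / \<rho> * min 1 (c1 c / \<epsilon> * rpr w)))"
proof -
  let ?n = "real (num_nodes G)"
  let ?R = "\<lambda>u. measure_spmf (replicate_spmf k (replicate_spmf k' (prsim_sample c G H u)))"
  let ?e = "\<lambda>runs w l. est_eta_pi (k * k') (concat (map (map fst) runs)) w l"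
  let ?sel = "\<lambda>runs w l. if ?e runs w l > \<epsilon> / c1 c then 1 else 0 :: ennreal"
  let ?L = "\<lambda>w l. of_nat (card (index_list c G \<epsilon> w l)) :: ennreal"
  have finH: "finite H" using H finite_V by (rule finite_subset)
  have a: "0 < c1 c / \<epsilon>" using c1_pos eps_pos by simp
  have prob: "(\<Sum>u\<in>V. \<integral>\<^sup>+ runs. ?sel runs w l \<partial>?R u) \<le> ennreal (?n * min 1 (c1 c / \<epsilon> * rpr w))" if w: "w \<in> V" for w l
  proof -
    have "(\<Sum>u\<in>V. \<integral>\<^sup>+ runs. ?sel runs w l \<partial>?R u) \<le> (\<Sum>u\<in>V. 1)"
      by (intro sum_mono order_trans[OF nn_integral_mono nn_integral_spmf_const_le]) simp
    also have "\<dots> = ennreal ?n" by (simp add: num_nodes_def ennreal_of_nat_eq_real_of_nat)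
    finally have 1: "(\<Sum>u\<in>V. \<integral>\<^sup>+ runs. ?sel runs w l \<partial>?R u) \<le> ennreal ?n" .
    have "(\<Sum>u\<in>V. \<integral>\<^sup>+ runs. ?sel runs w l \<partial>?R u) \<le> (\<Sum>u\<in>V. \<integral>\<^sup>+ runs. ennreal (c1 c / \<epsilon>) * ennreal (?e runs w l) \<partial>?R u)"
    proof (intro sum_mono nn_integral_mono)
      fix runs :: "('a sample \<times> nat) list list"
      show "?sel runs w l \<le> ennreal (c1 c / \<epsilon>) * ennreal (?e runs w l)"
      proof (cases "?e runs w l > \<epsilon> / c1 c")
        case True
        then have "1 \<le> c1 c / \<epsilon> * ?e runs w l" using c1_pos eps_pos by (simp add: field_simps)
        then have "ennreal 1 \<le> ennreal (c1 c / \<epsilon> * ?e runs w l)" by (rule ennreal_leI)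
        with True a show ?thesis by (simp only: ennreal_mult less_imp_le est_eta_pi_nonneg if_True ennreal_1)
      qed simp
    qed
    also have "\<dots> = (\<Sum>u\<in>V. ennreal (c1 c / \<epsilon>) * (\<integral>\<^sup>+ runs. ennreal (?e runs w l) \<partial>?R u))"
      by (intro sum.cong refl nn_integral_cmult) simp
    also have "\<dots> \<le> (\<Sum>u\<in>V. ennreal (c1 c / \<epsilon>) * ennreal (ppr c G l u w))"
      by (intro sum_mono mult_left_mono nn_integral_est_eta_pi) simp
    also have "\<dots> = ennreal (c1 c / \<epsilon> * (\<Sum>u\<in>V. ppr c G l u w))"
      using a by (subst ennreal_mult) (simp_all add: sum_distrib_left[symmetric] sum_ennreal ppr_nonneg sum_nonneg)
    also have "\<dots> \<le> ennreal (c1 c / \<epsilon> * (?n * rpr w))"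
    proof (intro ennreal_leI mult_left_mono)
      \<comment> \<open>One level is bounded by all levels together; the selection bound then no
        longer depends on \<open>l\<close> and factors out of the sum of list lengths.\<close>
      have "(\<Sum>u\<in>V. ppr c G l u w) \<le> (\<Sum>l<Suc l. \<Sum>u\<in>V. ppr c G l u w)"
        by (simp add: sum_nonneg ppr_nonneg)
      also have "\<dots> \<le> ?n * rpr w" by (rule sum_ppr_le[OF w])
      finally show "(\<Sum>u\<in>V. ppr c G l u w) \<le> ?n * rpr w" .
    qed (use a in simp)
    finally have 2: "(\<Sum>u\<in>V. \<integral>\<^sup>+ runs. ?sel runs w l \<partial>?R u) \<le> \<dots>" .
    show ?thesis using 1 2 by (cases "1 \<le> c1 c / \<epsilon> * rpr w") (simp_all add: min_def mult_ac)
  qed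
  have "(\<Sum>u\<in>V. \<integral>\<^sup>+ runs. of_nat (read_cost H (k * k') (concat (map (map fst) runs))) \<partial>?R u)
      \<le> (\<Sum>u\<in>V. \<integral>\<^sup>+ runs. (\<Sum>w\<in>H. \<Sum>l. ?L w l * ?sel runs w l) \<partial>?R u)"
    by (intro sum_mono nn_integral_mono of_nat_read_cost_le finH)
  also have "\<dots> = (\<Sum>u\<in>V. \<Sum>w\<in>H. \<Sum>l. ?L w l * (\<integral>\<^sup>+ runs. ?sel runs w l \<partial>?R u))"
    by (intro sum.cong refl, subst nn_integral_sum, simp, subst nn_integral_suminf, simp,
        subst nn_integral_cmult, simp, rule refl)
  also have "\<dots> = (\<Sum>w\<in>H. \<Sum>u\<in>V. \<Sum>l. ?L w l * (\<integral>\<^sup>+ runs. ?sel runs w l \<partial>?R u))"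
    by (rule sum.swap)
  also have "\<dots> = (\<Sum>w\<in>H. \<Sum>l. \<Sum>u\<in>V. ?L w l * (\<integral>\<^sup>+ runs. ?sel runs w l \<partial>?R u))"
    by (intro sum.cong refl suminf_sum[symmetric] summableI)
  also have "\<dots> = (\<Sum>w\<in>H. \<Sum>l. ?L w l * (\<Sum>u\<in>V. \<integral>\<^sup>+ runs. ?sel runs w l \<partial>?R u))"
    by (simp only: sum_distrib_left)
  also have "\<dots> \<le> (\<Sum>w\<in>H. \<Sum>l. ?L w l * ennreal (?n * min 1 (c1 c / \<epsilon> * rpr w)))"
    using H by (intro sum_mono suminf_le mult_left_mono prob summableI) auto
  also have "\<dots> = (\<Sum>w\<in>H. (\<Sum>l. ?L w l) * ennreal (?n * min 1 (c1 c / \<epsilon> * rpr w)))" by simp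
  also have "\<dots> \<le> (\<Sum>w\<in>H. ennreal (?n * rpr w / \<rho>) * ennreal (?n * min 1 (c1 c / \<epsilon> * rpr w)))"
    using H by (intro sum_mono mult_right_mono sum_card_index_list) auto
  also have "\<dots> = (\<Sum>w\<in>H. ennreal (?n * (?n * rpr w / \<rho> * min 1 (c1 c / \<epsilon> * rpr w))))"
  proof (rule sum.cong[OF refl])
    fix w
    have "0 \<le> c1 c / \<epsilon> * rpr w" using a rpr_nonneg[of w] by (intro mult_nonneg_nonneg) simp_all
    then have "0 \<le> ?n * min 1 (c1 c / \<epsilon> * rpr w)" by simp
    then show "ennreal (?n * rpr w / \<rho>) * ennreal (?n * min 1 (c1 c / \<epsilon> * rpr w))
        = ennreal (?n * (?n * rpr w / \<rho> * min 1 (c1 c / \<epsilon> * rpr w)))"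
      using r_max_pos rpr_nonneg[of w] by (subst ennreal_mult[symmetric]) (simp_all add: mult_ac)
  qed
  also have "\<dots> = ennreal (?n * (\<Sum>w\<in>H. ?n * rpr w / \<rho> * min 1 (c1 c / \<epsilon> * rpr w)))"
    unfolding sum_distrib_left using r_max_pos rpr_nonneg c1_pos eps_pos
    by (intro sum_ennreal mult_nonneg_nonneg divide_nonneg_nonneg) simp_all
  finally show ?thesis .
qed

text \<open>Positivity of \<open>f_r\<close> guarantees at least one round, so every median is taken
  of a nonempty list.\<close>

lemma nn_integral_query_cost:
  assumes "f_r G \<delta> > 0"
  shows "(\<integral>\<^sup>+ r. of_nat (snd r) \<partial>measure_spmf (prsim_query c G H \<epsilon> \<delta> u))
    \<le> 1 + of_nat (n_r c G \<epsilon> \<delta>) * (\<integral>\<^sup>+ r. of_nat (sample_cost r) \<partial>measure_spmf (prsim_sample c G H u))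
      + 2 * (\<integral>\<^sup>+ runs. of_nat (read_cost H (f_r G \<delta> * d_r c \<epsilon>) (concat (map (map fst) runs)))
          \<partial>measure_spmf (replicate_spmf (f_r G \<delta>) (replicate_spmf (d_r c \<epsilon>) (prsim_sample c G H u))))"
    (is "_ \<le> 1 + _ * ?S + 2 * ?T")
proof -
  let ?R = "measure_spmf (replicate_spmf (f_r G \<delta>) (replicate_spmf (d_r c \<epsilon>) (prsim_sample c G H u)))"
  have N: "n_r c G \<epsilon> \<delta> = f_r G \<delta> * d_r c \<epsilon>" by (simp add: n_r_def)
  have "(\<integral>\<^sup>+ r. of_nat (snd r) \<partial>measure_spmf (prsim_query c G H \<epsilon> \<delta> u))
      \<le> (\<integral>\<^sup>+ runs. of_nat (1 + sum_list (map sample_cost (concat runs))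
          + 2 * read_cost H (n_r c G \<epsilon> \<delta>) (concat (map (map fst) runs))) \<partial>?R)"
    unfolding prsim_query_def Let_def nn_integral_bind_spmf nn_integral_return_spmf snd_conv
  proof (intro nn_integral_spmf_cong_set of_nat_mono query_cost_le)
    fix runs assume "runs \<in> set_spmf (replicate_spmf (f_r G \<delta>) (replicate_spmf (d_r c \<epsilon>) (prsim_sample c G H u)))"
    from length_replicate_spmf[OF this] assms show "runs \<noteq> []" by auto
  qed
  also have "\<dots> = (\<integral>\<^sup>+ runs. 1 \<partial>?R) + (\<integral>\<^sup>+ runs. sum_list (map (\<lambda>r. of_nat (sample_cost r)) (concat runs)) \<partial>?R)
      + 2 * ?T"
  proof -
    have "of_nat (sum_list (map sample_cost rs)) = (sum_list (map (\<lambda>r. of_nat (sample_cost r)) rs) :: ennreal)" for rs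
      by (induction rs) simp_all
    then show ?thesis
      by (simp only: of_nat_add of_nat_mult of_nat_1 of_nat_numeral N) (simp add: nn_integral_add nn_integral_cmult)
  qed
  also have "\<dots> \<le> 1 + of_nat (n_r c G \<epsilon> \<delta>) * ?S + 2 * ?T"
    unfolding N by (intro add_mono nn_integral_spmf_const_le nn_integral_replicate_concat_spmf order_refl)
  finally show ?thesis .
qed

text \<open>A uniform start means the sum over all starts divided by \<open>n\<close>, which cancels
  the factor \<open>n\<close> in \<open>sum_sample_cost\<close> and
  \<open>sum_read_cost\<close>.\<close>

lemma expected_query_cost_le:
  assumes H: "H \<subseteq> V" and f: "f_r G \<delta> > 0" and V: "V \<noteq> {}"
  shows "expected_query_cost c G H \<epsilon> \<delta>
    \<le> ennreal (1 + real (n_r c G \<epsilon> \<delta>) * (4 / \<beta>\<^sup>2 + 3 + 7 / \<beta> * (\<Sum>w\<in>V - H. real (num_nodes G) * (rpr w)\<^sup>2))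
        + 2 * (\<Sum>w\<in>H. real (num_nodes G) * rpr w / \<rho> * min 1 (c1 c / \<epsilon> * rpr w)))"
    (is "_ \<le> ennreal (1 + real ?N * ?A + 2 * ?B)")
proof -
  let ?n = "real (num_nodes G)"
  let ?T = "\<lambda>u. \<integral>\<^sup>+ runs. of_nat (read_cost H (f_r G \<delta> * d_r c \<epsilon>) (concat (map (map fst) runs)))
          \<partial>measure_spmf (replicate_spmf (f_r G \<delta>) (replicate_spmf (d_r c \<epsilon>) (prsim_sample c G H u)))"
  have n: "?n > 0" using V by (simp add: num_nodes_def card_gt_0_iff)
  have A: "0 \<le> ?A"
    using beta by (intro add_nonneg_nonneg mult_nonneg_nonneg sum_nonneg) simp_all
  have B: "0 \<le> ?B"
    using c1_pos eps_pos r_max_pos rpr_nonneg by (intro sum_nonneg mult_nonneg_nonneg divide_nonneg_nonneg) simp_all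
  have "expected_query_cost c G H \<epsilon> \<delta>
      = (\<Sum>u\<in>V. \<integral>\<^sup>+ r. of_nat (snd r) \<partial>measure_spmf (prsim_query c G H \<epsilon> \<delta> u)) / of_nat (card V)"
    unfolding expected_query_cost_def
    by (subst expected_cost_lossless)
       (use V in \<open>simp_all add: lossless_prsim_query nn_integral_bind_spmf nn_integral_spmf_of_set\<close>)
  also have "\<dots> \<le> (\<Sum>u\<in>V. 1 + of_nat ?N * (\<integral>\<^sup>+ r. of_nat (sample_cost r) \<partial>measure_spmf (prsim_sample c G H u)) + 2 * ?T u) / of_nat (card V)"
    by (intro divide_right_mono_ennreal sum_mono nn_integral_query_cost f)
  also have "\<dots> = (of_nat (card V) + of_nat ?N * (\<Sum>u\<in>V. \<integral>\<^sup>+ r. of_nat (sample_cost r) \<partial>measure_spmf (prsim_sample c G H u))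
      + 2 * (\<Sum>u\<in>V. ?T u)) / of_nat (card V)"
    by (simp add: sum.distrib sum_distrib_left)
  also have "\<dots> \<le> (ennreal ?n + ennreal (real ?N) * ennreal (?n * ?A) + ennreal 2 * ennreal (?n * ?B)) / of_nat (card V)"
    by (intro divide_right_mono_ennreal add_mono mult_mono sum_sample_cost sum_read_cost H)
       (simp_all add: num_nodes_def ennreal_of_nat_eq_real_of_nat)
  also have "ennreal ?n + ennreal (real ?N) * ennreal (?n * ?A) + ennreal 2 * ennreal (?n * ?B)
      = ennreal (?n * (1 + real ?N * ?A + 2 * ?B))"
  proof -
    have "ennreal (?n * (1 + real ?N * a + 2 * b)) = ennreal ?n + ennreal (real ?N) * ennreal (?n * a) + ennreal 2 * ennreal (?n * b)"
      if "0 \<le> a" "0 \<le> b" for a b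
    proof -
      have "ennreal (?n * (1 + real ?N * a + 2 * b)) = ennreal (?n + real ?N * (?n * a) + 2 * (?n * b))"
        by (simp add: algebra_simps)
      also have "\<dots> = ennreal ?n + ennreal (real ?N) * ennreal (?n * a) + ennreal 2 * ennreal (?n * b)"
        using that by (simp only: ennreal_plus ennreal_mult add_nonneg_nonneg mult_nonneg_nonneg of_nat_0_le_iff zero_le_numeral)
      finally show ?thesis .
    qed
    from this[OF A B] show ?thesis ..
  qed
  also have "\<dots> / of_nat (card V) = ennreal (1 + real ?N * ?A + 2 * ?B)"
  proof -
    have "ennreal (?n * x) / of_nat (card V) = ennreal x" if "0 \<le> x" for x
    proof -
      have "of_nat (card V) = ennreal ?n" by (simp add: num_nodes_def ennreal_of_nat_eq_real_of_nat)
      moreover have "0 \<le> ?n * x" using that by simp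
      ultimately show ?thesis using n by (simp only: divide_ennreal) simp
    qed
    moreover have "0 \<le> 1 + real ?N * a + 2 * b" if "0 \<le> a" "0 \<le> b" for a b
      using that by simp
    ultimately show ?thesis using A B by blast
  qed
  finally show ?thesis .
qed

end


section \<open>Power-law graphs\<close>

locale power_law_graph = prsim_graph +
  fixes \<gamma> :: real and w :: "nat \<Rightarrow> 'a"
  assumes gamma: "1 \<le> \<gamma>" and order: "pagerank_order c G w" and power_law: "power_law c G \<gamma> w"
    and two_le_num_nodes: "2 \<le> num_nodes G"
begin

section \<open>Ranks, normalization and average degree\<close>

abbreviation "n \<equiv> real (num_nodes G)"
abbreviation "m \<equiv> real (num_edges G)"
abbreviation "d \<equiv> avg_deg G"
abbreviation "e \<equiv> 1 / \<gamma>"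

lemma exponent: "0 < e" "e \<le> 1" "\<gamma> > 1 \<Longrightarrow> e < 1"
  using gamma by simp_all

lemma n_ge_2: "2 \<le> n" using two_le_num_nodes by simp

lemma bij: "bij_betw w {1..num_nodes G} V"
  using order by (simp add: pagerank_order_def)

lemma rank_image: "inj_on w {1..num_nodes G}" "w ` {1..num_nodes G} = V"
  using bij by (simp_all add: bij_betw_def)

lemma hub_subset: "hub_nodes G w j0 \<subseteq> V"
  unfolding hub_nodes_def rank_image(2)[symmetric] by (rule image_mono) auto

lemma sum_hub: "(\<Sum>v\<in>hub_nodes G w j0. f v) = (\<Sum>j\<in>{j \<in> {1..num_nodes G}. real j \<le> j0}. f (w j))"
  unfolding hub_nodes_def
  by (subst sum.reindex) (auto intro: inj_on_subset[OF rank_image(1)])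

lemma sum_nonhub: "(\<Sum>v\<in>V - hub_nodes G w j0. f v) = (\<Sum>j\<in>{j \<in> {1..num_nodes G}. real j > j0}. f (w j))"
proof -
  have "V - hub_nodes G w j0 = w ` ({1..num_nodes G} - {j \<in> {1..num_nodes G}. real j \<le> j0})"
    unfolding hub_nodes_def rank_image(2)[symmetric]
    by (rule inj_on_image_set_diff[OF rank_image(1), symmetric]) auto
  also have "{1..num_nodes G} - {j \<in> {1..num_nodes G}. real j \<le> j0} = {j \<in> {1..num_nodes G}. real j > j0}"
    by auto
  finally have eq: "V - hub_nodes G w j0 = w ` {j \<in> {1..num_nodes G}. real j > j0}" .
  show ?thesis unfolding eq
    by (subst sum.reindex) (auto intro: inj_on_subset[OF rank_image(1)])
qed

text \<open>\<open>\<kappa> \<le> 1\<close> holds because every summand of the normalizing sum is at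
  least the last one, which is \<open>1 / n\<close>. The upper bounds below replace \<kappa> by
  1.\<close>

lemma power_law_rpr:
  obtains \<kappa> where "0 < \<kappa>" "\<kappa> \<le> 1"
    "\<And>j. j \<in> {1..num_nodes G} \<Longrightarrow> rpr (w j) = \<kappa> * (real j powr - e * n powr (e - 1))"
    "(\<Sum>j\<in>{1..num_nodes G}. rpr (w j)) = 1"
proof -
  from power_law obtain \<kappa> where
    1: "\<kappa> * (\<Sum>j = 1..num_nodes G. real j powr (- 1 / \<gamma>) / n powr (1 - 1 / \<gamma>)) = 1" and
    2: "\<And>j. j \<in> {1..num_nodes G} \<Longrightarrow> rpr (w j) = \<kappa> * real j powr (- 1 / \<gamma>) / n powr (1 - 1 / \<gamma>)"
    unfolding power_law_def Let_def by blast
  have conv: "real j powr (- 1 / \<gamma>) / n powr (1 - 1 / \<gamma>) = real j powr - e * n powr (e - 1)" for j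
  proof -
    have "n powr (e - 1) = inverse (n powr (1 - e))" by (simp add: powr_minus[symmetric])
    then show ?thesis by (simp add: divide_inverse)
  qed
  define S where "S = (\<Sum>j = 1..num_nodes G. real j powr - e * n powr (e - 1))"
  have \<kappa>: "\<kappa> * S = 1" using 1 unfolding S_def conv .
  have "1 = (\<Sum>j = 1..num_nodes G. n powr - e * n powr (e - 1))"
  proof -
    have "n powr - e * n powr (e - 1) = n powr (- 1)" by (subst powr_add[symmetric]) simp
    then show ?thesis using n_ge_2 by (simp add: powr_minus)
  qed
  also have "\<dots> \<le> S"
    unfolding S_def using exponent by (intro sum_mono mult_right_mono powr_mono2') simp_all
  finally have S: "1 \<le> S" .
  have "\<kappa> = 1 / S" using \<kappa> S by (simp add: field_simps)
  with S have k: "0 < \<kappa>" "\<kappa> \<le> 1" by simp_all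
  have r: "rpr (w j) = \<kappa> * (real j powr - e * n powr (e - 1))" if "j \<in> {1..num_nodes G}" for j
    using 2[OF that] by (simp only: times_divide_eq_right[symmetric] conv)
  have "(\<Sum>j\<in>{1..num_nodes G}. rpr (w j)) = \<kappa> * S" unfolding S_def by (simp add: r sum_distrib_left)
  with \<kappa> that[OF k r] show ?thesis by simp
qed

lemma rpr_le:
  assumes "j \<in> {1..num_nodes G}" shows "rpr (w j) \<le> real j powr - e * n powr (e - 1)"
proof -
  obtain \<kappa> where k: "0 < \<kappa>" "\<kappa> \<le> 1" "rpr (w j) = \<kappa> * (real j powr - e * n powr (e - 1))"
    using power_law_rpr assms by metis
  have "\<kappa> * (real j powr - e * n powr (e - 1)) \<le> 1 * (real j powr - e * n powr (e - 1))"
    using k by (intro mult_right_mono) simp_all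
  with k(3) show ?thesis by simp
qed

lemma sum_rpr: "(\<Sum>v\<in>V. rpr v) = 1"
  using power_law_rpr sum.reindex_bij_betw[OF bij, of rpr] by metis

text \<open>The power \<open>- \<gamma>\<close> undoes the exponent \<open>- 1 / \<gamma>\<close>,
  so the value determines the rank.\<close>

lemma inj_rpr: "inj_on rpr V"
proof -
  obtain \<kappa> where k: "0 < \<kappa>"
    "\<And>j. j \<in> {1..num_nodes G} \<Longrightarrow> rpr (w j) = \<kappa> * (real j powr - e * n powr (e - 1))"
    using power_law_rpr by metis
  have "inj_on (rpr \<circ> w) {1..num_nodes G}"
  proof (rule inj_onI)
    fix i j assume ij: "i \<in> {1..num_nodes G}" "j \<in> {1..num_nodes G}" "(rpr \<circ> w) i = (rpr \<circ> w) j"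
    then have "real i powr - e = real j powr - e" using k n_ge_2 by simp
    then have "(real i powr - e) powr (- \<gamma>) = (real j powr - e) powr (- \<gamma>)" by simp
    then show "i = j" using gamma ij by (simp add: powr_powr)
  qed
  then have "inj_on rpr (w ` {1..num_nodes G})" by (rule inj_on_imageI)
  then show ?thesis by (simp only: rank_image)
qed

lemma n_le: "n \<le> 3 * m"
  using num_nodes_le[OF inj_rpr two_le_num_nodes] by linarith

lemma m_eq: "m = n * d"
  using n_ge_2 by (simp add: avg_deg_def)

text \<open>The lower bound is \<open>n_le\<close>, the upper one the absence of parallel arcs. Both
  feed the absorption of the logarithm.\<close>

lemma d_bounds: "1 / 3 \<le> d" "d \<le> n"
proof -
  show "1 / 3 \<le> d" using n_le n_ge_2 by (simp add: avg_deg_def field_simps)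
  have "m \<le> n\<^sup>2" using num_edges_le by (metis of_nat_le_iff of_nat_power)
  then show "d \<le> n" using n_ge_2 by (simp add: avg_deg_def divide_le_eq power2_eq_square)
qed

lemma d_pos: "0 < d" using d_bounds by linarith

text \<open>The origin of the number of hubs: the sum over the first \<open>j0\<close> ranks grows
  like \<open>j0 powr (1 - 1 / \<gamma>)\<close>, and the exponent
  \<open>\<gamma> / (\<gamma> - 1)\<close> inverts this so that exactly one factor
  \<open>\<epsilon> * d\<close> appears. Dividing by \<rho> then leaves \<open>O(m)\<close>.\<close>

lemma hub_mass_le:
  assumes g: "1 < \<gamma>" and j0: "j0 = n * (\<epsilon> * d) powr (\<gamma> / (\<gamma> - 1))"
  shows "(\<Sum>v\<in>hub_nodes G w j0. n * rpr v) \<le> \<epsilon> * m / (1 - e)"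
proof -
  have ed: "0 < \<epsilon> * d" using eps_pos d_pos by simp
  have "(\<Sum>v\<in>hub_nodes G w j0. n * rpr v) \<le> (\<Sum>j\<in>{j \<in> {1..num_nodes G}. real j \<le> j0}. n * (real j powr - e * n powr (e - 1)))"
    unfolding sum_hub by (intro sum_mono mult_left_mono rpr_le) auto
  also have "\<dots> = n * n powr (e - 1) * (\<Sum>j\<in>{j \<in> {1..num_nodes G}. real j \<le> j0}. real j powr - e)"
    by (simp add: sum_distrib_left mult_ac)
  also have "\<dots> \<le> n * n powr (e - 1) * (j0 powr (1 - e) / (1 - e))"
    using exponent g j0 by (intro mult_left_mono sum_powr_upto_le) simp_all
  also have "j0 powr (1 - e) = n powr (1 - e) * (\<epsilon> * d)"
  proof -
    have 1: "\<gamma> / (\<gamma> - 1) * (1 - e) = 1" using g by (simp add: field_simps)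
    have 2: "j0 powr (1 - e) = n powr (1 - e) * (\<epsilon> * d) powr (\<gamma> / (\<gamma> - 1) * (1 - e))"
      unfolding j0 by (simp only: powr_mult powr_powr)
    have "(\<epsilon> * d) powr 1 = \<epsilon> * d" using ed by (simp only: powr_one less_imp_le)
    from 2[unfolded 1 this] show ?thesis .
  qed
  also have "n * n powr (e - 1) * (n powr (1 - e) * (\<epsilon> * d) / (1 - e)) = (n powr (e - 1) * n powr (1 - e)) * (\<epsilon> * (n * d)) / (1 - e)"
    by simp
  also have "n powr (e - 1) * n powr (1 - e) = 1" using n_ge_2 by (simp add: powr_add[symmetric])
  finally show ?thesis by (simp add: m_eq)
qed

text \<open>For \<open>\<gamma> = 1\<close> the formula for \<open>j0\<close> has no meaning, so
  \<open>j0\<close> is arbitrary there; even if all nodes are hubs,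
  \<open>1 / d \<le> \<epsilon>\<close> gives \<open>n \<le> \<epsilon> * m\<close>.\<close>

lemma index_bound:
  assumes "\<gamma> \<noteq> 1 \<Longrightarrow> j0 = n * (\<epsilon> * d) powr (\<gamma> / (\<gamma> - 1))" and "\<gamma> = 1 \<Longrightarrow> 1 / d \<le> \<epsilon>"
  shows "finite (index_tuples c G (hub_nodes G w j0) \<epsilon>)"
    and "real (card (index_tuples c G (hub_nodes G w j0) \<epsilon>)) \<le> 12 / \<beta>\<^sup>2 * (if \<gamma> = 1 then 1 else 1 / (1 - e)) * m"
proof -
  show "finite (index_tuples c G (hub_nodes G w j0) \<epsilon>)" by (rule index_tuples_bound(1)[OF hub_subset])
  have "(\<Sum>v\<in>hub_nodes G w j0. n * rpr v) \<le> \<epsilon> * m * (if \<gamma> = 1 then 1 else 1 / (1 - e))"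
  proof (cases "\<gamma> = 1")
    case True
    have "(\<Sum>v\<in>hub_nodes G w j0. n * rpr v) \<le> (\<Sum>v\<in>V. n * rpr v)"
      using hub_subset by (intro sum_mono2) (simp_all add: rpr_nonneg)
    also have "\<dots> = n" by (simp add: sum_distrib_left[symmetric] sum_rpr)
    also have "\<dots> \<le> \<epsilon> * m"
      using assms(2)[OF True] d_pos n_ge_2 unfolding m_eq by (simp add: field_simps)
    finally show ?thesis using True by simp
  next
    case False
    then show ?thesis using hub_mass_le[OF _ assms(1)] gamma by simp
  qed
  then have "(\<Sum>v\<in>hub_nodes G w j0. n * rpr v) / \<rho> \<le> \<epsilon> * m * (if \<gamma> = 1 then 1 else 1 / (1 - e)) / \<rho>"
    using r_max_pos by (intro divide_right_mono) simp_all
  also have "\<dots> = 12 / \<beta>\<^sup>2 * (if \<gamma> = 1 then 1 else 1 / (1 - e)) * m"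
    using eps_pos by (simp add: r_max_def)
  finally show "real (card (index_tuples c G (hub_nodes G w j0) \<epsilon>)) \<le> \<dots>"
    using index_tuples_bound(2)[OF hub_subset] by (rule order_trans[rotated])
qed

lemma preprocessing_bound:
  "preprocessing_cost c G (hub_nodes G w j0) \<epsilon> \<le> ennreal (128 / \<beta>^3 * (m / \<epsilon>))"
proof -
  have "preprocessing_cost c G (hub_nodes G w j0) \<epsilon> \<le> ennreal (32 / \<beta>^3 * ((n + m) / \<epsilon>))"
    by (rule preprocessing_cost_le[OF hub_subset])
  also have "\<dots> \<le> ennreal (32 / \<beta>^3 * (4 * m / \<epsilon>))"
    using n_le eps_pos beta by (intro ennreal_leI mult_left_mono divide_right_mono) simp_all
  finally show ?thesis by simp
qed

section \<open>The sums over hubs and over the other nodes\<close>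

definition tail_cost :: "real \<Rightarrow> real" where
  "tail_cost j0 = (\<Sum>v\<in>V - hub_nodes G w j0. n * (rpr v)\<^sup>2)"

definition hub_cost :: "real \<Rightarrow> real" where
  "hub_cost j0 = (\<Sum>v\<in>hub_nodes G w j0. n * rpr v / \<rho> * min 1 (c1 c / \<epsilon> * rpr v))"

text \<open>Majorant of \<open>n\<close> times the sum of all squared reverse PageRanks, with
  \<kappa> replaced by 1. The three regimes are those of the sum of
  \<open>j powr - (2 / \<gamma>)\<close>: growing as a power of \<open>n\<close>, growing
  logarithmically, bounded.\<close>

definition square_sum :: real where
  "square_sum = n powr (2 * e - 1) * (\<Sum>j = 1..num_nodes G. real j powr - (2 * e))"

lemma rpr_square_le:
  assumes "j \<in> {1..num_nodes G}"
  shows "n * (rpr (w j))\<^sup>2 \<le> n powr (2 * e - 1) * real j powr - (2 * e)"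
proof -
  have "(rpr (w j))\<^sup>2 \<le> (real j powr - e * n powr (e - 1))\<^sup>2"
    by (intro power_mono rpr_le assms rpr_nonneg)
  also have "\<dots> = real j powr - (2 * e) * n powr (2 * (e - 1))"
  proof -
    have sq: "(x powr t)\<^sup>2 = x powr (2 * t)" for x t :: real
      by (simp add: power2_eq_square powr_add[symmetric])
    show ?thesis unfolding power_mult_distrib sq by (simp only: mult_minus_right)
  qed
  finally have "n * (rpr (w j))\<^sup>2 \<le> n * (real j powr - (2 * e) * n powr (2 * (e - 1)))"
    by (intro mult_left_mono) simp_all
  also have "\<dots> = (n powr 1 * n powr (2 * (e - 1))) * real j powr - (2 * e)" using n_ge_2 by simp
  also have "n powr 1 * n powr (2 * (e - 1)) = n powr (2 * e - 1)"
    by (simp only: powr_add[symmetric]) (simp add: algebra_simps)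
  finally show ?thesis .
qed

lemma tail_cost_le:
  "tail_cost j0 \<le> n powr (2 * e - 1) * (\<Sum>j\<in>{j \<in> {1..num_nodes G}. real j > j0}. real j powr - (2 * e))"
  unfolding tail_cost_def sum_nonhub sum_distrib_left by (intro sum_mono rpr_square_le) auto

lemma tail_cost_nonneg: "0 \<le> tail_cost j0"
  unfolding tail_cost_def by (intro sum_nonneg mult_nonneg_nonneg) simp_all

lemma tail_cost_le_square_sum: "tail_cost j0 \<le> square_sum"
proof -
  have "(\<Sum>j\<in>{j \<in> {1..num_nodes G}. real j > j0}. real j powr - (2 * e)) \<le> (\<Sum>j = 1..num_nodes G. real j powr - (2 * e))"
    by (rule sum_mono2) auto
  then have "n powr (2 * e - 1) * (\<Sum>j\<in>{j \<in> {1..num_nodes G}. real j > j0}. real j powr - (2 * e)) \<le> square_sum"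
    unfolding square_sum_def by (intro mult_left_mono) simp_all
  with tail_cost_le show ?thesis by (rule order_trans)
qed

text \<open>Here the Markov entry of the minimum is taken, which turns the hub sum into a sum of
  squares.\<close>

lemma hub_cost_le_square_sum: "hub_cost j0 \<le> 12 * c1 c / \<beta>\<^sup>2 * square_sum / \<epsilon>\<^sup>2"
proof -
  have r: "0 \<le> rpr v" for v by (rule rpr_nonneg)
  have "hub_cost j0 \<le> (\<Sum>v\<in>hub_nodes G w j0. c1 c / (\<epsilon> * \<rho>) * (n * (rpr v)\<^sup>2))"
    unfolding hub_cost_def
  proof (rule sum_mono)
    fix v
    have "n * rpr v / \<rho> * min 1 (c1 c / \<epsilon> * rpr v) \<le> n * rpr v / \<rho> * (c1 c / \<epsilon> * rpr v)"
      using r r_max_pos by (intro mult_left_mono) simp_all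
    then show "n * rpr v / \<rho> * min 1 (c1 c / \<epsilon> * rpr v) \<le> c1 c / (\<epsilon> * \<rho>) * (n * (rpr v)\<^sup>2)"
      by (simp add: power2_eq_square mult_ac)
  qed
  also have "\<dots> \<le> (\<Sum>v\<in>V. c1 c / (\<epsilon> * \<rho>) * (n * (rpr v)\<^sup>2))"
    using hub_subset c1_pos eps_pos r_max_pos by (intro sum_mono2) simp_all
  also have "\<dots> = (\<Sum>j = 1..num_nodes G. c1 c / (\<epsilon> * \<rho>) * (n * (rpr (w j))\<^sup>2))"
    by (rule sum.reindex_bij_betw[OF bij, symmetric])
  also have "\<dots> \<le> (\<Sum>j = 1..num_nodes G. c1 c / (\<epsilon> * \<rho>) * (n powr (2 * e - 1) * real j powr - (2 * e)))"
    using c1_pos eps_pos r_max_pos by (intro sum_mono mult_left_mono rpr_square_le) simp_all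
  also have "\<dots> = c1 c / (\<epsilon> * \<rho>) * square_sum"
    by (simp only: square_sum_def sum_distrib_left)
  also have "\<dots> = 12 * c1 c / \<beta>\<^sup>2 * square_sum / \<epsilon>\<^sup>2"
    by (simp add: r_max_def power2_eq_square mult_ac)
  finally show ?thesis .
qed

lemma square_sum_gt_2: "2 < \<gamma> \<Longrightarrow> square_sum \<le> 1 / (1 - 2 * e)"
proof -
  assume g: "2 < \<gamma>"
  then have e: "0 \<le> 2 * e" "2 * e < 1" by simp_all
  have "square_sum \<le> n powr (2 * e - 1) * (n powr (1 - 2 * e) / (1 - 2 * e))"
    unfolding square_sum_def by (intro mult_left_mono sum_powr_le e) simp
  also have "\<dots> = (n powr (2 * e - 1) * n powr (1 - 2 * e)) / (1 - 2 * e)" by simp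
  also have "n powr (2 * e - 1) * n powr (1 - 2 * e) = 1" using n_ge_2 by (simp add: powr_add[symmetric])
  finally show ?thesis .
qed

lemma square_sum_2: "\<gamma> = 2 \<Longrightarrow> square_sum \<le> 1 + ln n"
  unfolding square_sum_def using sum_inverse_le[of "num_nodes G"] two_le_num_nodes n_ge_2 by simp

lemma square_sum_lt_2:
  assumes "1 < \<gamma>" "\<gamma> < 2"
  shows "square_sum \<le> 2 * e / (2 * e - 1) * (1 / 2) powr (1 - 2 * e) * n powr (2 * e - 1)"
proof -
  have e: "1 < 2 * e" using assms by simp
  \<comment> \<open>The cut at 1/2 lies below every rank, so the tail estimate bounds the full
    sum.\<close>
  have "{j \<in> {1..num_nodes G}. real j > 1 / 2} = {1..num_nodes G}" by auto
  with sum_powr_tail_le[OF e, of "1 / 2" "num_nodes G"]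
  have "(\<Sum>j = 1..num_nodes G. real j powr - (2 * e)) \<le> 2 * e / (2 * e - 1) * (1 / 2) powr (1 - 2 * e)" by simp
  then have "square_sum \<le> n powr (2 * e - 1) * (2 * e / (2 * e - 1) * (1 / 2) powr (1 - 2 * e))"
    unfolding square_sum_def by (intro mult_left_mono) simp_all
  then show ?thesis by (simp add: mult_ac)
qed

text \<open>For \<open>2 / \<gamma> > 1\<close> the tail beyond \<open>j0\<close> is governed by its
  first terms, and inserting \<open>j0\<close> cancels all powers of \<open>n\<close>.\<close>

lemma tail_cost_lt_2:
  assumes g: "1 < \<gamma>" "\<gamma> < 2" and j0: "j0 = n * (\<epsilon> * d) powr (\<gamma> / (\<gamma> - 1))"
  shows "tail_cost j0 \<le> 2 * e / (2 * e - 1) * (\<epsilon> * d) powr - ((2 - \<gamma>) / (\<gamma> - 1))"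
proof -
  have e: "1 < 2 * e" using g by simp
  have ed: "0 < \<epsilon> * d" using eps_pos d_pos by simp
  have "0 < (\<epsilon> * d) powr x" for x using ed unfolding powr_gt_zero by linarith
  then have "0 < j0" unfolding j0 using n_ge_2 by (intro mult_pos_pos) linarith+
  have "tail_cost j0 \<le> n powr (2 * e - 1) * (2 * e / (2 * e - 1) * j0 powr (1 - 2 * e))"
    by (rule order_trans[OF tail_cost_le], intro mult_left_mono sum_powr_tail_le e \<open>0 < j0\<close>) simp
  also have "j0 powr (1 - 2 * e) = n powr (1 - 2 * e) * (\<epsilon> * d) powr - ((2 - \<gamma>) / (\<gamma> - 1))"
  proof -
    have "\<gamma> / (\<gamma> - 1) * (1 - 2 * e) = - ((2 - \<gamma>) / (\<gamma> - 1))" using g by (simp add: field_simps)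
    then show ?thesis using ed n_ge_2 unfolding j0 by (simp only: powr_mult powr_powr)
  qed
  also have "n powr (2 * e - 1) * (2 * e / (2 * e - 1) * (n powr (1 - 2 * e) * (\<epsilon> * d) powr - ((2 - \<gamma>) / (\<gamma> - 1))))
      = (n powr (2 * e - 1) * n powr (1 - 2 * e)) * (2 * e / (2 * e - 1) * (\<epsilon> * d) powr - ((2 - \<gamma>) / (\<gamma> - 1)))" by simp
  also have "n powr (2 * e - 1) * n powr (1 - 2 * e) = 1" using n_ge_2 by (simp add: powr_add[symmetric])
  finally show ?thesis by simp
qed

lemma c1_ge_1: "1 \<le> c1 c"
proof -
  have "\<beta>\<^sup>2 \<le> 1" using beta by (intro power_le_one) simp_all
  then show ?thesis unfolding c1_def using beta by (simp add: field_simps)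
qed

text \<open>Interpolating between the two bounds on the probability of selecting a pair: with the exponent
  \<open>1 - 1/\<gamma>\<close> the sum over the hubs no longer depends on \<open>j\<^sub>0\<close>.\<close>

lemma hub_cost_le_interpolated:
  assumes g: "1 < \<gamma>"
  shows "hub_cost j0 \<le> 12 * c1 c / (\<beta>\<^sup>2 * (1 - e)\<^sup>2) * (n * \<epsilon>) powr e / \<epsilon>\<^sup>2"
proof -
  \<comment> \<open>With \<open>\<theta> = 1 - e\<close> the exponent of the rank becomes
    \<open>s = (1 - \<theta>) * (1 + \<theta>)\<close>, below 1, so the sum over all ranks is
    dominated by its upper end.\<close>
  define \<theta> where "\<theta> = 1 - e"
  have \<theta>: "0 < \<theta>" "\<theta> < 1" unfolding \<theta>_def using exponent g by simp_all
  define s where "s = e * (1 + \<theta>)"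
  have s: "0 \<le> s" "s < 1" "1 - s = \<theta>\<^sup>2"
  proof -
    show "1 - s = \<theta>\<^sup>2" unfolding s_def \<theta>_def by (simp add: power2_eq_square algebra_simps)
    then show "s < 1" using \<theta> by (metis diff_gt_0_iff_gt zero_less_power)
    show "0 \<le> s" unfolding s_def using exponent \<theta> by simp
  qed
  have summand: "n * rpr (w j) / \<rho> * min 1 (c1 c / \<epsilon> * rpr (w j))
      \<le> c1 c / \<rho> * \<epsilon> powr - \<theta> * (n * n powr ((e - 1) * (1 + \<theta>))) * real j powr - s"
    if j: "j \<in> {1..num_nodes G}" for j
  proof -
    define P where "P = real j powr - e * n powr (e - 1)"
    have P: "rpr (w j) \<le> P" unfolding P_def by (rule rpr_le[OF j])
    have r: "0 \<le> rpr (w j)" by (rule rpr_nonneg)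
    have "min 1 (c1 c / \<epsilon> * rpr (w j)) \<le> min 1 (c1 c / \<epsilon> * P)"
      using P c1_pos eps_pos by (intro min.mono mult_left_mono) simp_all
    also have "\<dots> \<le> (c1 c / \<epsilon> * P) powr \<theta>"
      using c1_pos eps_pos \<theta> r P by (intro min_one_le_powr mult_nonneg_nonneg) simp_all
    also have "\<dots> = c1 c powr \<theta> * \<epsilon> powr - \<theta> * P powr \<theta>"
      by (simp add: powr_mult powr_divide powr_minus_divide)
    also have "\<dots> \<le> c1 c powr 1 * \<epsilon> powr - \<theta> * P powr \<theta>"
      using c1_ge_1 \<theta> by (intro mult_right_mono powr_mono) simp_all
    finally have 1: "min 1 (c1 c / \<epsilon> * rpr (w j)) \<le> c1 c * \<epsilon> powr - \<theta> * P powr \<theta>" using c1_pos by simp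
    have "n * rpr (w j) / \<rho> * min 1 (c1 c / \<epsilon> * rpr (w j)) \<le> n * P / \<rho> * (c1 c * \<epsilon> powr - \<theta> * P powr \<theta>)"
      using 1 P r r_max_pos c1_pos eps_pos
      by (intro mult_mono divide_right_mono mult_left_mono) (simp_all add: min_def)
    also have "\<dots> = c1 c / \<rho> * \<epsilon> powr - \<theta> * n * (P * P powr \<theta>)" by simp
    also have "P * P powr \<theta> = P powr (1 + \<theta>)" unfolding P_def by (simp add: powr_add)
    also have "\<dots> = real j powr - s * n powr ((e - 1) * (1 + \<theta>))"
    proof -
      have "- e * (1 + \<theta>) = - s" by (simp add: s_def)
      then show ?thesis unfolding P_def by (simp only: powr_mult powr_powr)
    qed
    finally show ?thesis by (simp add: mult_ac)
  qed
  define Q where "Q = c1 c / \<rho> * \<epsilon> powr - \<theta> * (n * n powr ((e - 1) * (1 + \<theta>)))"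
  have Q: "0 \<le> Q" unfolding Q_def using c1_pos r_max_pos by simp
  have "hub_cost j0 \<le> (\<Sum>j\<in>{j \<in> {1..num_nodes G}. real j \<le> j0}. Q * real j powr - s)"
    unfolding hub_cost_def sum_hub Q_def by (intro sum_mono summand) simp
  also have "\<dots> \<le> (\<Sum>j = 1..num_nodes G. Q * real j powr - s)"
    using Q by (intro sum_mono2) auto
  also have "\<dots> = Q * (\<Sum>j = 1..num_nodes G. real j powr - s)" by (simp only: sum_distrib_left)
  also have "\<dots> \<le> Q * (n powr (1 - s) / (1 - s))"
    using Q s by (intro mult_left_mono sum_powr_le) simp_all
  also have "\<dots> = c1 c / \<rho> * \<epsilon> powr - \<theta> * (n powr 1 * n powr ((e - 1) * (1 + \<theta>)) * n powr (1 - s)) / \<theta>\<^sup>2"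
    unfolding Q_def s(3) using n_ge_2 by simp
  \<comment> \<open>The exponents add up to \<open>1 - \<theta> * (1 + \<theta>) + \<theta>\<^sup>2
    = 1 - \<theta>\<close>.\<close>
  also have "n powr 1 * n powr ((e - 1) * (1 + \<theta>)) * n powr (1 - s) = n powr e"
    unfolding powr_add[symmetric] s_def \<theta>_def by (simp add: algebra_simps)
  also have "c1 c / \<rho> * \<epsilon> powr - \<theta> * n powr e / \<theta>\<^sup>2 = 12 * c1 c / (\<beta>\<^sup>2 * \<theta>\<^sup>2) * (\<epsilon> powr - \<theta> / \<epsilon> * n powr e)"
    unfolding r_max_def by (simp add: mult_ac)
  also have "\<epsilon> powr - \<theta> / \<epsilon> = \<epsilon> powr e / \<epsilon>\<^sup>2"
  proof -
    have "\<epsilon> powr - \<theta> = \<epsilon> powr e / \<epsilon> powr 1" unfolding \<theta>_def powr_diff[symmetric] by simp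
    then show ?thesis using eps_pos by (simp add: power2_eq_square)
  qed
  also have "12 * c1 c / (\<beta>\<^sup>2 * \<theta>\<^sup>2) * (\<epsilon> powr e / \<epsilon>\<^sup>2 * n powr e) = 12 * c1 c / (\<beta>\<^sup>2 * \<theta>\<^sup>2) * (n * \<epsilon>) powr e / \<epsilon>\<^sup>2"
    by (simp add: powr_mult mult_ac)
  finally show ?thesis unfolding \<theta>_def .
qed

lemma query_cost_bound:
  assumes f: "f_r G \<delta> > 0"
  shows "expected_query_cost c G (hub_nodes G w j0) \<epsilon> \<delta>
    \<le> ennreal (1 + real (n_r c G \<epsilon> \<delta>) * (4 / \<beta>\<^sup>2 + 3 + 7 / \<beta> * tail_cost j0) + 2 * hub_cost j0)"
proof -
  have "V \<noteq> {}" using two_le_num_nodes by (auto simp: num_nodes_def)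
  from expected_query_cost_le[OF hub_subset f this] show ?thesis
    unfolding tail_cost_def hub_cost_def .
qed

section \<open>Query cost in the three regimes\<close>

lemma inverse_eps_ge_1: "1 \<le> 1 / \<epsilon>\<^sup>2"
  using eps_pos eps_less_1 by (simp add: power_le_one)

lemma ln_n_ge: "1 \<le> 2 * ln n"
proof -
  have "ln 2 \<le> ln n" using n_ge_2 by simp
  then show ?thesis using ln2_ge_two_thirds by linarith
qed

lemma ln_n_delta_ge:
  assumes "0 < \<delta>" "\<delta> < 1"
  shows "1 \<le> 2 * ln (n / \<delta>)" "f_r G \<delta> > 0" "ln n \<le> ln (n / \<delta>)"
proof -
  have "n * \<delta> \<le> n * 1" using assms by (intro mult_left_mono) simp_all
  then have "n \<le> n / \<delta>" using assms by (simp add: pos_le_divide_eq)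
  then show 1: "ln n \<le> ln (n / \<delta>)" using n_ge_2 by simp
  then show 2: "1 \<le> 2 * ln (n / \<delta>)" using ln_n_ge by linarith
  then show "f_r G \<delta> > 0" unfolding f_r_def by simp
qed

text \<open>The factor 10 = 2 * 5 absorbs the two ceilings:
  \<open>c1 c / \<epsilon>\<^sup>2 \<ge> 1\<close> doubles the first factor, and
  \<open>1 \<le> 2 * ln (n / \<delta>)\<close> turns 3 into 5 in the second.\<close>

lemma n_r_le:
  assumes "0 < \<delta>" "\<delta> < 1"
  shows "real (n_r c G \<epsilon> \<delta>) \<le> 10 * c1 c * (1 / \<epsilon>\<^sup>2 * ln (n / \<delta>))"
proof -
  note l = ln_n_delta_ge[OF assms]
  have c: "1 \<le> c1 c * (1 / \<epsilon>\<^sup>2)" using mult_mono[OF c1_ge_1 inverse_eps_ge_1] c1_pos by simp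
  have "real (d_r c \<epsilon>) \<le> 2 * (c1 c * (1 / \<epsilon>\<^sup>2))" unfolding d_r_def using c by (simp, linarith)
  moreover have "real (f_r G \<delta>) \<le> 5 * ln (n / \<delta>)" unfolding f_r_def using l by (simp, linarith)
  ultimately have "real (d_r c \<epsilon>) * real (f_r G \<delta>) \<le> 2 * (c1 c * (1 / \<epsilon>\<^sup>2)) * (5 * ln (n / \<delta>))"
    using c l by (intro mult_mono) simp_all
  then show ?thesis by (simp add: n_r_def mult_ac)
qed

definition walk_const :: real where "walk_const = 4 / \<beta>\<^sup>2 + 3"
definition tail_const :: real where "tail_const = 7 / \<beta>"

lemma const_nonneg: "0 \<le> walk_const" "0 \<le> tail_const"
  unfolding walk_const_def tail_const_def using beta by simp_all

text \<open>\<open>square_sum\<close> is bounded, so the cost is of the order of the number of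
  samples. The 48 collects the 2 from reading and reporting, the 12 in \<open>r_max\<close> and the
  2 in \<open>1 / \<epsilon>\<^sup>2 \<le> 2 * D\<close>.\<close>

lemma query_bound_gt_2:
  assumes g: "2 < \<gamma>" and \<delta>: "0 < \<delta>" "\<delta> < 1"
  shows "expected_query_cost c G (hub_nodes G w j0) \<epsilon> \<delta>
    \<le> ennreal ((2 + 10 * c1 c * (walk_const + tail_const * (1 / (1 - 2 * e))) + 48 * c1 c / \<beta>\<^sup>2 * (1 / (1 - 2 * e)))
         * (1 / \<epsilon>\<^sup>2 * ln (n / \<delta>)))"
proof -
  define D where "D = 1 / \<epsilon>\<^sup>2 * ln (n / \<delta>)"
  define s where "s = 1 / (1 - 2 * e)"
  note l = ln_n_delta_ge[OF \<delta>]
  have s: "0 \<le> s" unfolding s_def using g by simp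
  have eD: "1 / \<epsilon>\<^sup>2 \<le> 2 * D"
    using mult_left_mono[OF l(1), of "1 / \<epsilon>\<^sup>2"] unfolding D_def by simp
  then have D: "1 \<le> 2 * D" using inverse_eps_ge_1 by linarith
  have T: "tail_cost j0 \<le> s" using tail_cost_le_square_sum square_sum_gt_2[OF g] unfolding s_def by (rule order_trans)
  have "hub_cost j0 \<le> 12 * c1 c / \<beta>\<^sup>2 * square_sum / \<epsilon>\<^sup>2" by (rule hub_cost_le_square_sum)
  also have "\<dots> \<le> 12 * c1 c / \<beta>\<^sup>2 * s / \<epsilon>\<^sup>2"
    using square_sum_gt_2[OF g] c1_pos unfolding s_def by (intro divide_right_mono mult_left_mono) simp_all
  also have "\<dots> = 12 * c1 c / \<beta>\<^sup>2 * s * (1 / \<epsilon>\<^sup>2)" by simp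
  also have "\<dots> \<le> 12 * c1 c / \<beta>\<^sup>2 * s * (2 * D)"
    using s c1_pos eD by (intro mult_left_mono) simp_all
  finally have B: "hub_cost j0 \<le> 12 * c1 c / \<beta>\<^sup>2 * s * (2 * D)" .
  have "real (n_r c G \<epsilon> \<delta>) * (walk_const + tail_const * tail_cost j0) \<le> 10 * c1 c * D * (walk_const + tail_const * s)"
    using n_r_le[OF \<delta>] T const_nonneg c1_pos D tail_cost_nonneg unfolding D_def[symmetric]
    by (intro mult_mono add_mono mult_left_mono add_nonneg_nonneg mult_nonneg_nonneg) simp_all
  then have "1 + real (n_r c G \<epsilon> \<delta>) * (walk_const + tail_const * tail_cost j0) + 2 * hub_cost j0
      \<le> 2 * D + 10 * c1 c * D * (walk_const + tail_const * s) + 2 * (12 * c1 c / \<beta>\<^sup>2 * s * (2 * D))"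
    using D B by linarith
  also have "\<dots> = (2 + 10 * c1 c * (walk_const + tail_const * s) + 48 * c1 c / \<beta>\<^sup>2 * s) * D"
    by (simp add: algebra_simps)
  finally show ?thesis
    using query_cost_bound[OF l(2), of j0] unfolding walk_const_def[symmetric] tail_const_def[symmetric] D_def[symmetric] s_def[symmetric]
    by (meson ennreal_leI order_trans)
qed

text \<open>As for larger exponents, but with \<open>square_sum \<le> 1 + L \<le> 3 * L\<close>;
  hence 144 = 3 * 48.\<close>

lemma query_bound_2:
  assumes g: "\<gamma> = 2" and \<delta>: "0 < \<delta>" "\<delta> < 1"
  shows "expected_query_cost c G (hub_nodes G w j0) \<epsilon> \<delta>
    \<le> ennreal ((4 + 10 * c1 c * (2 * walk_const + 3 * tail_const) + 144 * c1 c / \<beta>\<^sup>2) * (1 / \<epsilon>\<^sup>2 * ln (n / \<delta>) * ln n))"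
proof -
  define L where "L = ln n"
  define D where "D = 1 / \<epsilon>\<^sup>2 * ln (n / \<delta>)"
  note l = ln_n_delta_ge[OF \<delta>]
  have L: "1 \<le> 2 * L" unfolding L_def by (rule ln_n_ge)
  have eD: "1 / \<epsilon>\<^sup>2 \<le> 2 * D"
    using mult_left_mono[OF l(1), of "1 / \<epsilon>\<^sup>2"] unfolding D_def by simp
  then have D: "1 \<le> 2 * D" using inverse_eps_ge_1 by linarith
  have DL: "1 \<le> 4 * (D * L)" using mult_mono[OF D L] D L by simp
  have S: "square_sum \<le> 3 * L" using square_sum_2[OF g] L unfolding L_def by linarith
  have T: "tail_cost j0 \<le> 3 * L" using tail_cost_le_square_sum S by (rule order_trans)
  have "hub_cost j0 \<le> 12 * c1 c / \<beta>\<^sup>2 * square_sum / \<epsilon>\<^sup>2" by (rule hub_cost_le_square_sum)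
  also have "\<dots> \<le> 12 * c1 c / \<beta>\<^sup>2 * (3 * L) / \<epsilon>\<^sup>2"
    using S c1_pos by (intro divide_right_mono mult_left_mono) simp_all
  also have "\<dots> = 12 * c1 c / \<beta>\<^sup>2 * (3 * L) * (1 / \<epsilon>\<^sup>2)" by simp
  also have "\<dots> \<le> 12 * c1 c / \<beta>\<^sup>2 * (3 * L) * (2 * D)"
    using L c1_pos eD by (intro mult_left_mono) simp_all
  finally have B: "hub_cost j0 \<le> 12 * c1 c / \<beta>\<^sup>2 * (3 * L) * (2 * D)" .
  have "walk_const * 1 \<le> walk_const * (2 * L)" using const_nonneg L by (intro mult_left_mono) simp_all
  moreover have "tail_const * tail_cost j0 \<le> tail_const * (3 * L)" using const_nonneg T by (intro mult_left_mono) simp_all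
  ultimately have "walk_const + tail_const * tail_cost j0 \<le> (2 * walk_const + 3 * tail_const) * L" by (simp add: algebra_simps)
  then have "real (n_r c G \<epsilon> \<delta>) * (walk_const + tail_const * tail_cost j0) \<le> 10 * c1 c * D * ((2 * walk_const + 3 * tail_const) * L)"
    using n_r_le[OF \<delta>] const_nonneg c1_pos D tail_cost_nonneg unfolding D_def[symmetric]
    by (intro mult_mono add_nonneg_nonneg mult_nonneg_nonneg) simp_all
  then have "1 + real (n_r c G \<epsilon> \<delta>) * (walk_const + tail_const * tail_cost j0) + 2 * hub_cost j0
      \<le> 4 * (D * L) + 10 * c1 c * D * ((2 * walk_const + 3 * tail_const) * L) + 2 * (12 * c1 c / \<beta>\<^sup>2 * (3 * L) * (2 * D))"
    using DL B by linarith
  also have "\<dots> = (4 + 10 * c1 c * (2 * walk_const + 3 * tail_const) + 144 * c1 c / \<beta>\<^sup>2) * (D * L)"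
    by (simp add: algebra_simps)
  finally show ?thesis
    using query_cost_bound[OF l(2), of j0] unfolding walk_const_def[symmetric] tail_const_def[symmetric] D_def[symmetric] L_def[symmetric]
    by (meson ennreal_leI order_trans)
qed

text \<open>The assumptions on \<open>C\<close> are the conclusions of
  \<open>log_absorption\<close>: one handles the fixed cost of all samples, the other their backward
  walks. The hubs need neither.\<close>

lemma query_bound_lt_2:
  assumes g: "1 < \<gamma>" "\<gamma> < 2" and \<delta>: "1 / n powr a < \<delta>" "\<delta> < 1" and a: "0 < a"
    and j0: "j0 = n * (\<epsilon> * d) powr (\<gamma> / (\<gamma> - 1))"
    and C: "0 < C"
      "ln n \<le> C * min (n powr (2 / \<gamma> - 1)) ((n * \<epsilon>) powr (1 / \<gamma>))"
      "ln n * (\<epsilon> * d) powr (- ((2 - \<gamma>) / (\<gamma> - 1))) \<le> C * min (n powr (2 / \<gamma> - 1)) ((n * \<epsilon>) powr (1 / \<gamma>))"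
  shows "expected_query_cost c G (hub_nodes G w j0) \<epsilon> \<delta>
    \<le> ennreal ((2 * C + 10 * c1 c * (1 + a) * (walk_const * C + tail_const * (2 * e / (2 * e - 1)) * C)
         + 2 * (12 * c1 c / \<beta>\<^sup>2 * (2 * e / (2 * e - 1) * (1 / 2) powr (1 - 2 * e)) + 12 * c1 c / (\<beta>\<^sup>2 * (1 - e)\<^sup>2)))
       * min (n powr (1 / \<gamma>) / \<epsilon> powr (2 - 1 / \<gamma>)) (n powr (2 / \<gamma> - 1) / \<epsilon>\<^sup>2))"
proof -
  define L where "L = ln n"
  define Y where "Y = min (n powr (2 / \<gamma> - 1)) ((n * \<epsilon>) powr (1 / \<gamma>))"
  define C1 where "C1 = 2 * e / (2 * e - 1)"
  define k1 where "k1 = 12 * c1 c / \<beta>\<^sup>2 * (C1 * (1 / 2) powr (1 - 2 * e))"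
  define k2 where "k2 = 12 * c1 c / (\<beta>\<^sup>2 * (1 - e)\<^sup>2)"
  define T where "T = (\<epsilon> * d) powr (- ((2 - \<gamma>) / (\<gamma> - 1)))"
  define D where "D = Y / \<epsilon>\<^sup>2"
  have "0 < 1 / n powr a" using n_ge_2 by simp
  then have \<delta>0: "0 < \<delta>" using \<delta> by linarith
  note l = ln_n_delta_ge[OF \<delta>0 \<delta>(2)]
  have L: "1 \<le> 2 * L" unfolding L_def by (rule ln_n_ge)
  have e: "1 < 2 * e" using g by simp
  have C1: "0 \<le> C1" unfolding C1_def using e g by simp
  have k: "0 \<le> k1" "0 \<le> k2" unfolding k1_def k2_def using c1_pos C1 by simp_all
  have Y: "0 \<le> Y" unfolding Y_def by simp
  have D: "0 \<le> D" unfolding D_def using Y by simp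
  \<comment> \<open>With \<open>1 / \<epsilon>\<^sup>2\<close> factored out, the first entry of the
    minimum becomes \<open>(n * \<epsilon>) powr (1 / \<gamma>)\<close>, the form used in
    \<open>Y\<close>.\<close>
  have target: "min (n powr (1 / \<gamma>) / \<epsilon> powr (2 - 1 / \<gamma>)) (n powr (2 / \<gamma> - 1) / \<epsilon>\<^sup>2) = D"
  proof -
    have "n powr (1 / \<gamma>) / \<epsilon> powr (2 - 1 / \<gamma>) = (n * \<epsilon>) powr (1 / \<gamma>) / \<epsilon>\<^sup>2"
      using eps_pos by (simp add: powr_diff powr_mult)
    then show ?thesis unfolding D_def Y_def using eps_pos by (simp add: min_def divide_le_cancel)
  qed
  have LY: "L \<le> C * Y" and LTY: "L * T \<le> C * Y" using C(2,3) unfolding L_def Y_def T_def by simp_all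
  have "1 \<le> 2 * (C * Y)" using L LY by linarith
  then have "1 * 1 \<le> 2 * (C * Y) * (1 / \<epsilon>\<^sup>2)" using inverse_eps_ge_1 by (intro mult_mono) simp_all
  then have one: "1 \<le> 2 * C * D" unfolding D_def by simp
  \<comment> \<open>The polynomial lower bound on \<delta> makes the two logarithms
    comparable.\<close>
  have lnd: "ln (n / \<delta>) \<le> (1 + a) * L"
  proof -
    have "n / \<delta> \<le> n * n powr a"
    proof -
      have "1 \<le> \<delta> * n powr a" using \<delta>(1) n_ge_2 by (simp add: pos_divide_less_eq less_imp_le)
      then have "n * 1 \<le> n * (\<delta> * n powr a)" by (intro mult_left_mono) simp_all
      then show ?thesis using \<delta>0 by (simp add: pos_divide_le_eq mult_ac)
    qed
    then have "ln (n / \<delta>) \<le> ln (n * n powr a)" using n_ge_2 \<delta>0 by (intro ln_mono) simp_all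
    also have "\<dots> = (1 + a) * L" unfolding L_def using n_ge_2 by (simp add: ln_mult ln_powr distrib_right)
    finally show ?thesis .
  qed
  have "tail_cost j0 \<le> C1 * T" unfolding C1_def T_def by (rule tail_cost_lt_2[OF g j0])
  then have "real (n_r c G \<epsilon> \<delta>) * (walk_const + tail_const * tail_cost j0)
      \<le> 10 * c1 c * (1 / \<epsilon>\<^sup>2 * ((1 + a) * L)) * (walk_const + tail_const * (C1 * T))"
    using order_trans[OF n_r_le[OF \<delta>0 \<delta>(2)] mult_left_mono[OF mult_left_mono[OF lnd]], of]
      const_nonneg c1_pos C1 L a tail_cost_nonneg
    by (intro mult_mono add_mono mult_left_mono add_nonneg_nonneg mult_nonneg_nonneg) simp_all
  also have "\<dots> = 10 * c1 c * (1 + a) * (walk_const * L + tail_const * C1 * (L * T)) * (1 / \<epsilon>\<^sup>2)"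
    by (simp add: algebra_simps add_divide_distrib)
  also have "\<dots> \<le> 10 * c1 c * (1 + a) * (walk_const * (C * Y) + tail_const * C1 * (C * Y)) * (1 / \<epsilon>\<^sup>2)"
    using LY LTY const_nonneg C1 c1_pos a by (intro mult_right_mono mult_left_mono add_mono mult_nonneg_nonneg) simp_all
  also have "\<dots> = 10 * c1 c * (1 + a) * (walk_const * C + tail_const * C1 * C) * D"
    unfolding D_def by (simp add: algebra_simps)
  finally have S: "real (n_r c G \<epsilon> \<delta>) * (walk_const + tail_const * tail_cost j0) \<le> \<dots>" .
  \<comment> \<open>The same sum is bounded once by each entry of the minimum; the common constant
    \<open>k1 + k2\<close> then allows the minimum itself.\<close>
  have "hub_cost j0 \<le> k1 * (n powr (2 / \<gamma> - 1) / \<epsilon>\<^sup>2)"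
  proof -
    have "hub_cost j0 \<le> 12 * c1 c / \<beta>\<^sup>2 * square_sum / \<epsilon>\<^sup>2" by (rule hub_cost_le_square_sum)
    also have "\<dots> \<le> 12 * c1 c / \<beta>\<^sup>2 * (2 * e / (2 * e - 1) * (1 / 2) powr (1 - 2 * e) * n powr (2 * e - 1)) / \<epsilon>\<^sup>2"
      using c1_pos by (intro divide_right_mono mult_left_mono square_sum_lt_2 g) simp_all
    also have "\<dots> = k1 * (n powr (2 / \<gamma> - 1) / \<epsilon>\<^sup>2)" unfolding k1_def C1_def by simp
    finally show ?thesis .
  qed
  moreover have "hub_cost j0 \<le> k2 * ((n * \<epsilon>) powr (1 / \<gamma>) / \<epsilon>\<^sup>2)"
    using hub_cost_le_interpolated[OF g(1), of j0] unfolding k2_def by simp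
  moreover have "k1 * z \<le> (k1 + k2) * z" "k2 * z \<le> (k1 + k2) * z" if "0 \<le> z" for z
    using that k by (simp_all add: mult_right_mono)
  ultimately have "hub_cost j0 \<le> (k1 + k2) * (n powr (2 / \<gamma> - 1) / \<epsilon>\<^sup>2)"
      "hub_cost j0 \<le> (k1 + k2) * ((n * \<epsilon>) powr (1 / \<gamma>) / \<epsilon>\<^sup>2)"
    by (meson order_trans zero_le_divide_iff powr_ge_zero zero_le_power2)+
  then have B: "hub_cost j0 \<le> (k1 + k2) * D" unfolding D_def Y_def by (simp add: min_def)
  have "1 + real (n_r c G \<epsilon> \<delta>) * (walk_const + tail_const * tail_cost j0) + 2 * hub_cost j0
      \<le> 2 * C * D + 10 * c1 c * (1 + a) * (walk_const * C + tail_const * C1 * C) * D + 2 * ((k1 + k2) * D)"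
    using one S B by linarith
  also have "\<dots> = (2 * C + 10 * c1 c * (1 + a) * (walk_const * C + tail_const * C1 * C) + 2 * (k1 + k2)) * D"
    by (simp only: distrib_right mult.assoc)
  finally show ?thesis
    using query_cost_bound[OF l(2), of j0]
    unfolding walk_const_def[symmetric] tail_const_def[symmetric] target C1_def[symmetric] k1_def[symmetric] k2_def[symmetric]
    by (meson ennreal_leI order_trans)
qed

end

text \<open>\<open>K\<close> is chosen before the graph and may depend only on \<open>c\<close>,
  \<gamma> and \<open>a\<close>, where \<open>a\<close> is the hidden exponent in the condition on
  \<delta>. The condition on \<epsilon> is imposed only where its exponent is defined, that is for
  \<open>\<gamma> \<noteq> 2\<close>, and the formula for \<open>j0\<close> only for
  \<open>\<gamma> \<noteq> 1\<close>.\<close>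

theorem theorem3p12:
  fixes c \<gamma> a :: real
  assumes "0 < c" and "c < 1" and "\<gamma> \<ge> 1" and "a > 0"
  shows "\<exists>K>0. \<forall>(G :: 'a pair_pre_digraph) w \<epsilon> \<delta> j0 n m d H.
    pair_fin_digraph G \<longrightarrow>
    n = real (num_nodes G) \<longrightarrow> m = real (num_edges G) \<longrightarrow> d = avg_deg G \<longrightarrow>
    pagerank_order c G w \<longrightarrow> power_law c G \<gamma> w \<longrightarrow>
    0 < \<epsilon> \<longrightarrow> \<epsilon> < 1 \<longrightarrow>
    (\<gamma> \<noteq> 2 \<longrightarrow> \<epsilon> \<ge> ln n powr ((\<gamma> - 1) / (2 - \<gamma>)) / (n powr ((\<gamma> - 1) / \<gamma>) * d powr (2 - \<gamma>))) \<longrightarrow>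
    \<delta> > 1 / n powr a \<longrightarrow> \<delta> < 1 \<longrightarrow>
    (\<gamma> \<noteq> 1 \<longrightarrow> j0 = n * (\<epsilon> * d) powr (\<gamma> / (\<gamma> - 1))) \<longrightarrow>
    H = hub_nodes G w j0 \<longrightarrow>
      (\<gamma> > 2 \<longrightarrow>
         expected_query_cost c G H \<epsilon> \<delta> \<le> ennreal (K * (1 / \<epsilon>\<^sup>2 * ln (n / \<delta>)))) \<and>
      (\<gamma> = 2 \<longrightarrow>
         expected_query_cost c G H \<epsilon> \<delta> \<le> ennreal (K * (1 / \<epsilon>\<^sup>2 * ln (n / \<delta>) * ln n))) \<and>
      (1 < \<gamma> \<and> \<gamma> < 2 \<longrightarrow>
         expected_query_cost c G H \<epsilon> \<delta> \<le>
           ennreal (K * min (n powr (1 / \<gamma>) / \<epsilon> powr (2 - 1 / \<gamma>))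
                            (n powr (2 / \<gamma> - 1) / \<epsilon>\<^sup>2))) \<and>
      finite (index_tuples c G H \<epsilon>) \<and> real (card (index_tuples c G H \<epsilon>)) \<le> K * m \<and>
      preprocessing_cost c G H \<epsilon> \<le> ennreal (K * (m / \<epsilon>))"
proof -
  define \<beta> where "\<beta> = 1 - sqrt c"
  define A0 where "A0 = 4 / \<beta>\<^sup>2 + 3"
  define A1 where "A1 = 7 / \<beta>"
  \<comment> \<open>One \<open>C\<close> is wanted in all regimes so that \<open>K\<close> can be
    defined uniformly; outside \<open>1 < \<gamma> < 2\<close> the condition is vacuous and 1
    serves.\<close>
  obtain C where C: "C > 0"
    and log: "\<And>n d \<epsilon>. 1 < \<gamma> \<Longrightarrow> \<gamma> < 2 \<Longrightarrow> 2 \<le> n \<Longrightarrow> 1 / 3 \<le> d \<Longrightarrow> d \<le> n \<Longrightarrow> 0 < \<epsilon> \<Longrightarrow>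
       \<epsilon> \<ge> ln n powr ((\<gamma> - 1) / (2 - \<gamma>)) / (n powr ((\<gamma> - 1) / \<gamma>) * d powr (2 - \<gamma>)) \<Longrightarrow>
       ln n \<le> C * min (n powr (2 / \<gamma> - 1)) ((n * \<epsilon>) powr (1 / \<gamma>)) \<and>
       ln n * (\<epsilon> * d) powr (- ((2 - \<gamma>) / (\<gamma> - 1))) \<le> C * min (n powr (2 / \<gamma> - 1)) ((n * \<epsilon>) powr (1 / \<gamma>))"
  proof (cases "1 < \<gamma> \<and> \<gamma> < 2")
    case True
    then obtain C where "C > 0"
      "\<And>n d \<epsilon>. 2 \<le> n \<Longrightarrow> 1 / 3 \<le> d \<Longrightarrow> d \<le> n \<Longrightarrow> 0 < \<epsilon> \<Longrightarrow>
       \<epsilon> \<ge> ln n powr ((\<gamma> - 1) / (2 - \<gamma>)) / (n powr ((\<gamma> - 1) / \<gamma>) * d powr (2 - \<gamma>)) \<Longrightarrow>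
       ln n \<le> C * min (n powr (2 / \<gamma> - 1)) ((n * \<epsilon>) powr (1 / \<gamma>)) \<and>
       ln n * (\<epsilon> * d) powr (- ((2 - \<gamma>) / (\<gamma> - 1))) \<le> C * min (n powr (2 / \<gamma> - 1)) ((n * \<epsilon>) powr (1 / \<gamma>))"
      using log_absorption by metis
    then show ?thesis using that by blast
  next
    case False
    show ?thesis by (rule that[of 1]) (use False in auto)
  qed
  define K1 where "K1 = 2 + 10 * c1 c * (A0 + A1 * (1 / (1 - 2 * (1 / \<gamma>)))) + 48 * c1 c / \<beta>\<^sup>2 * (1 / (1 - 2 * (1 / \<gamma>)))"
  define K2 where "K2 = 4 + 10 * c1 c * (2 * A0 + 3 * A1) + 144 * c1 c / \<beta>\<^sup>2"
  define K3 where "K3 = 2 * C + 10 * c1 c * (1 + a) * (A0 * C + A1 * (2 * (1 / \<gamma>) / (2 * (1 / \<gamma>) - 1)) * C)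
         + 2 * (12 * c1 c / \<beta>\<^sup>2 * (2 * (1 / \<gamma>) / (2 * (1 / \<gamma>) - 1) * (1 / 2) powr (1 - 2 * (1 / \<gamma>))) + 12 * c1 c / (\<beta>\<^sup>2 * (1 - 1 / \<gamma>)\<^sup>2))"
  define K4 where "K4 = 12 / \<beta>\<^sup>2 * (if \<gamma> = 1 then 1 else 1 / (1 - 1 / \<gamma>))"
  define K5 where "K5 = 128 / \<beta>^3"
  \<comment> \<open>A constant outside its own regime may be negative, as \<open>K1\<close> can be
    for \<open>\<gamma> < 2\<close>; absolute values make the sum dominate each of them.\<close>
  define K where "K = 1 + \<bar>K1\<bar> + \<bar>K2\<bar> + \<bar>K3\<bar> + \<bar>K4\<bar> + \<bar>K5\<bar>"
  have K: "K1 \<le> K" "K2 \<le> K" "K3 \<le> K" "K4 \<le> K" "K5 \<le> K" "0 < K" unfolding K_def by linarith+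
  show ?thesis
  proof (intro exI conjI allI impI)
    show "0 < K" by (rule K)
    fix G :: "'a pair_pre_digraph" and w \<epsilon> \<delta> j0 n m d H
    assume G: "pair_fin_digraph G" and n: "n = real (num_nodes G)" and m: "m = real (num_edges G)"
      and d: "d = avg_deg G" and ord: "pagerank_order c G w" and pl: "power_law c G \<gamma> w"
      and eps: "0 < \<epsilon>" "\<epsilon> < 1"
      and lower: "\<gamma> \<noteq> 2 \<longrightarrow> \<epsilon> \<ge> ln n powr ((\<gamma> - 1) / (2 - \<gamma>)) / (n powr ((\<gamma> - 1) / \<gamma>) * d powr (2 - \<gamma>))"
      and \<delta>: "\<delta> > 1 / n powr a" "\<delta> < 1"
      and j0: "\<gamma> \<noteq> 1 \<longrightarrow> j0 = n * (\<epsilon> * d) powr (\<gamma> / (\<gamma> - 1))" and H: "H = hub_nodes G w j0"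
    \<comment> \<open>An empty graph would make the normalizing sum 0, and a single node would
      require \<open>1 < \<delta> < 1\<close>.\<close>
    have "num_nodes G \<noteq> 0"
    proof
      assume "num_nodes G = 0"
      with pl show False by (simp add: power_law_def)
    qed
    moreover have "num_nodes G \<noteq> 1" using \<delta> unfolding n by auto
    ultimately have "2 \<le> num_nodes G" by linarith
    then interpret power_law_graph G c \<epsilon> \<gamma> w
      using assms G eps ord pl
      by (auto intro!: power_law_graph.intro prsim_graph.intro walk_graph.intro
          walk_graph_axioms.intro prsim_graph_axioms.intro power_law_graph_axioms.intro)
    have n2: "2 \<le> n" and d3: "1 / 3 \<le> d" "d \<le> n" using n_ge_2 d_bounds unfolding n d by simp_all
    have \<delta>0: "0 < \<delta>" using \<delta>(1) n2 by (metis less_trans powr_gt_zero zero_less_divide_1_iff less_le_trans zero_less_numeral less_irrefl)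
    have lnd: "0 \<le> ln (n / \<delta>)" "0 \<le> ln n" using ln_n_delta_ge[OF \<delta>0 \<delta>(2)] n2 unfolding n by simp_all
    {
      assume "\<gamma> > 2"
      from query_bound_gt_2[OF this \<delta>0 \<delta>(2), of j0]
      have "expected_query_cost c G H \<epsilon> \<delta> \<le> ennreal (K1 * (1 / \<epsilon>\<^sup>2 * ln (n / \<delta>)))"
        unfolding H n K1_def \<beta>_def A0_def A1_def walk_const_def tail_const_def .
      also have "\<dots> \<le> ennreal (K * (1 / \<epsilon>\<^sup>2 * ln (n / \<delta>)))"
        using K lnd by (intro ennreal_leI mult_right_mono) simp_all
      finally show "expected_query_cost c G H \<epsilon> \<delta> \<le> \<dots>" .
    next
      assume "\<gamma> = 2"
      from query_bound_2[OF this \<delta>0 \<delta>(2), of j0]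
      have "expected_query_cost c G H \<epsilon> \<delta> \<le> ennreal (K2 * (1 / \<epsilon>\<^sup>2 * ln (n / \<delta>) * ln n))"
        unfolding H n K2_def \<beta>_def A0_def A1_def walk_const_def tail_const_def .
      also have "\<dots> \<le> ennreal (K * (1 / \<epsilon>\<^sup>2 * ln (n / \<delta>) * ln n))"
        using K lnd by (intro ennreal_leI mult_right_mono) simp_all
      finally show "expected_query_cost c G H \<epsilon> \<delta> \<le> \<dots>" .
    next
      assume g: "1 < \<gamma> \<and> \<gamma> < 2"
      then have g': "1 < \<gamma>" "\<gamma> < 2" by simp_all
      have "\<gamma> \<noteq> 2" "\<gamma> \<noteq> 1" using g' by simp_all
      note logs = log[OF g' n2 d3 eps(1) lower[rule_format, OF \<open>\<gamma> \<noteq> 2\<close>]]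
      from query_bound_lt_2[OF g' \<delta>[unfolded n] \<open>a > 0\<close> j0[rule_format, OF \<open>\<gamma> \<noteq> 1\<close>, unfolded n d] C
          logs[THEN conjunct1, unfolded n] logs[THEN conjunct2, unfolded n d]]
      have "expected_query_cost c G H \<epsilon> \<delta> \<le> ennreal (K3 * min (n powr (1 / \<gamma>) / \<epsilon> powr (2 - 1 / \<gamma>)) (n powr (2 / \<gamma> - 1) / \<epsilon>\<^sup>2))"
        unfolding H n K3_def \<beta>_def A0_def A1_def walk_const_def tail_const_def .
      also have "\<dots> \<le> ennreal (K * min (n powr (1 / \<gamma>) / \<epsilon> powr (2 - 1 / \<gamma>)) (n powr (2 / \<gamma> - 1) / \<epsilon>\<^sup>2))"
        using K by (intro ennreal_leI mult_right_mono) simp_all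
      finally show "expected_query_cost c G H \<epsilon> \<delta> \<le> \<dots>" .
    }
    \<comment> \<open>At \<open>\<gamma> = 1\<close> the exponents of \<open>ln n\<close> and
      \<open>n\<close> vanish and that of \<open>d\<close> is 1, so the condition on \<epsilon>
      reads \<open>1 / d \<le> \<epsilon>\<close>.\<close>
    have low1: "1 / avg_deg G \<le> \<epsilon>" if "\<gamma> = 1"
      using lower that n2 d3 unfolding n d by simp
    note index = index_bound[of j0, OF j0[rule_format, unfolded n d] low1]
    show "finite (index_tuples c G H \<epsilon>)" unfolding H using index(1) by simp
    have "real (card (index_tuples c G H \<epsilon>)) \<le> K4 * m"
      unfolding H m K4_def \<beta>_def using index(2) by simp
    also have "\<dots> \<le> K * m" using K unfolding m by (intro mult_right_mono) simp_all
    finally show "real (card (index_tuples c G H \<epsilon>)) \<le> K * m" .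
    have "preprocessing_cost c G H \<epsilon> \<le> ennreal (K5 * (m / \<epsilon>))"
      using preprocessing_bound unfolding H m K5_def \<beta>_def .
    also have "\<dots> \<le> ennreal (K * (m / \<epsilon>))"
      using K eps unfolding m by (intro ennreal_leI mult_right_mono) simp_all
    finally show "preprocessing_cost c G H \<epsilon> \<le> ennreal (K * (m / \<epsilon>))" .
  qed
qed

end
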